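(* Let $1\le q<\infty$. Assume that $|F|\in L^1_{\mathrm{loc}}(\Omega_T)$ and that $u\in L^q_{\mathrm{loc}}(0,T;W^{1,q}_{\mathrm{loc}}(\Omega;\mathbb{R}^N))$ satisfies $$\iint_{\Omega_T}\bigl(-u\cdot\varphi_t+\mathcal{A}(z,\nabla u)\cdot\nabla\varphi\bigr)\,dz=\iint_{\Omega_T}F\cdot\nabla\varphi\,dz$$ for every $\varphi\in C_0^\infty(\Omega_T;\mathbb{R}^N)$. Then there exists a constant $c=c(n,q,L)$ such that $$\frac1{|Q|}\iint_{Q}\frac{|u-u_{Q}|^{q}}{\rho^{q}}\,dz\le c\,\frac1{|Q|}\iint_{Q}|\nabla u|^{q}\,dz+c\left(\frac1{|Q|}\iint_{Q}|F|\,dz\right)^{q}$$ for every parabolic cylinder $Q=Q_\rho$ with $Q\Subset\Omega_T$.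
   Context: $\Omega\subset\mathbb{R}^n$, $n\ge1$, is a bounded open domain, $T>0$, $\Omega_T=\Omega\times(0,T)$, $N\ge1$, $0<\nu<L<\infty$. $\mathcal{A}:\Omega_T\times\mathbb{R}^{Nn}\to\mathbb{R}^{Nn}$ is a Carathéodory vector field ($\mathcal{A}(\cdot,\xi)$ measurable for every $\xi$, $\mathcal{A}(z,\cdot)$ continuous for a.e. $z$) with $\nu|\xi|^2\le\mathcal{A}(z,\xi)\cdot\xi$ and $|\mathcal{A}(z,\xi)|\le L|\xi|$ for a.e. $z\in\Omega_T$ and every $\xi\in\mathbb{R}^{Nn}$. $F:\Omega_T\to\mathbb{R}^{Nn}$ is measurable. We write $z=(x,t)$, $dz=dx\,dt$, and $\nabla$ is the gradient in $x$. $u\in L^q_{\mathrm{loc}}(0,T;W^{1,q}_{\mathrm{loc}}(\Omega;\mathbb{R}^N))$ means that for all $\Omega'\Subset\Omega$ and $0<t_1<t_2<T$ one has $u(\cdot,t)\in W^{1,q}(\Omega';\mathbb{R}^N)$ for a.e. $t\in(t_1,t_2)$ and $\int_{t_1}^{t_2}\int_{\Omega'}(|u|^q+|\nabla u|^q)\,dx\,dt<\infty$. A parabolic cylinder of radius $\rho>0$ centered at $(x_0,t_0)$ is $Q_\rho=B_\rho(x_0)\times(t_0-\rho^2,t_0+\rho^2)$. $u_Q=\frac1{|Q|}\iint_Q u\,dz$ (componentwise). $Q\Subset\Omega_T$ means that the closure of $Q$ is a compact subset of $\Omega_T$. *)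

theory Defs
  imports "HOL-Analysis.Analysis"
begin

text \<open>
  The space dimension $n$ is the type-level dimension of \<^typ>\<open>real^'n\<close>, but the number $N$ of
  components is a natural number: the constant in the theorem must not depend on $N$, so $N$ has to
  be quantified inside the formula. As in \<^const>\<open>Euclidean_space\<close>, elements of $R^N$ are functions
  \<^typ>\<open>nat \<Rightarrow> real\<close> that vanish from index \<open>N\<close> on; elements of $R^{Nn}$ are likewise functions
  \<^typ>\<open>nat \<Rightarrow> real^'n\<close> (row \<open>i\<close> of a gradient is the gradient of the \<open>i\<close>-th component). The product
  topology restricted to \<open>vecs N\<close> is the Euclidean one.
\<close>

definition vecs :: "nat \<Rightarrow> (nat \<Rightarrow> 'b::zero) set"
  where "vecs N = {v. \<forall>i\<ge>N. v i = 0}"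

definition vinner :: "nat \<Rightarrow> (nat \<Rightarrow> 'b::real_inner) \<Rightarrow> (nat \<Rightarrow> 'b) \<Rightarrow> real"
  where "vinner N v w = (\<Sum>i<N. v i \<bullet> w i)"

definition vnorm :: "nat \<Rightarrow> (nat \<Rightarrow> 'b::real_normed_vector) \<Rightarrow> real"
  where "vnorm N v = L2_set (\<lambda>i. norm (v i)) {..<N}"

definition vmeasurable :: "nat \<Rightarrow> 'a measure \<Rightarrow> ('a \<Rightarrow> nat \<Rightarrow> 'b::topological_space) \<Rightarrow> bool"
  where "vmeasurable N M f \<longleftrightarrow> (\<forall>i<N. (\<lambda>z. f z i) \<in> borel_measurable M)"

definition compactly_contained :: "'a::topological_space set \<Rightarrow> 'a set \<Rightarrow> bool"
  where "compactly_contained U V \<longleftrightarrow> compact (closure U) \<and> closure U \<subseteq> V"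

definition locally_integrable_on ::
    "('a::euclidean_space \<Rightarrow> 'b::euclidean_space) \<Rightarrow> 'a set \<Rightarrow> bool"
  where "locally_integrable_on f U \<longleftrightarrow>
    (\<forall>K. compact K \<and> K \<subseteq> U \<longrightarrow> f absolutely_integrable_on K)"

definition avg :: "'a::euclidean_space set \<Rightarrow> ('a \<Rightarrow> real) \<Rightarrow> real"
  where "avg Q f = (LINT z|lebesgue_on Q. f z) / measure lebesgue Q"


fun C_k :: "nat \<Rightarrow> ('a::real_normed_vector \<Rightarrow> 'b::real_normed_vector) \<Rightarrow> bool"
  where
    "C_k 0 f \<longleftrightarrow> continuous_on UNIV f"
  | "C_k (Suc k) f \<longleftrightarrow>
      (\<forall>x. f differentiable (at x)) \<and> (\<forall>v. C_k k (\<lambda>x. frechet_derivative f (at x) v))"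

text \<open>Test functions on \<open>U\<close> are regarded as functions on the whole space, extended by zero.\<close>

definition test_functions :: "'a::euclidean_space set \<Rightarrow> ('a \<Rightarrow> real) set"
  where "test_functions U =
    {\<phi>. (\<forall>k. C_k k \<phi>) \<and> compact (closure {x. \<phi> x \<noteq> 0}) \<and> closure {x. \<phi> x \<noteq> 0} \<subseteq> U}"

definition vec_test_functions :: "nat \<Rightarrow> 'a::euclidean_space set \<Rightarrow> ('a \<Rightarrow> nat \<Rightarrow> real) set"
  where "vec_test_functions N U =
    {\<phi>. (\<forall>z. \<phi> z \<in> vecs N) \<and> (\<forall>i<N. (\<lambda>z. \<phi> z i) \<in> test_functions U)}"

definition grad :: "(real^'n \<Rightarrow> real) \<Rightarrow> real^'n \<Rightarrow> real^'n"
  where "grad f x = (\<chi> j. frechet_derivative f (at x) (axis j 1))"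

definition space_grad :: "((real^'n) \<times> real \<Rightarrow> nat \<Rightarrow> real) \<Rightarrow> (real^'n) \<times> real \<Rightarrow> nat \<Rightarrow> real^'n"
  where "space_grad \<phi> z i = grad (\<lambda>x. \<phi> (x, snd z) i) (fst z)"

definition time_deriv :: "((real^'n) \<times> real \<Rightarrow> nat \<Rightarrow> real) \<Rightarrow> (real^'n) \<times> real \<Rightarrow> nat \<Rightarrow> real"
  where "time_deriv \<phi> z i = deriv (\<lambda>t. \<phi> (fst z, t) i) (snd z)"


definition has_weak_gradient_on ::
    "(real^'n \<Rightarrow> real) \<Rightarrow> (real^'n \<Rightarrow> real^'n) \<Rightarrow> (real^'n) set \<Rightarrow> bool"
  where "has_weak_gradient_on f g U \<longleftrightarrow>
    locally_integrable_on f U \<and> locally_integrable_on g U \<and>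
    (\<forall>\<phi>\<in>test_functions U.
      (LINT x|lebesgue_on U. f x *\<^sub>R grad \<phi> x) = - (LINT x|lebesgue_on U. \<phi> x *\<^sub>R g x))"

text \<open>\<open>f\<close> belongs to $W^{1,q}(U;R^N)$ and \<open>g\<close> is (a representative of) its weak gradient.\<close>

definition W1q_with_gradient ::
    "nat \<Rightarrow> real \<Rightarrow> (real^'n) set \<Rightarrow> (real^'n \<Rightarrow> nat \<Rightarrow> real) \<Rightarrow> (real^'n \<Rightarrow> nat \<Rightarrow> real^'n) \<Rightarrow> bool"
  where "W1q_with_gradient N q U f g \<longleftrightarrow>
    vmeasurable N (lebesgue_on U) f \<and> vmeasurable N (lebesgue_on U) g \<and>
    integrable (lebesgue_on U) (\<lambda>x. vnorm N (f x) powr q) \<and>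
    integrable (lebesgue_on U) (\<lambda>x. vnorm N (g x) powr q) \<and>
    (\<forall>i<N. has_weak_gradient_on (\<lambda>x. f x i) (\<lambda>x. g x i) U)"

text \<open>
  \<open>u\<close> belongs to $L^q_{loc}(0,T;W^{1,q}_{loc}(\Omega;R^N))$ and \<open>Du\<close> is its spatial gradient.
  The gradient is determined almost everywhere by \<open>u\<close>; it is carried along as a function because
  its slicewise representatives have to be chosen jointly measurable in space-time.
\<close>

definition parabolic_sobolev ::
    "nat \<Rightarrow> real \<Rightarrow> (real^'n) set \<Rightarrow> real \<Rightarrow>
     ((real^'n) \<times> real \<Rightarrow> nat \<Rightarrow> real) \<Rightarrow> ((real^'n) \<times> real \<Rightarrow> nat \<Rightarrow> real^'n) \<Rightarrow> bool"
  where "parabolic_sobolev N q \<Omega> T u Du \<longleftrightarrow>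
    u \<in> \<Omega> \<times> {0<..<T} \<rightarrow> vecs N \<and> Du \<in> \<Omega> \<times> {0<..<T} \<rightarrow> vecs N \<and>
    vmeasurable N (lebesgue_on (\<Omega> \<times> {0<..<T})) u \<and>
    vmeasurable N (lebesgue_on (\<Omega> \<times> {0<..<T})) Du \<and>
    (\<forall>\<Omega>' t1 t2. open \<Omega>' \<and> compactly_contained \<Omega>' \<Omega> \<and> 0 < t1 \<and> t1 < t2 \<and> t2 < T \<longrightarrow>
      (AE t in lebesgue_on {t1<..<t2}.
        W1q_with_gradient N q \<Omega>' (\<lambda>x. u (x, t)) (\<lambda>x. Du (x, t))) \<and>
      integrable (lebesgue_on (\<Omega>' \<times> {t1<..<t2}))
        (\<lambda>z. vnorm N (u z) powr q + vnorm N (Du z) powr q))"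


definition caratheodory_field ::
    "nat \<Rightarrow> 'a::euclidean_space set \<Rightarrow> ('a \<Rightarrow> (nat \<Rightarrow> real^'n) \<Rightarrow> nat \<Rightarrow> real^'n) \<Rightarrow> bool"
  where "caratheodory_field N D A \<longleftrightarrow>
    (\<forall>z\<in>D. A z \<in> vecs N \<rightarrow> vecs N) \<and>
    (\<forall>\<xi>\<in>vecs N. vmeasurable N (lebesgue_on D) (\<lambda>z. A z \<xi>)) \<and>
    (AE z in lebesgue_on D. continuous_on (vecs N) (A z))"

definition structure_conditions ::
    "nat \<Rightarrow> real \<Rightarrow> real \<Rightarrow> 'a::euclidean_space set \<Rightarrow>
     ('a \<Rightarrow> (nat \<Rightarrow> real^'n) \<Rightarrow> nat \<Rightarrow> real^'n) \<Rightarrow> bool"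
  where "structure_conditions N \<nu> L D A \<longleftrightarrow>
    (AE z in lebesgue_on D. \<forall>\<xi>\<in>vecs N.
      \<nu> * (vnorm N \<xi>)\<^sup>2 \<le> vinner N (A z \<xi>) \<xi> \<and> vnorm N (A z \<xi>) \<le> L * vnorm N \<xi>)"

definition weak_solution ::
    "nat \<Rightarrow> ((real^'n) \<times> real) set \<Rightarrow>
     ((real^'n) \<times> real \<Rightarrow> (nat \<Rightarrow> real^'n) \<Rightarrow> nat \<Rightarrow> real^'n) \<Rightarrow>
     ((real^'n) \<times> real \<Rightarrow> nat \<Rightarrow> real^'n) \<Rightarrow>
     ((real^'n) \<times> real \<Rightarrow> nat \<Rightarrow> real) \<Rightarrow> ((real^'n) \<times> real \<Rightarrow> nat \<Rightarrow> real^'n) \<Rightarrow> bool"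
  where "weak_solution N D A F u Du \<longleftrightarrow>
    (\<forall>\<phi>\<in>vec_test_functions N D.
      (LINT z|lebesgue_on D.
         - vinner N (u z) (time_deriv \<phi> z) + vinner N (A z (Du z)) (space_grad \<phi> z)) =
      (LINT z|lebesgue_on D. vinner N (F z) (space_grad \<phi> z)))"

definition cylinder :: "real \<Rightarrow> real^'n \<Rightarrow> real \<Rightarrow> ((real^'n) \<times> real) set"
  where "cylinder \<rho> x0 t0 = ball x0 \<rho> \<times> {t0 - \<rho>\<^sup>2<..<t0 + \<rho>\<^sup>2}"

end

theory Submission
  imports Defs
begin

text \<open>
Let \<open>Q = B \<times> I\<close> be a cylinder of radius \<open>\<rho>\<close>, and fix a smooth cutoff \<open>\<eta>\<close> supported in \<open>B\<close> with
\<open>0 \<le> \<eta> \<le> 1\<close>, \<open>|grad \<eta>| \<le> 1/\<rho>\<close> and \<open>m = \<integral> \<eta>\<close> comparable to \<open>|B|\<close>. The function \<open>u\<close> is compared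
with its weighted space averages \<open>w(t) = (1/m) \<integral> u(x,t) \<eta>(x) dx\<close>, and these with the single vector \<open>w(s)\<close>
for a suitable time \<open>s\<close>.

On almost every time slice, a Poincare inequality with weight \<open>\<eta>\<close> bounds \<open>\<integral>\<^sub>B |u(x,t) - w(t)|\<^sup>q dx\<close> by a
constant times \<open>\<rho>\<^sup>q \<integral>\<^sub>B |grad u|\<^sup>q dx\<close> (\<open>weighted_poincare\<close>). In time nothing is known about \<open>u\<close> except the
system. Testing it with \<open>\<eta>(x) \<theta>(t)\<close> in one component shows that \<open>m w\<close> has the weak derivative
\<open>- \<integral> (A(z, grad u) - F) grad \<eta> dx\<close>. Hence \<open>w\<close> oscillates on \<open>I\<close> by at most
\<open>(1/(m \<rho>)) \<integral>\<^sub>Q |A(z, grad u) - F| dz\<close>, which is at most a constant times \<open>\<rho>\<close> times the mean over \<open>Q\<close> of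
\<open>L |grad u| + |F|\<close> (\<open>time_increment_le\<close>). This is why only an average of \<open>|F|\<close> is needed, whatever \<open>q\<close> is.
The two bounds add up in \<open>cylinder_oscillation\<close>, and replacing \<open>w(s)\<close> by the mean of \<open>u\<close> over \<open>Q\<close> costs
only a factor (\<open>oscillation_about_mean_le\<close>).

Both steps rest on one fact, \<open>weak_derivative_imp_increment\<close>: if \<open>g\<close> is the weak derivative of \<open>f\<close> in
the direction \<open>v\<close>, then \<open>f(x + v) - f(x)\<close> is the integral of \<open>g(x + s v)\<close> over \<open>0 \<le> s \<le> 1\<close> for almost
every \<open>x\<close>. It follows from Fubini and the fundamental lemma of the calculus of variations, with
no mollification. It is applied on time slices with \<open>v\<close> a space vector, and to \<open>m w\<close> with \<open>v\<close> a time shift.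

The constant does not depend on the number \<open>N\<close> of components because the components are never
estimated one by one: the Euclidean norm of the whole vector is moved under integrals by
\<open>vnorm_integral_le\<close>.

The data are Lebesgue measurable, while Fubini's theorem is used for the product of Borel
measures. The estimates up to \<open>cylinder_oscillation\<close> are therefore proved for Borel functions, which
then replace the data almost everywhere; the composition \<open>A(z, grad u(z))\<close> is measurable by the Caratheodory condition.
\<close>

section \<open>Smooth functions and bumps\<close>

declare C_k.simps(2) [simp del]

lemma C_k_SucI:
  assumes "\<And>x. (f has_derivative D x) (at x)"
    and "\<And>v. C_k k (\<lambda>x. D x v)"
  shows "C_k (Suc k) f"
proof -
  have "frechet_derivative f (at x) = D x" for x
    using frechet_derivative_at[OF assms(1)] by simp
  then show ?thesis
    using assms by (auto simp: differentiable_def C_k.simps(2))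
qed

lemma C_k_SucD:
  assumes "C_k (Suc k) f"
  shows "(f has_derivative frechet_derivative f (at x)) (at x)"
    and "C_k k (\<lambda>x. frechet_derivative f (at x) v)"
  using assms by (auto simp: frechet_derivative_works C_k.simps(2))

lemma C_k_Suc_imp: "C_k (Suc k) f \<Longrightarrow> C_k k f"
proof (induction k arbitrary: f)
  case 0
  then show ?case
    by (simp add: C_k.simps(2) differentiable_imp_continuous_on differentiable_on_def
        differentiable_at_withinI)
next
  case (Suc k)
  then show ?case
    by (metis C_k.simps(2))
qed

lemma C_k_const: "C_k k (\<lambda>x. c)"
proof (induction k arbitrary: c)
  case (Suc k)
  then show ?case
    by (intro C_k_SucI[where D="\<lambda>x v. 0"]) auto
qed simp

lemma C_k_add: "C_k k f \<Longrightarrow> C_k k g \<Longrightarrow> C_k k (\<lambda>x. f x + g x)"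
proof (induction k arbitrary: f g)
  case 0
  then show ?case by (simp add: continuous_on_add)
next
  case (Suc k)
  show ?case
    by (rule C_k_SucI[where D="\<lambda>x v. frechet_derivative f (at x) v + frechet_derivative g (at x) v"])
      (auto intro!: Suc.IH C_k_SucD(2) Suc.prems has_derivative_add C_k_SucD(1))
qed

lemma C_k_mult:
  fixes f g :: "'a::real_normed_vector \<Rightarrow> real"
  shows "C_k k f \<Longrightarrow> C_k k g \<Longrightarrow> C_k k (\<lambda>x. f x * g x)"
proof (induction k arbitrary: f g)
  case 0
  then show ?case by (simp add: continuous_on_mult)
next
  case (Suc k)
  show ?case
  proof (rule C_k_SucI[where D="\<lambda>x v. f x * frechet_derivative g (at x) v + frechet_derivative f (at x) v * g x"])
    show "((\<lambda>x. f x * g x) has_derivative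
           (\<lambda>v. f x * frechet_derivative g (at x) v + frechet_derivative f (at x) v * g x)) (at x)" for x
      by (rule has_derivative_mult[OF C_k_SucD(1)[OF Suc.prems(1)] C_k_SucD(1)[OF Suc.prems(2)]])
    show "C_k k (\<lambda>x. f x * frechet_derivative g (at x) v + frechet_derivative f (at x) v * g x)" for v
      by (intro C_k_add Suc.IH C_k_SucD(2) Suc.prems C_k_Suc_imp)
  qed
qed

lemma C_k_minus:
  fixes f g :: "'a::real_normed_vector \<Rightarrow> real"
  shows "C_k k f \<Longrightarrow> C_k k g \<Longrightarrow> C_k k (\<lambda>x. f x - g x)"
  using C_k_add[of k f "\<lambda>x. (-1) * g x"] C_k_mult[OF C_k_const, of k g "-1"] by simp

lemma C_k_prod:
  fixes f :: "'i \<Rightarrow> 'a::real_normed_vector \<Rightarrow> real"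
  assumes "\<And>i. i \<in> I \<Longrightarrow> C_k k (f i)"
  shows "C_k k (\<lambda>x. \<Prod>i\<in>I. f i x)"
  using assms
  by (induction I rule: infinite_finite_induct) (auto intro!: C_k_mult C_k_const)

lemma C_k_bounded_linear: "bounded_linear f \<Longrightarrow> C_k k f"
proof (cases k)
  case (Suc m)
  assume "bounded_linear f"
  then show ?thesis
    unfolding Suc by (intro C_k_SucI[where D="\<lambda>x. f"] bounded_linear_imp_has_derivative C_k_const)
qed (simp add: linear_continuous_on)

lemma C_k_compose_linear:
  assumes "bounded_linear l" "C_k k f"
  shows "C_k k (\<lambda>x. f (c + l x))"
  using assms(2)
proof (induction k arbitrary: f)
  case 0
  then show ?case
    using continuous_on_compose2[of UNIV f UNIV "\<lambda>x. c + l x"]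
      continuous_on_add[OF continuous_on_const linear_continuous_on[OF assms(1)]] by simp
next
  case (Suc k)
  show ?case
  proof (rule C_k_SucI[where D="\<lambda>x v. frechet_derivative f (at (c + l x)) (l v)"])
    show "((\<lambda>x. f (c + l x)) has_derivative
           (\<lambda>v. frechet_derivative f (at (c + l x)) (l v))) (at x)" for x
    proof (rule has_derivative_compose[where g=f])
      show "((\<lambda>x. c + l x) has_derivative l) (at x)"
        using has_derivative_add[OF has_derivative_const[of c] bounded_linear_imp_has_derivative[OF assms(1)]]
        by simp
    qed (rule C_k_SucD(1)[OF Suc.prems])
    show "C_k k (\<lambda>x. frechet_derivative f (at (c + l x)) (l v))" for v
      by (rule Suc.IH[OF C_k_SucD(2)[OF Suc.prems]])
  qed
qed

lemma C_k_compose_real: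
  fixes h :: "real \<Rightarrow> real" and g :: "'a::real_normed_vector \<Rightarrow> real"
  assumes "C_k k h" "C_k k g"
  shows "C_k k (\<lambda>x. h (g x))"
  using assms
proof (induction k arbitrary: h)
  case 0
  then show ?case
    by (auto intro: continuous_on_compose2[of UNIV h UNIV g])
next
  case (Suc k)
  show ?case
  proof (rule C_k_SucI[where D="\<lambda>x v. frechet_derivative h (at (g x)) (frechet_derivative g (at x) v)"])
    show "((\<lambda>x. h (g x)) has_derivative
           (\<lambda>v. frechet_derivative h (at (g x)) (frechet_derivative g (at x) v))) (at x)" for x
      by (rule has_derivative_compose[OF C_k_SucD(1)[OF Suc.prems(2)] C_k_SucD(1)[OF Suc.prems(1)]])
    have *: "frechet_derivative h (at y) a = a * frechet_derivative h (at y) 1" for y a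
      using linear_cmul[OF has_derivative_linear[OF C_k_SucD(1)[OF Suc.prems(1)]], of y a 1] by simp
    have eq: "(\<lambda>x. frechet_derivative h (at (g x)) (frechet_derivative g (at x) v)) =
        (\<lambda>x. frechet_derivative g (at x) v * frechet_derivative h (at (g x)) 1)" for v
      by (intro ext) (rule *)
    show "C_k k (\<lambda>x. frechet_derivative h (at (g x)) (frechet_derivative g (at x) v))" for v
      unfolding eq
      by (rule C_k_mult[OF C_k_SucD(2)[OF Suc.prems(2)]
            Suc.IH[OF C_k_SucD(2)[OF Suc.prems(1)] C_k_Suc_imp[OF Suc.prems(2)]]])
  qed
qed

lemma C_k_exp: "C_k k (\<lambda>x::real. exp x)"
proof (induction k)
  case 0
  then show ?case by (simp add: continuous_on_exp continuous_on_id)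
next
  case (Suc k)
  show ?case
  proof (rule C_k_SucI[where D="\<lambda>x v. exp x * v"])
    show "(exp has_derivative (\<lambda>v. exp x * v)) (at x)" for x :: real
      using DERIV_exp has_field_derivative_def by blast
    show "C_k k (\<lambda>x. exp x * v)" for v :: real
      by (intro C_k_mult Suc C_k_const)
  qed
qed

text \<open>
The functions \<open>y\<^sup>-\<^sup>m exp(-1/y)\<close>, extended by zero to \<open>y \<le> 0\<close>. The exponent \<open>m\<close> is there because the
derivative of such a function is a combination of two others (\<open>flat_exp_has_derivative\<close>), so that
smoothness of all orders follows by induction for the whole family at once.
\<close>

definition flat_exp :: "nat \<Rightarrow> real \<Rightarrow> real"
  where "flat_exp m y = (if 0 < y then exp (- inverse y) * inverse y ^ m else 0)"

lemma flat_exp_tendsto_0: "(flat_exp m \<longlongrightarrow> 0) (at 0)"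
proof -
  have "((\<lambda>y. exp (- inverse y) * inverse y ^ m) \<longlongrightarrow> 0) (at_right (0::real))"
  proof -
    have "((\<lambda>y. inverse y ^ m / exp (inverse y)) \<longlongrightarrow> 0) (at_right (0::real))"
      by (rule filterlim_compose[OF tendsto_power_div_exp_0 filterlim_inverse_at_top_right])
    then show ?thesis
      by (simp add: exp_minus divide_inverse mult.commute)
  qed
  then have "(flat_exp m \<longlongrightarrow> 0) (at_right 0)"
    by (rule Lim_transform_eventually)
      (auto simp: eventually_at_filter flat_exp_def)
  moreover have "(flat_exp m \<longlongrightarrow> 0) (at_left 0)"
    by (rule tendsto_eventually) (auto simp: eventually_at_filter flat_exp_def)
  ultimately show ?thesis
    by (simp add: filterlim_split_at)
qed

lemma flat_exp_has_derivative:
  "(flat_exp m has_field_derivative (flat_exp (m + 2) y - real m * flat_exp (m + 1) y)) (at y)"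
proof (cases "y = 0")
  case True
  have "((\<lambda>z. flat_exp m z / z) \<longlongrightarrow> 0) (at 0)"
  proof (rule Lim_transform_eventually[OF flat_exp_tendsto_0[of "Suc m"]])
    show "\<forall>\<^sub>F z in at 0. flat_exp (Suc m) z = flat_exp m z / z"
      by (auto simp: flat_exp_def divide_inverse intro!: eventuallyI)
  qed
  then show ?thesis
    unfolding True has_field_derivative_iff by (simp add: flat_exp_def)
next
  case False
  show ?thesis
  proof (cases "0 < y")
    case True
    have "((\<lambda>y. exp (- inverse y) * inverse y ^ m) has_field_derivative
        (flat_exp (m + 2) y - real m * flat_exp (m + 1) y)) (at y)"
    proof (cases m)
      case 0
      show ?thesis
        using True unfolding 0
        by (auto intro!: derivative_eq_intros simp: flat_exp_def power2_eq_square)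
    next
      case (Suc k)
      show ?thesis
        using True unfolding Suc
        apply (auto intro!: derivative_eq_intros simp: flat_exp_def power2_eq_square algebra_simps)
        apply (cases k; simp)
        done
    qed
    then show ?thesis
    proof (rule has_field_derivative_transform_within_open)
      show "open {0::real<..}" "y \<in> {0<..}" using True by auto
    qed (auto simp: flat_exp_def)
  next
    case F: False
    have "((\<lambda>y. 0) has_field_derivative (flat_exp (m + 2) y - real m * flat_exp (m + 1) y)) (at y)"
      using F by (auto simp: flat_exp_def)
    then show ?thesis
    proof (rule has_field_derivative_transform_within_open)
      show "open {..<0::real}" "y \<in> {..<0}" using F False by auto
    qed (auto simp: flat_exp_def)
  qed
qed

lemma C_k_flat_exp: "C_k k (flat_exp m)"
proof (induction k arbitrary: m)
  case 0
  show ?case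
    using DERIV_continuous_on[OF has_field_derivative_at_within[OF flat_exp_has_derivative]] by simp
next
  case (Suc k)
  show ?case
    by (rule C_k_SucI[OF flat_exp_has_derivative[unfolded has_field_derivative_def]])
      (intro C_k_mult C_k_minus C_k_const Suc)
qed

text \<open>
The derivative of \<open>exp(-1/y)\<close> is at most one; this makes the gradient bound of the cutoff
function explicit.
\<close>

lemma flat_exp_2_le_1: "flat_exp 2 y \<le> 1"
proof (cases "0 < y")
  case True
  let ?z = "inverse y"
  have "1 + ?z / 2 + (?z/2)\<^sup>2 / 2 \<le> exp (?z / 2)"
    using True by (intro exp_lower_Taylor_quadratic) simp
  moreover have "0 \<le> (?z - 2)\<^sup>2"
    by simp
  ultimately have "?z \<le> exp (?z / 2)"
    unfolding power2_eq_square by (simp add: algebra_simps)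
  then have "?z ^ 2 \<le> exp (?z / 2) ^ 2"
    using True by (intro power_mono) auto
  also have "\<dots> = exp ?z" by (simp flip: exp_double)
  finally have "exp (- ?z) * ?z\<^sup>2 \<le> exp (- ?z) * exp ?z"
    by (intro mult_left_mono) auto
  also have "\<dots> = 1"
    by (simp flip: exp_add)
  finally show ?thesis
    using True by (simp add: flat_exp_def)
qed (simp add: flat_exp_def)

section \<open>Test functions\<close>

lemma test_functions_mono: "U \<subseteq> V \<Longrightarrow> \<phi> \<in> test_functions U \<Longrightarrow> \<phi> \<in> test_functions V"
  by (auto simp: test_functions_def)

lemma test_functionsI:
  fixes U :: "'a::euclidean_space set"
  assumes "\<And>k. C_k k \<phi>" "compact K" "K \<subseteq> U" "\<And>x. x \<notin> K \<Longrightarrow> \<phi> x = 0"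
  shows "\<phi> \<in> test_functions U"
proof -
  have "closure {x. \<phi> x \<noteq> 0} \<subseteq> K"
    using assms by (intro closure_minimal compact_imp_closed) auto
  then show ?thesis
    using assms by (auto simp: test_functions_def compact_closure intro: bounded_subset compact_imp_bounded
      intro: bounded_subset[OF compact_imp_bounded closure_subset[THEN subset_trans]])
qed

lemma test_functionsD:
  assumes "\<phi> \<in> test_functions U"
  shows "C_k k \<phi>"
    and "(\<phi> has_derivative frechet_derivative \<phi> (at x)) (at x)"
    and "continuous_on A \<phi>"
    and "x \<notin> U \<Longrightarrow> \<phi> x = 0"
proof -
  show *: "C_k k \<phi>" for k using assms by (auto simp: test_functions_def)
  show "(\<phi> has_derivative frechet_derivative \<phi> (at x)) (at x)"
    using *[of "Suc 0"] by (rule C_k_SucD(1))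
  show "continuous_on A \<phi>"
    using *[of 0] by (auto intro: continuous_on_subset)
  show "x \<notin> U \<Longrightarrow> \<phi> x = 0"
    using assms closure_subset[of "{x. \<phi> x \<noteq> 0}"] by (auto simp: test_functions_def)
qed

lemma test_functions_measurable [measurable_dest]:
  "\<phi> \<in> test_functions U \<Longrightarrow> \<phi> \<in> borel_measurable borel"
  by (intro borel_measurable_continuous_onI test_functionsD(3))

lemma test_functions_derivative:
  assumes "\<phi> \<in> test_functions U"
  shows "(\<lambda>x. frechet_derivative \<phi> (at x) v) \<in> test_functions U"
proof (rule test_functionsI)
  let ?K = "closure {x. \<phi> x \<noteq> 0}"
  show "compact ?K" "?K \<subseteq> U" using assms by (auto simp: test_functions_def)
  show "C_k k (\<lambda>x. frechet_derivative \<phi> (at x) v)" for k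
    using test_functionsD(1)[OF assms, of "Suc k"] by (rule C_k_SucD(2))
  fix x assume x: "x \<notin> ?K"
  have "(\<phi> has_derivative (\<lambda>_. 0)) (at x)"
  proof (rule has_derivative_transform_within_open[where s="- ?K"])
    show "\<And>y. y \<in> - ?K \<Longrightarrow> 0 = \<phi> y"
      using closure_subset[of "{x. \<phi> x \<noteq> 0}"] by force
  qed (use x in auto)
  then have "frechet_derivative \<phi> (at x) = (\<lambda>_. 0)"
    using frechet_derivative_at by metis
  then show "frechet_derivative \<phi> (at x) v = 0" by simp
qed

lemma test_functions_bounded:
  assumes "\<phi> \<in> test_functions U"
  obtains C where "0 < C" "\<And>x. \<bar>\<phi> x\<bar> \<le> C"
proof -
  let ?K = "closure {x. \<phi> x \<noteq> 0}"
  have "compact (\<phi> ` ?K)"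
    using assms by (intro compact_continuous_image test_functionsD(3)[OF assms]) (auto simp: test_functions_def)
  from compact_imp_bounded[OF this] obtain C where C: "0 < C" "\<And>x. x \<in> ?K \<Longrightarrow> norm (\<phi> x) \<le> C"
    unfolding bounded_pos by auto
  have "\<bar>\<phi> x\<bar> \<le> C" for x
  proof (cases "\<phi> x = 0")
    case False
    then have "x \<in> ?K" using closure_subset[of "{x. \<phi> x \<noteq> 0}"] by blast
    then show ?thesis using C(2) by fastforce
  qed (use C(1) in simp)
  with C show ?thesis using that by blast
qed

lemma integrable_mult_bounded:
  fixes f g :: "'a \<Rightarrow> real"
  assumes f: "integrable M f" and g: "g \<in> borel_measurable M" "\<And>x. \<bar>g x\<bar> \<le> C"
  shows "integrable M (\<lambda>x. f x * g x)"
proof (rule Bochner_Integration.integrable_bound)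
  show "integrable M (\<lambda>x. C * norm (f x))"
    using f by (intro integrable_mult_right integrable_norm)
  show "(\<lambda>x. f x * g x) \<in> borel_measurable M"
    using f g(1) by (intro borel_measurable_times) auto
  show "AE x in M. norm (f x * g x) \<le> norm (C * norm (f x))"
  proof (rule AE_I2)
    fix x
    have "\<bar>f x\<bar> * \<bar>g x\<bar> \<le> \<bar>f x\<bar> * \<bar>C\<bar>"
      using g(2)[of x] by (intro mult_left_mono) auto
    then show "norm (f x * g x) \<le> norm (C * norm (f x))"
      by (simp add: abs_mult mult.commute)
  qed
qed

lemma integrable_mult_test_function:
  assumes "integrable lborel f" "\<phi> \<in> test_functions U"
  shows "integrable lborel (\<lambda>x. f x * \<phi> x)"
proof -
  obtain C where "\<And>x. \<bar>\<phi> x\<bar> \<le> C" using test_functions_bounded[OF assms(2)] by blast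
  then show ?thesis
    using test_functions_measurable[OF assms(2)] by (intro integrable_mult_bounded[OF assms(1)]) auto
qed

lemma test_functions_translate:
  assumes "\<phi> \<in> test_functions V" "\<And>x. x \<in> V \<Longrightarrow> x + a \<in> U"
  shows "(\<lambda>x. \<phi> (x - a)) \<in> test_functions U"
proof (rule test_functionsI)
  let ?K = "closure {x. \<phi> x \<noteq> 0}"
  show "compact ((+) a ` ?K)" using assms by (auto simp: test_functions_def compact_translation)
  show "(+) a ` ?K \<subseteq> U" using assms by (auto simp: test_functions_def add.commute)
  show "C_k k (\<lambda>x. \<phi> (x - a))" for k
    using C_k_compose_linear[OF bounded_linear_ident test_functionsD(1)[OF assms(1)], of k "-a"] by simp
  fix x assume "x \<notin> (+) a ` ?K"
  then have "x - a \<notin> ?K" by (metis add.commute diff_add_cancel image_eqI)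
  then show "\<phi> (x - a) = 0" using closure_subset[of "{x. \<phi> x \<noteq> 0}"] by auto
qed

lemma test_functions_times:
  fixes \<eta> :: "'a::euclidean_space \<Rightarrow> real" and \<theta> :: "'b::euclidean_space \<Rightarrow> real"
  assumes "\<eta> \<in> test_functions U" "\<theta> \<in> test_functions V"
  shows "(\<lambda>z. \<eta> (fst z) * \<theta> (snd z)) \<in> test_functions (U \<times> V)"
proof (rule test_functionsI)
  let ?K = "closure {x. \<eta> x \<noteq> 0}" and ?L = "closure {x. \<theta> x \<noteq> 0}"
  show "compact (?K \<times> ?L)" "?K \<times> ?L \<subseteq> U \<times> V"
    using assms by (auto simp: test_functions_def compact_Times)
  show "C_k k (\<lambda>z. \<eta> (fst z) * \<theta> (snd z))" for k
    using C_k_compose_linear[OF bounded_linear_fst test_functionsD(1)[OF assms(1)], of k 0]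
      C_k_compose_linear[OF bounded_linear_snd test_functionsD(1)[OF assms(2)], of k 0]
    by (intro C_k_mult) simp_all
  fix z assume "z \<notin> ?K \<times> ?L"
  then show "\<eta> (fst z) * \<theta> (snd z) = 0"
    using closure_subset[of "{x. \<eta> x \<noteq> 0}"] closure_subset[of "{x. \<theta> x \<noteq> 0}"]
    by (auto simp: mem_Times_iff)
qed

section \<open>The fundamental lemma of the calculus of variations\<close>

text \<open>
If \<open>p \<ge> 0\<close> is smooth and positive exactly on the box, then \<open>1 - exp(-k p)\<close> vanishes outside the
box, stays below one, and tends to one inside. A product of one-dimensional bumps is such a \<open>p\<close>.
\<close>

lemma box_indicator_limit_of_test_functions:
  fixes a b :: "'a::euclidean_space"
  assumes "cbox a b \<subseteq> V"
  obtains \<phi> where "\<And>k::nat. \<phi> k \<in> test_functions V" "\<And>k x. \<bar>\<phi> k x\<bar> \<le> 1"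
    "\<And>x. (\<lambda>k. \<phi> k x) \<longlonglongrightarrow> indicator (box a b) x"
proof -
  define p where "p x = (\<Prod>i\<in>Basis. flat_exp 0 (x \<bullet> i - a \<bullet> i) * flat_exp 0 (b \<bullet> i - x \<bullet> i))" for x :: 'a
  have p_in: "0 < p x" if "x \<in> box a b" for x
    using that unfolding p_def by (intro prod_pos) (auto simp: flat_exp_def box_def)
  have p_out: "p x = 0" if "x \<notin> box a b" for x
    using that unfolding p_def by (auto simp: prod_zero_iff flat_exp_def box_def)
  have p_nonneg: "0 \<le> p x" for x
    using p_in[of x] p_out[of x] by (cases "x \<in> box a b") auto
  have smooth_inner: "C_k k (\<lambda>x::'a. flat_exp 0 (x \<bullet> i - a \<bullet> i))"
    "C_k k (\<lambda>x::'a. flat_exp 0 (b \<bullet> i - x \<bullet> i))" for k i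
    using C_k_compose_real[OF C_k_flat_exp C_k_minus[OF C_k_bounded_linear[OF bounded_linear_inner_left] C_k_const]]
      C_k_compose_real[OF C_k_flat_exp C_k_minus[OF C_k_const C_k_bounded_linear[OF bounded_linear_inner_left]]]
    by blast+
  have smooth_p: "C_k k p" for k
    unfolding p_def[abs_def] by (intro C_k_prod C_k_mult smooth_inner)
  define \<phi> where "\<phi> k x = 1 - exp (0 - real k * p x)" for k :: nat and x
  show ?thesis
  proof
    show "\<phi> k \<in> test_functions V" for k
    proof (rule test_functionsI[OF _ compact_cbox assms])
      show "C_k m (\<phi> k)" for m
        unfolding \<phi>_def[abs_def]
        by (rule C_k_minus[OF C_k_const C_k_compose_real[OF C_k_exp
                C_k_minus[OF C_k_const C_k_mult[OF C_k_const smooth_p]]]])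
      show "\<phi> k x = 0" if "x \<notin> cbox a b" for x
        using that p_out[of x] box_subset_cbox[of a b] by (auto simp: \<phi>_def)
    qed
    show "\<bar>\<phi> k x\<bar> \<le> 1" for k x
      using p_nonneg[of x] exp_ge_zero[of "- (real k * p x)"] by (simp add: \<phi>_def abs_le_iff del: exp_ge_zero)
    show "(\<lambda>k. \<phi> k x) \<longlonglongrightarrow> indicator (box a b) x" for x
    proof (cases "x \<in> box a b")
      case True
      have "filterlim (\<lambda>k. real k * p x) at_top sequentially"
        using filterlim_tendsto_pos_mult_at_top[OF tendsto_const p_in[OF True] filterlim_real_sequentially]
        by (simp add: mult.commute)
      then have "filterlim (\<lambda>k. - (real k * p x)) at_bot sequentially"
        by (simp add: filterlim_uminus_at_bot)
      then have "(\<lambda>k. exp (- (real k * p x))) \<longlonglongrightarrow> 0"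
        by (rule filterlim_compose[OF exp_at_bot])
      then have "(\<lambda>k. 1 - exp (- (real k * p x))) \<longlonglongrightarrow> 1 - 0"
        by (intro tendsto_intros)
      then show ?thesis using True by (simp add: \<phi>_def)
    next
      case False
      then show ?thesis using p_out[OF False] by (simp add: \<phi>_def)
    qed
  qed
qed

text \<open>
On a closed box inside \<open>V\<close>, the positive and the negative part of \<open>F\<close> are densities of finite
measures that agree on all boxes, a generating family closed under intersection. So the
measures coincide, and with them the densities.
\<close>

lemma integral_boxes_zero_imp_AE_zero:
  fixes F :: "'a::euclidean_space \<Rightarrow> real"
  assumes "open V" and F: "integrable lborel F"
    and zero: "\<And>a b. cbox a b \<subseteq> V \<Longrightarrow> (LINT x|lborel. F x * indicator (box a b) x) = 0"
  shows "AE x in lborel. x \<in> V \<longrightarrow> F x = 0"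
proof -
  note [measurable] = borel_measurable_integrable[OF F]
  have on_cbox: "AE x in lborel. x \<in> cbox c d \<longrightarrow> F x = 0" if cd: "cbox c d \<subseteq> V" for c d
  proof -
    define G where "G x = F x * indicator (box c d) x" for x
    have [measurable]: "G \<in> borel_measurable borel" unfolding G_def[abs_def] by measurable
    have G: "integrable lborel G"
      unfolding G_def[abs_def] by (rule integrable_real_mult_indicator[OF _ F]) auto
    let ?M = "density lborel (\<lambda>x. ennreal (G x))" and ?M' = "density lborel (\<lambda>x. ennreal (- G x))"
    let ?E = "range (\<lambda>(a, b). box a b::'a set)"
    have box_eq: "emeasure ?M X = emeasure ?M' X" if "X \<in> ?E" for X
    proof -
      obtain a b where X: "X = box a b" using \<open>X \<in> ?E\<close> by auto
      define l where "l = (\<Sum>i\<in>Basis. max (a\<bullet>i) (c\<bullet>i) *\<^sub>R i)"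
      define u where "u = (\<Sum>i\<in>Basis. min (b\<bullet>i) (d\<bullet>i) *\<^sub>R i)"
      have lu: "box a b \<inter> box c d = box l u" "cbox a b \<inter> cbox c d = cbox l u"
        by (simp_all add: box_Int_box Int_interval l_def u_def)
      have H: "integrable lborel (\<lambda>x. G x * indicator X x)"
        by (rule integrable_real_mult_indicator[OF _ G]) (auto simp: X)
      have "(LINT x|lborel. G x * indicator X x) = (LINT x|lborel. F x * indicator (box l u) x)"
        by (intro Bochner_Integration.integral_cong) (auto simp: G_def X lu(1)[symmetric] indicator_def)
      also have "\<dots> = 0"
        using lu(2) cd by (intro zero) auto
      finally have eq: "enn2real (\<integral>\<^sup>+x. ennreal (G x * indicator X x) \<partial>lborel) =
          enn2real (\<integral>\<^sup>+x. ennreal (- (G x * indicator X x)) \<partial>lborel)"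
        using real_lebesgue_integral_def[OF H] by simp
      have enn2real_inj: "enn2real a = enn2real b \<Longrightarrow> a \<noteq> \<infinity> \<Longrightarrow> b \<noteq> \<infinity> \<Longrightarrow> a = b" for a b
        by (cases a; cases b) auto
      have fin: "(\<integral>\<^sup>+x. ennreal (G x * indicator X x) \<partial>lborel) \<noteq> \<infinity>"
        "(\<integral>\<^sup>+x. ennreal (- (G x * indicator X x)) \<partial>lborel) \<noteq> \<infinity>"
        using H by (simp_all add: real_integrable_def)
      have "(\<integral>\<^sup>+x. ennreal (G x * indicator X x) \<partial>lborel) =
          (\<integral>\<^sup>+x. ennreal (- (G x * indicator X x)) \<partial>lborel)"
        by (rule enn2real_inj[OF eq fin])
      moreover have "emeasure ?M X = (\<integral>\<^sup>+x. ennreal (G x * indicator X x) \<partial>lborel)"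
        by (subst emeasure_density) (auto simp: X indicator_def intro!: nn_integral_cong)
      moreover have "emeasure ?M' X = (\<integral>\<^sup>+x. ennreal (- (G x * indicator X x)) \<partial>lborel)"
        by (subst emeasure_density) (auto simp: X indicator_def intro!: nn_integral_cong)
      ultimately show ?thesis by simp
    qed
    have "?M = ?M'"
    proof (rule measure_eqI_generator_eq)
      show "Int_stable ?E"
        by (auto simp: Int_stable_def box_Int_box)
      show "?E \<subseteq> Pow UNIV" "sets ?M = sigma_sets UNIV ?E" "sets ?M' = sigma_sets UNIV ?E"
        by (simp_all add: borel_eq_box)
      let ?A = "\<lambda>n::nat. box (- (real n *\<^sub>R One)) (real n *\<^sub>R One) :: 'a set"
      show "range ?A \<subseteq> ?E" "(\<Union>i. ?A i) = UNIV"
        unfolding UN_box_eq_UNIV by auto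
      have "emeasure ?M X \<le> (\<integral>\<^sup>+x. ennreal (G x) \<partial>lborel)" for X
        using emeasure_space[of ?M X] by (simp add: emeasure_density)
      moreover have "(\<integral>\<^sup>+x. ennreal (G x) \<partial>lborel) < \<infinity>"
        using G by (simp add: real_integrable_def less_top)
      ultimately show "emeasure ?M (?A i) \<noteq> \<infinity>" for i
        by (metis less_le_not_le order_le_less_trans)
    qed (rule box_eq)
    then have "AE x in lborel. ennreal (G x) = ennreal (- G x)"
      by (intro sigma_finite_measure.density_unique[OF lborel.sigma_finite_measure_axioms]) auto
    then have "AE x in lborel. x \<in> box c d \<longrightarrow> F x = 0"
    proof eventually_elim
      case (elim x)
      then show ?case
        by (auto simp: G_def) (smt (verit) ennreal_eq_0_iff ennreal_neg)
    qed
    moreover have "AE x in lborel. x \<notin> cbox c d - box c d"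
      using negligible_frontier_interval[of c d]
      by (intro AE_not_in) (simp add: negligible_iff_null_sets null_sets_completion_iff)
    ultimately show ?thesis by eventually_elim auto
  qed
  obtain D where D: "countable D" "\<And>X. X \<in> D \<Longrightarrow> \<exists>a b. X = cbox a b" "\<Union>D = V"
    using open_countable_Union_open_cbox[OF \<open>open V\<close>] by metis
  have "AE x in lborel. \<forall>X\<in>D. x \<in> X \<longrightarrow> F x = 0"
    unfolding AE_ball_countable[OF D(1)]
    using D on_cbox by (metis Union_upper)
  then show ?thesis
    by eventually_elim (use D(3) in auto)
qed

lemma fundamental_lemma_calculus_of_variations:
  fixes F :: "'a::euclidean_space \<Rightarrow> real"
  assumes "open V" and F: "integrable lborel F"
    and zero: "\<And>\<phi>. \<phi> \<in> test_functions V \<Longrightarrow> (LINT x|lborel. F x * \<phi> x) = 0"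
  shows "AE x in lborel. x \<in> V \<longrightarrow> F x = 0"
proof (rule integral_boxes_zero_imp_AE_zero[OF \<open>open V\<close> F])
  fix a b :: 'a assume "cbox a b \<subseteq> V"
  then obtain \<phi> where \<phi>: "\<And>k::nat. \<phi> k \<in> test_functions V" "\<And>k x. \<bar>\<phi> k x\<bar> \<le> 1"
    "\<And>x. (\<lambda>k. \<phi> k x) \<longlonglongrightarrow> indicator (box a b) x"
    using box_indicator_limit_of_test_functions by blast
  note [measurable] = borel_measurable_integrable[OF F] test_functions_measurable[OF \<phi>(1)]
  have "(\<lambda>k. LINT x|lborel. F x * \<phi> k x) \<longlonglongrightarrow> (LINT x|lborel. F x * indicator (box a b) x)"
  proof (rule integral_dominated_convergence[where w="\<lambda>x. norm (F x)"])
    show "AE x in lborel. norm (F x * \<phi> k x) \<le> norm (F x)" for k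
      using \<phi>(2)[of k] by (auto simp: abs_mult intro!: mult_left_le)
  qed (use F \<phi>(3) in \<open>auto intro!: tendsto_intros\<close>)
  then show "(LINT x|lborel. F x * indicator (box a b) x) = 0"
    using LIMSEQ_unique[OF _ tendsto_const] by (simp add: zero[OF \<phi>(1)])
qed

section \<open>Weak derivatives and translations\<close>

lemma nn_integral_lborel_translate:
  fixes a :: "'a::euclidean_space"
  assumes [measurable]: "f \<in> borel_measurable borel"
  shows "(\<integral>\<^sup>+x. f (x + a) \<partial>lborel) = (\<integral>\<^sup>+x. f x \<partial>lborel)"
proof -
  have "(\<integral>\<^sup>+x. f x \<partial>lborel) = (\<integral>\<^sup>+x. f x \<partial>distr lborel borel ((+) a))"
    by (simp add: lborel_distr_plus)
  also have "\<dots> = (\<integral>\<^sup>+x. f (a + x) \<partial>lborel)"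
    by (rule nn_integral_distr) auto
  finally show ?thesis by (simp add: add.commute)
qed

lemma
  fixes f :: "'a::euclidean_space \<Rightarrow> real"
  shows integrable_lborel_translate: "integrable lborel f \<Longrightarrow> integrable lborel (\<lambda>x. f (x + a))"
    and integral_lborel_translate: "f \<in> borel_measurable borel \<Longrightarrow> (LINT x|lborel. f (x + a)) = (LINT x|lborel. f x)"
proof -
  show "integrable lborel (\<lambda>x. f (x + a))" if "integrable lborel f"
  proof -
    have "integrable (distr lborel borel ((+) a)) f"
      using that by (simp add: lborel_distr_plus)
    from integrable_distr[OF _ this] show ?thesis by (simp add: add.commute)
  qed
  show "(LINT x|lborel. f (x + a)) = (LINT x|lborel. f x)" if "f \<in> borel_measurable borel"
  proof -
    have "(LINT x|lborel. f x) = (LINT x|distr lborel borel ((+) a). f x)"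
      by (simp add: lborel_distr_plus)
    also have "\<dots> = (LINT x|lborel. f (a + x))"
      using that by (intro integral_distr) auto
    finally show ?thesis by (simp add: add.commute)
  qed
qed

text \<open>
Tonelli, with translation invariance for each fixed \<open>s\<close>. The case \<open>v = 0\<close> gives functions of \<open>x\<close> alone
on the unit strip.
\<close>

lemma integrable_along_segments:
  fixes g :: "'a::euclidean_space \<Rightarrow> real"
  assumes g: "integrable lborel g"
  shows "integrable (lborel \<Otimes>\<^sub>M lborel) (\<lambda>(x, s). g (x + s *\<^sub>R v) * indicator {0..1::real} s)"
proof -
  have gm [measurable]: "g \<in> borel_measurable borel" using borel_measurable_integrable[OF g] by simp
  have m [measurable]: "(\<lambda>(x, s). g (x + s *\<^sub>R v) * indicator {0..1::real} s) \<in> borel_measurable (lborel \<Otimes>\<^sub>M lborel)"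
    by measurable
  show ?thesis
    unfolding integrable_iff_bounded
  proof
    have "(\<integral>\<^sup>+z. ennreal (norm (case z of (x, s) \<Rightarrow> g (x + s *\<^sub>R v) * indicator {0..1::real} s)) \<partial>(lborel \<Otimes>\<^sub>M lborel))
        = (\<integral>\<^sup>+s. \<integral>\<^sup>+x. ennreal (norm (g (x + s *\<^sub>R v) * indicator {0..1::real} s)) \<partial>lborel \<partial>lborel)"
      by (subst lborel_pair.nn_integral_snd[symmetric]) auto
    also have "\<dots> = (\<integral>\<^sup>+s. (\<integral>\<^sup>+x. ennreal (norm (g x)) \<partial>lborel) * indicator {0..1::real} s \<partial>lborel)"
    proof (rule nn_integral_cong)
      fix s :: real
      show "(\<integral>\<^sup>+x. ennreal (norm (g (x + s *\<^sub>R v) * indicator {0..1::real} s)) \<partial>lborel) =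
          (\<integral>\<^sup>+x. ennreal (norm (g x)) \<partial>lborel) * indicator {0..1::real} s"
        using nn_integral_lborel_translate[of "\<lambda>x. ennreal (norm (g x))" "s *\<^sub>R v"]
        by (auto simp: indicator_def)
    qed
    also have "\<dots> < \<infinity>"
      using g by (simp add: nn_integral_cmult integrable_iff_bounded)
    finally show "(\<integral>\<^sup>+z. ennreal (norm (case z of (x, s) \<Rightarrow> g (x + s *\<^sub>R v) * indicator {0..1::real} s)) \<partial>(lborel \<Otimes>\<^sub>M lborel)) < \<infinity>" .
  qed (rule m)
qed

lemma test_function_increment:
  assumes "\<phi> \<in> test_functions U"
  shows "(LINT s|lborel. frechet_derivative \<phi> (at (y - s *\<^sub>R v)) v * indicator {0..1::real} s) = \<phi> y - \<phi> (y - v)"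
proof -
  have "(LINT s|lborel. frechet_derivative \<phi> (at (y - s *\<^sub>R v)) v * indicator {0..1::real} s)
     = - \<phi> (y - 1 *\<^sub>R v) - (- \<phi> (y - 0 *\<^sub>R v))"
  proof (rule integral_FTC_Icc_real)
    fix s :: real
    have "((\<lambda>s. \<phi> (y - s *\<^sub>R v)) has_derivative
        (\<lambda>h. frechet_derivative \<phi> (at (y - s *\<^sub>R v)) (- (h *\<^sub>R v)))) (at s)"
      by (rule has_derivative_compose[OF _ test_functionsD(2)[OF assms]])
        (auto intro!: derivative_eq_intros)
    then have "((\<lambda>s. - \<phi> (y - s *\<^sub>R v)) has_derivative
        (\<lambda>h. - frechet_derivative \<phi> (at (y - s *\<^sub>R v)) (- (h *\<^sub>R v)))) (at s)"
      by (rule has_derivative_minus)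
    moreover have "linear (frechet_derivative \<phi> (at (y - s *\<^sub>R v)))"
      using has_derivative_linear[OF test_functionsD(2)[OF assms]] .
    ultimately show "((\<lambda>s. - \<phi> (y - s *\<^sub>R v)) has_real_derivative
        frechet_derivative \<phi> (at (y - s *\<^sub>R v)) v) (at s)"
      by (simp add: has_field_derivative_def linear_neg linear_cmul mult_commute_abs)
    have "continuous_on UNIV (\<lambda>s::real. frechet_derivative \<phi> (at (y - s *\<^sub>R v)) v)"
      by (rule continuous_on_compose2[OF test_functionsD(3)[OF test_functions_derivative[OF assms]]])
        (auto intro!: continuous_intros)
    then show "isCont (\<lambda>s::real. frechet_derivative \<phi> (at (y - s *\<^sub>R v)) v) s"
      by (simp add: continuous_on_eq_continuous_at)
  qed simp
  then show ?thesis by simp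
qed

text \<open>
Tested with \<open>\<phi>\<close>, the right-hand side becomes the integral over \<open>s\<close> of \<open>\<integral> g(y) \<phi>(y - s v) dy\<close>. Each
translate of \<open>\<phi>\<close> is admissible because \<open>U\<close> is convex, so the derivative falls on \<open>\<phi>\<close>; integration
over \<open>s\<close> then leaves \<open>\<integral> f(y) (\<phi>(y - v) - \<phi>(y)) dy\<close>, which is the left-hand side tested with \<open>\<phi>\<close>.
\<close>

lemma weak_derivative_imp_increment:
  fixes f g :: "'a::euclidean_space \<Rightarrow> real"
  assumes U: "open U" "convex U" and f: "integrable lborel f" and g: "integrable lborel g"
    and wd: "\<And>\<phi>. \<phi> \<in> test_functions U \<Longrightarrow>
      (LINT x|lborel. f x * frechet_derivative \<phi> (at x) v) = - (LINT x|lborel. g x * \<phi> x)"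
  shows "AE x in lborel. x \<in> U \<and> x + v \<in> U \<longrightarrow>
    f (x + v) - f x = (LINT s|lborel. g (x + s *\<^sub>R v) * indicator {0..1::real} s)"
proof -
  \<comment> \<open>the points whose whole segment in direction \<open>v\<close> stays in \<open>U\<close>\<close>
  define V where "V = U \<inter> (\<lambda>x. x + v) -` U"
  have "open V"
    unfolding V_def by (intro open_Int U open_vimage continuous_intros)
  have seg: "x + s *\<^sub>R v \<in> U" if "x \<in> V" "s \<in> {0..1}" for x and s :: real
  proof -
    have "(1 - s) *\<^sub>R x + s *\<^sub>R (x + v) \<in> U"
      using that U(2) by (intro convexD) (auto simp: V_def)
    then show ?thesis by (simp add: algebra_simps)
  qed
  note [measurable] = borel_measurable_integrable[OF f] borel_measurable_integrable[OF g]
  let ?S = "\<lambda>x. LINT s|lborel. g (x + s *\<^sub>R v) * indicator {0..1::real} s"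
  note seg_int = integrable_along_segments[OF g, of v]
  have S: "integrable lborel ?S"
    using lborel_pair.integrable_fst'[OF seg_int] by simp
  let ?F = "\<lambda>x. f (x + v) - f x - ?S x"
  have "AE x in lborel. x \<in> V \<longrightarrow> ?F x = 0"
  proof (rule fundamental_lemma_calculus_of_variations[OF \<open>open V\<close>])
    show "integrable lborel ?F"
      by (intro Bochner_Integration.integrable_diff integrable_lborel_translate f S)
    fix \<phi> assume \<phi>: "\<phi> \<in> test_functions V"
    note [measurable] = test_functions_measurable[OF \<phi>]
      test_functions_measurable[OF test_functions_derivative[OF \<phi>]]
    obtain C where C: "0 < C" "\<And>x. \<bar>\<phi> x\<bar> \<le> C" using test_functions_bounded[OF \<phi>] by blast
    obtain C' where C': "0 < C'" "\<And>x. \<bar>frechet_derivative \<phi> (at x) v\<bar> \<le> C'"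
      using test_functions_bounded[OF test_functions_derivative[OF \<phi>]] by blast
    let ?d = "\<lambda>x. frechet_derivative \<phi> (at x) v"
    have "integrable (lborel \<Otimes>\<^sub>M lborel) (\<lambda>z. (case z of (x, s) \<Rightarrow> g (x + s *\<^sub>R v) * indicator {0..1::real} s) * \<phi> (fst z))"
      using C(2) by (intro integrable_mult_bounded[OF seg_int]) measurable
    then have int1: "integrable (lborel \<Otimes>\<^sub>M lborel) (\<lambda>(x, s). g (x + s *\<^sub>R v) * indicator {0..1::real} s * \<phi> x)"
      by (simp add: case_prod_beta')
    have "integrable (lborel \<Otimes>\<^sub>M lborel) (\<lambda>(y, s). f (y + s *\<^sub>R 0) * indicator {0..1::real} s)"
      by (rule integrable_along_segments[OF f])
    then have "integrable (lborel \<Otimes>\<^sub>M lborel) (\<lambda>z. (case z of (y, s) \<Rightarrow> f (y + s *\<^sub>R 0) * indicator {0..1::real} s) *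
        ?d (fst z - snd z *\<^sub>R v))"
      using C'(2) by (intro integrable_mult_bounded) measurable
    then have int2: "integrable (lborel \<Otimes>\<^sub>M lborel) (\<lambda>(y, s). f y * (?d (y - s *\<^sub>R v) * indicator {0..1::real} s))"
      by (simp add: case_prod_beta' mult.assoc mult.commute[of "indicator _ _"])
    have slice: "(LINT x|lborel. g (x + s *\<^sub>R v) * indicator {0..1::real} s * \<phi> x) =
        - (LINT y|lborel. f y * (?d (y - s *\<^sub>R v) * indicator {0..1::real} s))" for s :: real
    proof (cases "s \<in> {0..1}")
      case True
      have \<phi>s: "(\<lambda>y. \<phi> (y - s *\<^sub>R v)) \<in> test_functions U"
        using seg True by (intro test_functions_translate[OF \<phi>]) auto
      have "((\<lambda>y. \<phi> (y - s *\<^sub>R v)) has_derivative frechet_derivative \<phi> (at (y - s *\<^sub>R v))) (at y)" for y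
      proof -
        have "((\<lambda>y. y - s *\<^sub>R v) has_derivative (\<lambda>h. h)) (at y)"
          by (auto intro!: derivative_eq_intros)
        from has_derivative_compose[OF this test_functionsD(2)[OF \<phi>]] show ?thesis
          by simp
      qed
      then have d: "frechet_derivative (\<lambda>y. \<phi> (y - s *\<^sub>R v)) (at y) = frechet_derivative \<phi> (at (y - s *\<^sub>R v))" for y
        using frechet_derivative_at by metis
      have "(LINT x|lborel. g (x + s *\<^sub>R v) * \<phi> x) = (LINT y|lborel. g y * \<phi> (y - s *\<^sub>R v))"
        using integral_lborel_translate[of "\<lambda>y. g y * \<phi> (y - s *\<^sub>R v)" "s *\<^sub>R v"] by simp
      also have "\<dots> = - (LINT y|lborel. f y * ?d (y - s *\<^sub>R v))"
        using wd[OF \<phi>s] by (simp add: d)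
      finally show ?thesis using True by simp
    qed simp
    have "(LINT x|lborel. ?S x * \<phi> x) =
        (LINT x|lborel. LINT s|lborel. g (x + s *\<^sub>R v) * indicator {0..1::real} s * \<phi> x)"
      by simp
    also have "\<dots> = (LINT s|lborel. LINT x|lborel. g (x + s *\<^sub>R v) * indicator {0..1::real} s * \<phi> x)"
      using lborel_pair.Fubini_integral[OF int1] by simp
    also have "\<dots> = - (LINT s|lborel. LINT y|lborel. f y * (?d (y - s *\<^sub>R v) * indicator {0..1::real} s))"
      unfolding slice by simp
    also have "\<dots> = - (LINT y|lborel. LINT s|lborel. f y * (?d (y - s *\<^sub>R v) * indicator {0..1::real} s))"
      using lborel_pair.Fubini_integral[OF int2] by simp
    also have "\<dots> = - (LINT y|lborel. f y * (\<phi> y - \<phi> (y - v)))"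
      by (simp add: test_function_increment[OF \<phi>])
    also have "\<dots> = (LINT y|lborel. f y * \<phi> (y - v) - f y * \<phi> y)"
      by (subst Bochner_Integration.integral_minus[symmetric]) (simp add: algebra_simps)
    also have "\<dots> = (LINT y|lborel. f y * \<phi> (y - v)) - (LINT y|lborel. f y * \<phi> y)"
      by (intro Bochner_Integration.integral_diff integrable_mult_test_function[OF f \<phi>]
          integrable_mult_test_function[OF f test_functions_translate[OF \<phi>, of v UNIV]]) auto
    also have "(LINT y|lborel. f y * \<phi> (y - v)) = (LINT x|lborel. f (x + v) * \<phi> x)"
      using integral_lborel_translate[of "\<lambda>y. f y * \<phi> (y - v)" v] by simp
    finally have "(LINT x|lborel. ?S x * \<phi> x) = (LINT x|lborel. f (x + v) * \<phi> x) - (LINT y|lborel. f y * \<phi> y)" .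
    moreover have "(LINT x|lborel. ?F x * \<phi> x) =
        (LINT x|lborel. f (x + v) * \<phi> x) - (LINT y|lborel. f y * \<phi> y) - (LINT x|lborel. ?S x * \<phi> x)"
      using integrable_mult_test_function[OF f \<phi>] integrable_mult_test_function[OF S \<phi>]
        integrable_mult_test_function[OF integrable_lborel_translate[OF f] \<phi>]
      by (simp add: left_diff_distrib)
    ultimately show "(LINT x|lborel. ?F x * \<phi> x) = 0" by simp
  qed
  then show ?thesis
    by eventually_elim (auto simp: V_def)
qed

section \<open>Vector norms and convexity inequalities\<close>

lemma vnorm_nonneg: "0 \<le> vnorm N v"
  by (simp add: vnorm_def L2_set_nonneg)

lemma vnorm_cong: "(\<And>i. i < N \<Longrightarrow> v i = w i) \<Longrightarrow> vnorm N v = vnorm N w"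
  by (auto simp: vnorm_def intro!: L2_set_cong)

lemma vnorm_measurable [measurable (raw)]:
  assumes "\<And>i. i < N \<Longrightarrow> (\<lambda>x. v x i) \<in> borel_measurable M"
  shows "(\<lambda>x. vnorm N (v x)) \<in> borel_measurable M"
proof -
  have "(\<lambda>x. sqrt (\<Sum>i<N. (norm (v x i))\<^sup>2)) \<in> borel_measurable M"
    using assms by (intro measurable_compose[OF _ borel_measurable_sqrt] borel_measurable_sum
        borel_measurable_power borel_measurable_norm) auto
  then show ?thesis by (simp add: vnorm_def L2_set_def)
qed

lemma vnorm_mono: "(\<And>i. i < N \<Longrightarrow> norm (v i) \<le> norm (w i)) \<Longrightarrow> vnorm N v \<le> vnorm N w"
  unfolding vnorm_def by (intro L2_set_mono) auto

lemma vnorm_add_le: "vnorm N (\<lambda>i. v i + w i) \<le> vnorm N v + vnorm N w"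
proof -
  have "vnorm N (\<lambda>i. v i + w i) \<le> L2_set (\<lambda>i. norm (v i) + norm (w i)) {..<N}"
    unfolding vnorm_def by (intro L2_set_mono norm_triangle_ineq) auto
  also have "\<dots> \<le> vnorm N v + vnorm N w"
    unfolding vnorm_def by (rule L2_set_triangle_ineq)
  finally show ?thesis .
qed

lemma vnorm_diff_triangle: "vnorm N (\<lambda>i. u i - w i) \<le> vnorm N (\<lambda>i. u i - v i) + vnorm N (\<lambda>i. v i - w i)"
  using vnorm_add_le[of N "\<lambda>i. u i - v i" "\<lambda>i. v i - w i"] by simp

lemma vnorm_diff_commute: "vnorm N (\<lambda>i. u i - w i) = vnorm N (\<lambda>i. w i - u i)"
  by (simp add: vnorm_def norm_minus_commute)

lemma vnorm_scaleR: "vnorm N (\<lambda>i. c *\<^sub>R v i) = \<bar>c\<bar> * vnorm N v"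
  unfolding vnorm_def norm_scaleR by (rule L2_set_right_distrib[symmetric]) auto

lemma vnorm_mult: "vnorm N (\<lambda>i. c * v i :: real) = \<bar>c\<bar> * vnorm N v"
  using vnorm_scaleR[of N c v] by simp

lemma vnorm_inner_le:
  fixes g :: "nat \<Rightarrow> 'a::real_inner"
  shows "vnorm N (\<lambda>i. g i \<bullet> h) \<le> norm h * vnorm N g"
proof -
  have "norm (g i \<bullet> h) \<le> norm (norm h *\<^sub>R g i)" for i
    using Cauchy_Schwarz_ineq2[of "g i" h] by (simp add: mult.commute)
  then have "vnorm N (\<lambda>i. g i \<bullet> h) \<le> vnorm N (\<lambda>i. norm h *\<^sub>R g i)"
    by (intro vnorm_mono)
  then show ?thesis by (simp add: vnorm_scaleR)
qed

lemma norm_le_vnorm: "i < N \<Longrightarrow> norm (v i) \<le> vnorm N v"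
  unfolding vnorm_def by (rule member_le_L2_set) auto

lemma vnorm_le_sum: "vnorm N v \<le> (\<Sum>i<N. norm (v i))"
  unfolding vnorm_def by (rule L2_set_le_sum) auto

lemma integrable_vnorm:
  fixes v :: "nat \<Rightarrow> 'a \<Rightarrow> 'b::{banach, second_countable_topology}"
  assumes "\<And>i. i < N \<Longrightarrow> integrable M (v i)"
  shows "integrable M (\<lambda>x. vnorm N (\<lambda>i. v i x))"
proof (rule Bochner_Integration.integrable_bound)
  show "integrable M (\<lambda>x. \<Sum>i<N. norm (v i x))"
    using assms by (intro Bochner_Integration.integrable_sum integrable_norm) auto
  show "(\<lambda>x. vnorm N (\<lambda>i. v i x)) \<in> borel_measurable M"
    using assms by (intro vnorm_measurable) auto
  show "AE x in M. norm (vnorm N (\<lambda>i. v i x)) \<le> norm (\<Sum>i<N. norm (v i x))"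
    using vnorm_le_sum by (auto simp: vnorm_nonneg sum_nonneg intro!: AE_I2)
qed

text \<open>
With \<open>c\<close> the vector of the integrals, \<open>|c|\<^sup>2\<close> is the integral of \<open>c \<bullet> v(x)\<close>, which is at most
\<open>|c| \<integral> |v(x)| dx\<close> by Cauchy-Schwarz. Unlike a componentwise estimate, this loses no factor
depending on \<open>N\<close>.
\<close>

lemma vnorm_integral_le:
  fixes v :: "nat \<Rightarrow> 'a \<Rightarrow> real"
  assumes "\<And>i. i < N \<Longrightarrow> integrable M (v i)"
  shows "vnorm N (\<lambda>i. LINT x|M. v i x) \<le> (LINT x|M. vnorm N (\<lambda>i. v i x))"
proof -
  define c where "c i = (LINT x|M. v i x)" for i
  define V where "V = vnorm N c"
  have int: "integrable M (\<lambda>x. vnorm N (\<lambda>i. v i x))" using assms by (rule integrable_vnorm)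
  have "V * V = (\<Sum>i<N. c i * c i)"
    by (simp add: V_def vnorm_def L2_set_def sum_nonneg power2_eq_square)
  also have "\<dots> = (\<Sum>i<N. LINT x|M. c i * v i x)"
    by (simp add: c_def)
  also have "\<dots> = (LINT x|M. (\<Sum>i<N. c i * v i x))"
    using assms by (intro Bochner_Integration.integral_sum[symmetric] integrable_mult_right) auto
  also have "\<dots> \<le> (LINT x|M. V * vnorm N (\<lambda>i. v i x))"
  proof (rule integral_mono)
    show "(\<Sum>i<N. c i * v i x) \<le> V * vnorm N (\<lambda>i. v i x)" for x
    proof -
      have "(\<Sum>i<N. c i * v i x) \<le> (\<Sum>i<N. \<bar>c i\<bar> * \<bar>v i x\<bar>)"
        by (intro sum_mono) (metis abs_ge_self abs_mult)
      also have "\<dots> \<le> V * vnorm N (\<lambda>i. v i x)"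
        unfolding V_def vnorm_def real_norm_def using L2_set_mult_ineq[of c "\<lambda>i. v i x" "{..<N}"]
        by (simp add: L2_set_def)
      finally show ?thesis .
    qed
  qed (use assms int in \<open>auto intro!: Bochner_Integration.integrable_sum integrable_mult_right\<close>)
  also have "\<dots> = V * (LINT x|M. vnorm N (\<lambda>i. v i x))"
    by simp
  finally have "V * V \<le> V * (LINT x|M. vnorm N (\<lambda>i. v i x))" .
  moreover have "0 \<le> V" "0 \<le> (LINT x|M. vnorm N (\<lambda>i. v i x))"
    by (auto simp: V_def vnorm_nonneg)
  ultimately have "V \<le> (LINT x|M. vnorm N (\<lambda>i. v i x))"
    by (metis mult_le_cancel_left_pos order_le_less)
  then show ?thesis by (simp add: V_def c_def[abs_def])
qed

text \<open>
The graph of the convex function \<open>x\<^sup>q\<close> lies above its tangent at \<open>a\<close>. Young's inequality gives the case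
\<open>a = 1\<close>, and the rest is scaling.
\<close>

lemma powr_tangent_le:
  fixes a b q :: real
  assumes "1 \<le> q" "0 < a" "0 \<le> b"
  shows "a powr q + q * a powr (q - 1) * (b - a) \<le> b powr q"
proof -
  have *: "q * y \<le> y powr q + (q - 1)" if "0 \<le> y" for y
  proof (cases "y = 0")
    case False
    then have "0 < y" using that by simp
    have "(y powr q) powr (1/q) * 1 powr (1 - 1/q) \<le> (1/q) * y powr q + (1 - 1/q) * 1"
      using assms \<open>0 < y\<close> by (intro Youngs_inequality_0) auto
    then have "y \<le> (1/q) * y powr q + (1 - 1/q)"
      using assms \<open>0 < y\<close> by (simp add: powr_powr)
    then have "q * y \<le> q * ((1/q) * y powr q + (1 - 1/q))"
      using assms by (intro mult_left_mono) auto
    moreover have "q * ((1/q) * y powr q + (1 - 1/q)) = y powr q + (q - 1)"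
      using assms by (simp add: distrib_left right_diff_distrib)
    ultimately show ?thesis by simp
  qed (use assms in auto)
  have "a powr q * (q * (b/a)) \<le> a powr q * ((b/a) powr q + (q - 1))"
    using assms by (intro mult_left_mono *) auto
  moreover have "a powr q * (b/a) powr q = b powr q"
    using assms by (simp add: powr_divide)
  moreover have "a powr q = a powr (q - 1) * a"
    using powr_add[of a "q - 1" 1] assms by simp
  ultimately show ?thesis
    using assms by (simp add: field_simps)
qed

lemma powr_add_le:
  fixes a b q :: real
  assumes "1 \<le> q" "0 \<le> a" "0 \<le> b"
  shows "(a + b) powr q \<le> 2 powr q * (a powr q + b powr q)"
proof -
  have "(a + b) powr q \<le> (2 * max a b) powr q"
    using assms by (intro powr_mono2) auto
  also have "\<dots> = 2 powr q * (max a b) powr q"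
    using assms by (simp add: powr_mult)
  also have "\<dots> \<le> 2 powr q * (a powr q + b powr q)"
    by (intro mult_left_mono) (auto simp: max_def)
  finally show ?thesis .
qed

text \<open>
The tangent inequality at the mean value of \<open>f\<close> is integrated. The right-hand side is stated
as a nonnegative integral so that \<open>f\<^sup>q\<close> need not be integrable.
\<close>

lemma (in finite_measure) jensen_powr:
  fixes f :: "'a \<Rightarrow> real"
  assumes q: "1 \<le> q" and f: "integrable M f" "\<And>x. 0 \<le> f x"
  shows "ennreal ((LINT x|M. f x) powr q)
    \<le> ennreal (measure M (space M) powr (q - 1)) * (\<integral>\<^sup>+x. ennreal (f x powr q) \<partial>M)"
proof -
  let ?\<mu> = "measure M (space M)" and ?I = "LINT x|M. f x"
  note [measurable] = borel_measurable_integrable[OF f(1)]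
  have "0 \<le> ?I" using f by simp
  show ?thesis
  proof (cases "?I = 0")
    case False
    then have I: "0 < ?I" using \<open>0 \<le> ?I\<close> by simp
    have "?\<mu> \<noteq> 0"
    proof
      assume "?\<mu> = 0"
      then have "space M \<in> null_sets M"
        by (simp add: null_sets_def emeasure_eq_measure)
      then have "AE x in M. f x = 0"
        by (rule AE_I') auto
      then have "?I = 0" by (rule integral_eq_zero_AE)
      with I show False by simp
    qed
    then have \<mu>: "0 < ?\<mu>" by (simp add: zero_less_measure_iff)
    define m where "m = ?I / ?\<mu>"
    have m: "0 < m" "?I = m * ?\<mu>" using I \<mu> by (auto simp: m_def)
    show ?thesis
    proof (cases "(\<integral>\<^sup>+x. ennreal (f x powr q) \<partial>M) = \<infinity>")
      case True
      then show ?thesis using \<mu> by (simp add: ennreal_mult_top)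
    next
      case fin: False
      then have fq: "integrable M (\<lambda>x. f x powr q)"
        by (intro integrableI_bounded) (auto simp: less_top)
      have "(LINT x|M. m powr q + q * m powr (q - 1) * (f x - m)) \<le> (LINT x|M. f x powr q)"
        using q m f by (intro integral_mono fq Bochner_Integration.integrable_add integrable_mult_right
            Bochner_Integration.integrable_diff powr_tangent_le) auto
      also have "(LINT x|M. m powr q + q * m powr (q - 1) * (f x - m)) = m powr q * ?\<mu>"
        using f m by (simp add: Bochner_Integration.integral_diff)
      finally have "?\<mu> powr (q - 1) * (m powr q * ?\<mu>) \<le> ?\<mu> powr (q - 1) * (LINT x|M. f x powr q)"
        by (intro mult_left_mono) auto
      moreover have "?I powr q = ?\<mu> powr (q - 1) * (m powr q * ?\<mu>)"
        using \<mu> m(1) powr_add[of ?\<mu> "q - 1" 1] by (simp add: m(2) powr_mult)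
      ultimately have "ennreal (?I powr q) \<le> ennreal (?\<mu> powr (q - 1) * (LINT x|M. f x powr q))"
        by (intro ennreal_leI) simp
      also have "\<dots> = ennreal (?\<mu> powr (q - 1)) * (\<integral>\<^sup>+x. ennreal (f x powr q) \<partial>M)"
        using fq by (simp add: ennreal_mult nn_integral_eq_integral)
      finally show ?thesis .
    qed
  qed simp
qed

section \<open>The Poincare inequality on a ball\<close>

text \<open>
The increment is an average of \<open>g(x + s h) \<bullet> h\<close> over \<open>0 \<le> s \<le> 1\<close>. Jensen's inequality takes the
power inside, and for each \<open>s\<close> the integral over \<open>x\<close> no longer sees the translation by \<open>s h\<close>.
\<close>

lemma nn_integral_increment_powr_le:
  fixes f :: "nat \<Rightarrow> 'a::euclidean_space \<Rightarrow> real" and g :: "nat \<Rightarrow> 'a \<Rightarrow> 'a"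
  assumes q: "1 \<le> q" and U: "open U" "convex U"
    and f: "\<And>i. i < N \<Longrightarrow> integrable lborel (f i)" and g: "\<And>i. i < N \<Longrightarrow> integrable lborel (g i)"
    and wd: "\<And>i v \<phi>. i < N \<Longrightarrow> \<phi> \<in> test_functions U \<Longrightarrow>
      (LINT x|lborel. f i x * frechet_derivative \<phi> (at x) v) = - (LINT x|lborel. (g i x \<bullet> v) * \<phi> x)"
  shows "(\<integral>\<^sup>+x. ennreal (vnorm N (\<lambda>i. f i (x + h) - f i x) powr q) * indicator {x. x \<in> U \<and> x + h \<in> U} x \<partial>lborel)
    \<le> ennreal (norm h powr q) * (\<integral>\<^sup>+x. ennreal (vnorm N (\<lambda>i. g i x) powr q) \<partial>lborel)"
proof -
  have fm [measurable]: "f i \<in> borel_measurable borel" if "i < N" for i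
    using borel_measurable_integrable[OF f[OF that]] by simp
  have gm [measurable]: "g i \<in> borel_measurable borel" if "i < N" for i
    using borel_measurable_integrable[OF g[OF that]] by simp
  let ?I = "restrict_space lborel {0..1::real}"
  interpret I: finite_measure ?I
    by (intro finite_measureI) (simp add: emeasure_restrict_space space_restrict_space)
  have I1: "measure ?I (space ?I) = 1"
    by (simp add: measure_restrict_space space_restrict_space)
  let ?G = "\<lambda>x. ennreal (vnorm N (\<lambda>i. g i x) powr q)"
  have Gm [measurable]: "?G \<in> borel_measurable borel" by (measurable; simp add: gm)
  have gh: "integrable lborel (\<lambda>x. g i x \<bullet> h)" if "i < N" for i
    using g[OF that] by (rule integrable_inner_left)
  have "AE x in lborel. \<forall>i<N. x \<in> U \<and> x + h \<in> U \<longrightarrow>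
      f i (x + h) - f i x = (LINT s|lborel. (g i (x + s *\<^sub>R h) \<bullet> h) * indicator {0..1::real} s)"
    unfolding all_simps(6)[symmetric]
    by (subst AE_all_countable) (auto intro!: AE_impI weak_derivative_imp_increment[OF U f gh wd])
  moreover have "AE x in lborel. \<forall>i<N. integrable lborel (\<lambda>s. (g i (x + s *\<^sub>R h) \<bullet> h) * indicator {0..1::real} s)"
    using lborel_pair.AE_integrable_fst'[OF integrable_along_segments[OF gh, of _ h]]
    by (subst AE_all_countable) (auto intro!: AE_impI)
  ultimately have "AE x in lborel. ennreal (vnorm N (\<lambda>i. f i (x + h) - f i x) powr q) * indicator {x. x \<in> U \<and> x + h \<in> U} x
      \<le> (\<integral>\<^sup>+s. ennreal (norm h powr q) * ?G (x + s *\<^sub>R h) * indicator {0..1} s \<partial>lborel)"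
  proof eventually_elim
    case (elim x)
    show ?case
    proof (cases "x \<in> U \<and> x + h \<in> U")
      case True
      have int: "integrable ?I (\<lambda>s. g i (x + s *\<^sub>R h) \<bullet> h)" if "i < N" for i
        using elim(2) that by (subst integrable_restrict_space) (auto simp: mult.commute)
      have "f i (x + h) - f i x = (LINT s|?I. g i (x + s *\<^sub>R h) \<bullet> h)" if "i < N" for i
        using elim(1) that True by (subst integral_restrict_space) (auto simp: mult.commute)
      then have "vnorm N (\<lambda>i. f i (x + h) - f i x) = vnorm N (\<lambda>i. LINT s|?I. g i (x + s *\<^sub>R h) \<bullet> h)"
        by (intro vnorm_cong) auto
      also have "\<dots> \<le> (LINT s|?I. vnorm N (\<lambda>i. g i (x + s *\<^sub>R h) \<bullet> h))"
        by (rule vnorm_integral_le[OF int])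
      finally have "ennreal (vnorm N (\<lambda>i. f i (x + h) - f i x) powr q) \<le>
          ennreal ((LINT s|?I. vnorm N (\<lambda>i. g i (x + s *\<^sub>R h) \<bullet> h)) powr q)"
        using q by (intro ennreal_leI powr_mono2) (auto simp: vnorm_nonneg)
      also have "\<dots> \<le> (\<integral>\<^sup>+s. ennreal (vnorm N (\<lambda>i. g i (x + s *\<^sub>R h) \<bullet> h) powr q) \<partial>?I)"
        using I.jensen_powr[OF q integrable_vnorm[OF int] vnorm_nonneg] unfolding I1 by simp
      also have "\<dots> \<le> (\<integral>\<^sup>+s. ennreal (norm h powr q) * ?G (x + s *\<^sub>R h) \<partial>?I)"
      proof (intro nn_integral_mono)
        fix s
        have "vnorm N (\<lambda>i. g i (x + s *\<^sub>R h) \<bullet> h) powr q \<le> (norm h * vnorm N (\<lambda>i. g i (x + s *\<^sub>R h))) powr q"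
          using q by (intro powr_mono2 vnorm_inner_le) (auto simp: vnorm_nonneg)
        then show "ennreal (vnorm N (\<lambda>i. g i (x + s *\<^sub>R h) \<bullet> h) powr q) \<le> ennreal (norm h powr q) * ?G (x + s *\<^sub>R h)"
          by (simp add: powr_mult vnorm_nonneg ennreal_mult[symmetric] ennreal_leI)
      qed
      also have "\<dots> = (\<integral>\<^sup>+s. ennreal (norm h powr q) * ?G (x + s *\<^sub>R h) * indicator {0..1} s \<partial>lborel)"
        by (subst nn_integral_restrict_space) auto
      finally show ?thesis using True by simp
    qed simp
  qed
  then have "(\<integral>\<^sup>+x. ennreal (vnorm N (\<lambda>i. f i (x + h) - f i x) powr q) * indicator {x. x \<in> U \<and> x + h \<in> U} x \<partial>lborel)
     \<le> (\<integral>\<^sup>+x. \<integral>\<^sup>+s. ennreal (norm h powr q) * ?G (x + s *\<^sub>R h) * indicator {0..1} s \<partial>lborel \<partial>lborel)"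
    by (rule nn_integral_mono_AE)
  also have "\<dots> = (\<integral>\<^sup>+s. \<integral>\<^sup>+x. ennreal (norm h powr q) * ?G (x + s *\<^sub>R h) * indicator {0..1::real} s \<partial>lborel \<partial>lborel)"
    by (rule lborel_pair.Fubini') measurable
  also have "\<dots> = (\<integral>\<^sup>+s. (ennreal (norm h powr q) * (\<integral>\<^sup>+x. ?G x \<partial>lborel)) * indicator {0..1::real} s \<partial>lborel)"
  proof (rule nn_integral_cong)
    fix s :: real
    have "(\<integral>\<^sup>+x. ennreal (norm h powr q) * ?G (x + s *\<^sub>R h) * indicator {0..1::real} s \<partial>lborel)
      = ennreal (norm h powr q) * (\<integral>\<^sup>+x. ?G (x + s *\<^sub>R h) \<partial>lborel) * indicator {0..1::real} s"
      by (subst nn_integral_multc, measurable, subst nn_integral_cmult) measurable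
    then show "(\<integral>\<^sup>+x. ennreal (norm h powr q) * ?G (x + s *\<^sub>R h) * indicator {0..1::real} s \<partial>lborel)
      = ennreal (norm h powr q) * (\<integral>\<^sup>+x. ?G x \<partial>lborel) * indicator {0..1::real} s"
      using nn_integral_lborel_translate[OF Gm, of "s *\<^sub>R h"] by simp
  qed
  also have "\<dots> = ennreal (norm h powr q) * (\<integral>\<^sup>+x. ?G x \<partial>lborel)"
    by (subst nn_integral_cmult) auto
  finally show ?thesis .
qed

text \<open>
Pairs \<open>(x, y)\<close> of points of the ball are described by \<open>x\<close> and the increment \<open>h = y - x\<close>, which ranges over
the ball of radius \<open>2\<rho>\<close>. For each fixed \<open>h\<close> the bound on increments applies, so no change of
variables other than a translation is needed.
\<close>

lemma double_integral_poincare: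
  fixes f :: "nat \<Rightarrow> 'a::euclidean_space \<Rightarrow> real" and g :: "nat \<Rightarrow> 'a \<Rightarrow> 'a"
  assumes q: "1 \<le> q" and \<rho>: "0 < \<rho>"
    and f: "\<And>i. i < N \<Longrightarrow> integrable lborel (f i)" and g: "\<And>i. i < N \<Longrightarrow> integrable lborel (g i)"
    and wd: "\<And>i v \<phi>. i < N \<Longrightarrow> \<phi> \<in> test_functions (ball x0 \<rho>) \<Longrightarrow>
      (LINT x|lborel. f i x * frechet_derivative \<phi> (at x) v) = - (LINT x|lborel. (g i x \<bullet> v) * \<phi> x)"
  shows "(\<integral>\<^sup>+x. \<integral>\<^sup>+y. ennreal (vnorm N (\<lambda>i. f i y - f i x) powr q) * indicator (ball x0 \<rho>) x * indicator (ball x0 \<rho>) y \<partial>lborel \<partial>lborel)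
    \<le> ennreal ((2 * \<rho>) powr q) * emeasure lborel (ball (0::'a) (2 * \<rho>)) *
        (\<integral>\<^sup>+x. ennreal (vnorm N (\<lambda>i. g i x) powr q) \<partial>lborel)"
proof -
  have fm [measurable]: "f i \<in> borel_measurable borel" if "i < N" for i
    using borel_measurable_integrable[OF f[OF that]] by simp
  let ?B = "ball x0 \<rho>"
  let ?D = "\<lambda>x y. ennreal (vnorm N (\<lambda>i. f i y - f i x) powr q) * indicator ?B x * indicator ?B y"
  let ?G = "\<integral>\<^sup>+x. ennreal (vnorm N (\<lambda>i. g i x) powr q) \<partial>lborel"
  have [measurable]: "?B \<in> sets borel" by simp
  have [measurable]: "(\<lambda>z. vnorm N (\<lambda>i. f i (snd z) - f i (fst z))) \<in> borel_measurable (borel \<Otimes>\<^sub>M borel)"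
    by (rule vnorm_measurable) measurable
  have [measurable]: "?B \<in> sets borel" by simp
  have [measurable]: "(\<lambda>z. vnorm N (\<lambda>i. f i (snd z + fst z) - f i (fst z))) \<in> borel_measurable (borel \<Otimes>\<^sub>M borel)"
    by (rule vnorm_measurable) measurable
  have m2: "(\<lambda>(x, h). ?D x (h + x)) \<in> borel_measurable (lborel \<Otimes>\<^sub>M lborel)"
    by measurable
  have "(\<integral>\<^sup>+x. \<integral>\<^sup>+y. ?D x y \<partial>lborel \<partial>lborel) = (\<integral>\<^sup>+x. \<integral>\<^sup>+h. ?D x (h + x) \<partial>lborel \<partial>lborel)"
  proof (rule nn_integral_cong)
    fix x :: 'a
    have [measurable]: "(\<lambda>y. vnorm N (\<lambda>i. f i y - f i x)) \<in> borel_measurable borel"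
      by (rule vnorm_measurable) measurable
    have "(\<lambda>y. ?D x y) \<in> borel_measurable borel"
      by measurable
    then show "(\<integral>\<^sup>+y. ?D x y \<partial>lborel) = (\<integral>\<^sup>+h. ?D x (h + x) \<partial>lborel)"
      by (rule nn_integral_lborel_translate[symmetric])
  qed
  also have "\<dots> = (\<integral>\<^sup>+h. \<integral>\<^sup>+x. ?D x (h + x) \<partial>lborel \<partial>lborel)"
    by (rule lborel_pair.Fubini'[OF m2, symmetric])
  also have "\<dots> \<le> (\<integral>\<^sup>+h. ennreal ((2 * \<rho>) powr q) * ?G * indicator (ball (0::'a) (2 * \<rho>)) h \<partial>lborel)"
  proof (rule nn_integral_mono)
    fix h :: 'a
    show "(\<integral>\<^sup>+x. ?D x (h + x) \<partial>lborel) \<le> ennreal ((2 * \<rho>) powr q) * ?G * indicator (ball (0::'a) (2 * \<rho>)) h"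
    proof (cases "norm h < 2 * \<rho>")
      case True
      have "(\<integral>\<^sup>+x. ?D x (h + x) \<partial>lborel) =
          (\<integral>\<^sup>+x. ennreal (vnorm N (\<lambda>i. f i (x + h) - f i x) powr q) * indicator {x. x \<in> ?B \<and> x + h \<in> ?B} x \<partial>lborel)"
        by (intro nn_integral_cong) (auto simp: indicator_def add.commute)
      also have "\<dots> \<le> ennreal (norm h powr q) * ?G"
        by (rule nn_integral_increment_powr_le[OF q open_ball convex_ball f g wd])
      also have "\<dots> \<le> ennreal ((2 * \<rho>) powr q) * ?G"
        using True q by (intro mult_right_mono ennreal_leI powr_mono2) auto
      finally show ?thesis using True by simp
    next
      case False
      have "?D x (h + x) = 0" for x
      proof -
        have "norm h < 2 * \<rho>" if "x \<in> ?B" "h + x \<in> ?B"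
        proof -
          have "norm h = dist x (h + x)" by (simp add: dist_norm)
          also have "\<dots> \<le> dist x0 x + dist x0 (h + x)" by (metis dist_commute dist_triangle)
          finally show ?thesis using that by simp
        qed
        with False show ?thesis by (auto simp: indicator_def)
      qed
      then have "(\<integral>\<^sup>+x. ?D x (h + x) \<partial>lborel) = (\<integral>\<^sup>+x. 0 \<partial>(lborel :: 'a measure))"
        by (intro nn_integral_cong)
      then show ?thesis by simp
    qed
  qed
  also have "\<dots> = ennreal ((2 * \<rho>) powr q) * ?G * emeasure lborel (ball (0::'a) (2 * \<rho>))"
    by (rule nn_integral_cmult_indicator) simp
  finally show ?thesis by (simp add: mult_ac)
qed

text \<open>
The difference between \<open>f(x)\<close> and the weighted average is the average of \<open>f(x) - f(y)\<close> over \<open>y\<close> with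
weight \<open>\<eta>(y)/m\<close>. Jensen's inequality and the bound \<open>\<eta> \<le> 1\<close> reduce it to the double integral.
\<close>

lemma weighted_poincare:
  fixes f :: "nat \<Rightarrow> 'a::euclidean_space \<Rightarrow> real" and g :: "nat \<Rightarrow> 'a \<Rightarrow> 'a"
  assumes q: "1 \<le> q" and \<rho>: "0 < \<rho>"
    and f: "\<And>i. i < N \<Longrightarrow> integrable lborel (f i)" and g: "\<And>i. i < N \<Longrightarrow> integrable lborel (g i)"
    and wd: "\<And>i v \<phi>. i < N \<Longrightarrow> \<phi> \<in> test_functions (ball x0 \<rho>) \<Longrightarrow>
      (LINT x|lborel. f i x * frechet_derivative \<phi> (at x) v) = - (LINT x|lborel. (g i x \<bullet> v) * \<phi> x)"
    and \<eta>: "\<eta> \<in> test_functions (ball x0 \<rho>)" "\<And>x. 0 \<le> \<eta> x" "\<And>x. \<eta> x \<le> 1"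
    and m: "m = (LINT x|lborel. \<eta> x)" "0 < m"
  shows "(\<integral>\<^sup>+x. ennreal (vnorm N (\<lambda>i. f i x - (LINT y|lborel. f i y * \<eta> y) / m) powr q) * indicator (ball x0 \<rho>) x \<partial>lborel)
    \<le> ennreal (measure lborel (ball x0 \<rho>) powr (q - 1) / m powr q * (2 * \<rho>) powr q * measure lborel (ball (0::'a) (2 * \<rho>))) *
        (\<integral>\<^sup>+x. ennreal (vnorm N (\<lambda>i. g i x) powr q) \<partial>lborel)"
proof -
  let ?B = "ball x0 \<rho>"
  let ?R = "restrict_space lborel ?B"
  let ?G = "\<integral>\<^sup>+x. ennreal (vnorm N (\<lambda>i. g i x) powr q) \<partial>lborel"
  let ?D = "\<lambda>x y. ennreal (vnorm N (\<lambda>i. f i y - f i x) powr q) * indicator ?B x * indicator ?B y"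
  let ?k = "measure lborel ?B powr (q - 1) / m powr q"
  have [measurable]: "?B \<in> sets borel" by simp
  have fm [measurable]: "f i \<in> borel_measurable borel" if "i < N" for i
    using borel_measurable_integrable[OF f[OF that]] by simp
  note [measurable] = test_functions_measurable[OF \<eta>(1)]
  interpret R: finite_measure ?R
    using emeasure_lborel_ball_finite[of x0 \<rho>]
    by (intro finite_measureI) (simp add: emeasure_restrict_space space_restrict_space)
  have RM: "measure ?R (space ?R) = measure lborel ?B"
    by (simp add: measure_restrict_space space_restrict_space)
  have int_eta: "integrable lborel \<eta>"
    using m by (metis not_integrable_integral_eq less_irrefl)
  have pointwise: "ennreal (vnorm N (\<lambda>i. f i x - (LINT y|lborel. f i y * \<eta> y) / m) powr q)
      \<le> ennreal ?k * (\<integral>\<^sup>+y. ennreal (vnorm N (\<lambda>i. f i y - f i x) powr q) * indicator ?B y \<partial>lborel)" for x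
  proof -
    have int0: "integrable lborel (\<lambda>y. \<eta> y / m * (f i y - f i x))" if "i < N" for i
      using integrable_mult_test_function[OF f[OF that] \<eta>(1)] int_eta
      by (simp add: right_diff_distrib mult.commute)
    have off: "indicator ?B y *\<^sub>R (\<eta> y / m * c) = \<eta> y / m * c" for y c
      using test_functionsD(4)[OF \<eta>(1), of y] by (auto simp: indicator_def)
    have int: "integrable ?R (\<lambda>y. \<eta> y / m * (f i y - f i x))" if "i < N" for i
      using int0[OF that] by (subst integrable_restrict_space, simp, simp only: off)
    have "(LINT y|?R. \<eta> y / m * (f i y - f i x)) = (LINT y|lborel. f i y * \<eta> y) / m - f i x" if "i < N" for i
    proof -
      have "(LINT y|?R. \<eta> y / m * (f i y - f i x)) = (LINT y|lborel. \<eta> y / m * (f i y - f i x))"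
        by (subst integral_restrict_space, simp, simp only: off)
      also have "\<dots> = (LINT y|lborel. f i y * \<eta> y / m - f i x / m * \<eta> y)"
        by (intro Bochner_Integration.integral_cong) (auto simp: diff_divide_distrib algebra_simps)
      also have "\<dots> = (LINT y|lborel. f i y * \<eta> y) / m - f i x / m * (LINT y|lborel. \<eta> y)"
        using integrable_mult_test_function[OF f[OF that] \<eta>(1)] int_eta by simp
      finally show ?thesis using m by simp
    qed
    then have "vnorm N (\<lambda>i. f i x - (LINT y|lborel. f i y * \<eta> y) / m) = vnorm N (\<lambda>i. LINT y|?R. \<eta> y / m * (f i y - f i x))"
      by (subst vnorm_diff_commute) (auto intro!: vnorm_cong)
    also have "\<dots> \<le> (LINT y|?R. vnorm N (\<lambda>i. \<eta> y / m * (f i y - f i x)))"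
      by (rule vnorm_integral_le[OF int])
    finally have "ennreal (vnorm N (\<lambda>i. f i x - (LINT y|lborel. f i y * \<eta> y) / m) powr q) \<le>
        ennreal ((LINT y|?R. vnorm N (\<lambda>i. \<eta> y / m * (f i y - f i x))) powr q)"
      using q by (intro ennreal_leI powr_mono2) (auto simp: vnorm_nonneg)
    also have "\<dots> \<le> ennreal (measure lborel ?B powr (q - 1)) *
        (\<integral>\<^sup>+y. ennreal (vnorm N (\<lambda>i. \<eta> y / m * (f i y - f i x)) powr q) \<partial>?R)"
      using R.jensen_powr[OF q integrable_vnorm[OF int] vnorm_nonneg] unfolding RM .
    also have "\<dots> \<le> ennreal (measure lborel ?B powr (q - 1)) *
        (\<integral>\<^sup>+y. ennreal (1 / m powr q) * ennreal (vnorm N (\<lambda>i. f i y - f i x) powr q) \<partial>?R)"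
    proof (intro mult_left_mono nn_integral_mono)
      fix y
      have "vnorm N (\<lambda>i. \<eta> y / m * (f i y - f i x)) \<le> 1 / m * vnorm N (\<lambda>i. f i y - f i x)"
        using \<eta>(2,3)[of y] m unfolding vnorm_mult by (intro mult_right_mono) (auto simp: vnorm_nonneg divide_right_mono)
      then have "vnorm N (\<lambda>i. \<eta> y / m * (f i y - f i x)) powr q \<le> (1 / m * vnorm N (\<lambda>i. f i y - f i x)) powr q"
        using q by (intro powr_mono2) (auto simp: vnorm_nonneg)
      also have "\<dots> = 1 / m powr q * vnorm N (\<lambda>i. f i y - f i x) powr q"
        using m by (simp add: powr_divide vnorm_nonneg)
      finally show "ennreal (vnorm N (\<lambda>i. \<eta> y / m * (f i y - f i x)) powr q) \<le>
          ennreal (1 / m powr q) * ennreal (vnorm N (\<lambda>i. f i y - f i x) powr q)"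
        by (simp add: ennreal_mult[symmetric] ennreal_leI)
    qed auto
    also have "\<dots> = ennreal (measure lborel ?B powr (q - 1)) * (ennreal (1 / m powr q) *
        (\<integral>\<^sup>+y. ennreal (vnorm N (\<lambda>i. f i y - f i x) powr q) * indicator ?B y \<partial>lborel))"
    proof -
      have [measurable]: "(\<lambda>y. vnorm N (\<lambda>i. f i y - f i x)) \<in> borel_measurable borel"
        by (rule vnorm_measurable) measurable
      have "(\<integral>\<^sup>+y. ennreal (1 / m powr q) * ennreal (vnorm N (\<lambda>i. f i y - f i x) powr q) \<partial>?R) =
          (\<integral>\<^sup>+y. ennreal (1 / m powr q) * (ennreal (vnorm N (\<lambda>i. f i y - f i x) powr q) * indicator ?B y) \<partial>lborel)"
        by (subst nn_integral_restrict_space) (simp_all only: mult.assoc, simp)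
      also have "\<dots> = ennreal (1 / m powr q) *
          (\<integral>\<^sup>+y. ennreal (vnorm N (\<lambda>i. f i y - f i x) powr q) * indicator ?B y \<partial>lborel)"
        by (rule nn_integral_cmult) measurable
      finally show ?thesis by (simp only:)
    qed
    also have "\<dots> = ennreal ?k * (\<integral>\<^sup>+y. ennreal (vnorm N (\<lambda>i. f i y - f i x) powr q) * indicator ?B y \<partial>lborel)"
      by (simp add: mult.assoc[symmetric] ennreal_mult[symmetric])
    finally show ?thesis .
  qed
  have [measurable]: "?B \<in> sets borel" by simp
  have [measurable]: "(\<lambda>z. vnorm N (\<lambda>i. f i (snd z) - f i (fst z))) \<in> borel_measurable (borel \<Otimes>\<^sub>M borel)"
    by (rule vnorm_measurable) measurable
  have mD: "(\<lambda>(x, y). ?D x y) \<in> borel_measurable (lborel \<Otimes>\<^sub>M lborel)"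
    by measurable
  have mD': "(\<lambda>x. \<integral>\<^sup>+y. ?D x y \<partial>lborel) \<in> borel_measurable lborel"
    using lborel.borel_measurable_nn_integral_fst[OF mD] by simp
  have "(\<integral>\<^sup>+x. ennreal (vnorm N (\<lambda>i. f i x - (LINT y|lborel. f i y * \<eta> y) / m) powr q) * indicator ?B x \<partial>lborel)
      \<le> (\<integral>\<^sup>+x. ennreal ?k * (\<integral>\<^sup>+y. ?D x y \<partial>lborel) \<partial>lborel)"
  proof (rule nn_integral_mono)
    fix x
    show "ennreal (vnorm N (\<lambda>i. f i x - (LINT y|lborel. f i y * \<eta> y) / m) powr q) * indicator ?B x
        \<le> ennreal ?k * (\<integral>\<^sup>+y. ?D x y \<partial>lborel)"
      using pointwise[of x] by (cases "x \<in> ?B") simp_all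
  qed
  also have "\<dots> = ennreal ?k * (\<integral>\<^sup>+x. \<integral>\<^sup>+y. ?D x y \<partial>lborel \<partial>lborel)"
    by (rule nn_integral_cmult[OF mD'])
  also have "\<dots> \<le> ennreal ?k * (ennreal ((2 * \<rho>) powr q) * emeasure lborel (ball (0::'a) (2 * \<rho>)) * ?G)"
    by (intro mult_left_mono double_integral_poincare[OF q \<rho> f g wd]) auto
  also have "\<dots> = ennreal (?k * (2 * \<rho>) powr q * measure lborel (ball (0::'a) (2 * \<rho>))) * ?G"
  proof -
    have "emeasure lborel (ball (0::'a) (2 * \<rho>)) = ennreal (measure lborel (ball (0::'a) (2 * \<rho>)))"
      using emeasure_lborel_ball_finite[of "0::'a" "2 * \<rho>"] by (intro emeasure_eq_ennreal_measure) simp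
    moreover have "ennreal k * (ennreal a * ennreal b * G) = ennreal (k * a * b) * G"
      if "0 \<le> k" "0 \<le> a" "0 \<le> b" for k a b G
      using that by (simp add: ennreal_mult mult.assoc)
    ultimately show ?thesis
      by simp
  qed
  finally show ?thesis .
qed

section \<open>Oscillation in time of weighted space averages\<close>

text \<open>
Expansion in partial derivatives, which makes the derivative of \<open>\<eta>\<close> in a variable direction
measurable.
\<close>

lemma frechet_derivative_test_function_sum:
  fixes \<eta> :: "'a::euclidean_space \<Rightarrow> real"
  assumes "\<eta> \<in> test_functions U"
  shows "frechet_derivative \<eta> (at x) w = (\<Sum>b\<in>Basis. (w \<bullet> b) * frechet_derivative \<eta> (at x) b)"
proof -
  have l: "linear (frechet_derivative \<eta> (at x))"
    using has_derivative_linear[OF test_functionsD(2)[OF assms]] .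
  have "frechet_derivative \<eta> (at x) w = frechet_derivative \<eta> (at x) (\<Sum>b\<in>Basis. (w \<bullet> b) *\<^sub>R b)"
    by (simp add: euclidean_representation)
  also have "\<dots> = (\<Sum>b\<in>Basis. (w \<bullet> b) * frechet_derivative \<eta> (at x) b)"
    using l by (simp add: linear_sum linear_cmul)
  finally show ?thesis .
qed

lemma integrable_frechet_derivative_test_function:
  fixes \<eta> :: "'a::euclidean_space \<Rightarrow> real"
    and H :: "'a \<times> 'b::euclidean_space \<Rightarrow> 'a"
  assumes "\<eta> \<in> test_functions U" and H: "integrable lborel H"
  shows "integrable lborel (\<lambda>z. frechet_derivative \<eta> (at (fst z)) (H z))"
  unfolding frechet_derivative_test_function_sum[OF assms(1), of _ "H _"]
proof (rule Bochner_Integration.integrable_sum)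
  fix b :: 'a assume "b \<in> Basis"
  have d: "(\<lambda>x. frechet_derivative \<eta> (at x) b) \<in> test_functions U"
    by (rule test_functions_derivative[OF assms(1)])
  obtain C where C: "0 < C" "\<And>x. \<bar>frechet_derivative \<eta> (at x) b\<bar> \<le> C"
    using test_functions_bounded[OF d] by blast
  have [measurable]: "(\<lambda>x. frechet_derivative \<eta> (at x) b) \<in> borel_measurable borel"
    by (rule test_functions_measurable[OF d])
  have [measurable]: "fst \<in> borel_measurable (borel :: ('a \<times> 'b) measure)"
    by (intro borel_measurable_continuous_onI continuous_intros)
  show "integrable lborel (\<lambda>z. (H z \<bullet> b) * frechet_derivative \<eta> (at (fst z)) b)"
    using C(2) by (intro integrable_mult_bounded integrable_inner_left H) measurable
qed

lemma integrable_space_weight: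
  fixes u :: "'a::euclidean_space \<times> 'b::euclidean_space \<Rightarrow> real"
  assumes u: "integrable lborel u" and \<eta>: "\<eta> \<in> test_functions U"
  shows "integrable (lborel \<Otimes>\<^sub>M lborel) (\<lambda>(x, t). u (x, t) * \<eta> x)"
proof -
  note [measurable] = test_functions_measurable[OF \<eta>]
  have [measurable]: "fst \<in> borel_measurable (borel :: ('a \<times> 'b) measure)"
    by (intro borel_measurable_continuous_onI continuous_intros)
  obtain C where "\<And>x. \<bar>\<eta> x\<bar> \<le> C" using test_functions_bounded[OF \<eta>] by blast
  then have "integrable lborel (\<lambda>z. u z * \<eta> (fst z))"
    by (intro integrable_mult_bounded[OF u]) measurable
  then show ?thesis by (simp add: lborel_prod case_prod_beta')
qed

lemma
  fixes f :: "'a::euclidean_space \<times> 'b::euclidean_space \<Rightarrow> ennreal"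
  assumes "f \<in> borel_measurable borel"
  shows nn_integral_lborel_slices: "(\<integral>\<^sup>+t. \<integral>\<^sup>+x. f (x, t) \<partial>lborel \<partial>lborel) = (\<integral>\<^sup>+z. f z \<partial>lborel)"
    and measurable_nn_integral_slice: "(\<lambda>t. \<integral>\<^sup>+x. f (x, t) \<partial>lborel) \<in> borel_measurable borel"
proof -
  have f: "f \<in> borel_measurable (lborel \<Otimes>\<^sub>M lborel)"
    using assms by (simp add: lborel_prod)
  show "(\<integral>\<^sup>+t. \<integral>\<^sup>+x. f (x, t) \<partial>lborel \<partial>lborel) = (\<integral>\<^sup>+z. f z \<partial>lborel)"
    using lborel_pair.nn_integral_snd[OF f] by (simp add: lborel_prod)
  show "(\<lambda>t. \<integral>\<^sup>+x. f (x, t) \<partial>lborel) \<in> borel_measurable borel"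
    using lborel.borel_measurable_nn_integral_fst[OF measurable_pair_swap[OF f]] by simp
qed

text \<open>
The hypothesis \<open>eqn\<close> is the weak equation \<open>u\<^sub>t = div H\<close> tested with \<open>\<eta>(x) \<theta>(t)\<close>. By Fubini it says that
\<open>U(t) = \<integral> u(x,t) \<eta>(x) dx\<close> has the weak derivative \<open>-P\<close>, where \<open>P(t)\<close> is the integral of the
derivative of \<open>\<eta>\<close> in the direction \<open>H(x,t)\<close>. An increment of \<open>U\<close> is an integral of \<open>P\<close> over an
interval, hence at most the integral of \<open>|P|\<close> over the whole line.
\<close>

lemma time_increment_le:
  fixes u :: "nat \<Rightarrow> 'a::euclidean_space \<times> real \<Rightarrow> real" and H :: "nat \<Rightarrow> 'a \<times> real \<Rightarrow> 'a"
  assumes u: "\<And>i. i < N \<Longrightarrow> integrable lborel (u i)" and H: "\<And>i. i < N \<Longrightarrow> integrable lborel (H i)"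
    and I: "open I" "convex I"
    and eqn: "\<And>i \<theta>. i < N \<Longrightarrow> \<theta> \<in> test_functions I \<Longrightarrow>
      (LINT z|lborel. u i z * (\<eta> (fst z) * frechet_derivative \<theta> (at (snd z)) 1))
      = (LINT z|lborel. frechet_derivative \<eta> (at (fst z)) (H i z) * \<theta> (snd z))"
    and \<eta>: "\<eta> \<in> test_functions U" "\<And>x w. \<bar>frechet_derivative \<eta> (at x) w\<bar> \<le> K * norm w"
  shows "AE t in lborel. t \<in> I \<and> t + h \<in> I \<longrightarrow>
    vnorm N (\<lambda>i. (LINT x|lborel. u i (x, t + h) * \<eta> x) - (LINT x|lborel. u i (x, t) * \<eta> x))
      \<le> K * (LINT z|lborel. vnorm N (\<lambda>i. H i z))"
proof -
  define U where "U i t = (LINT x|lborel. u i (x, t) * \<eta> x)" for i t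
  define P where "P i t = (LINT x|lborel. frechet_derivative \<eta> (at x) (H i (x, t)))" for i t
  have "0 \<le> K"
    using \<eta>(2)[of undefined "SOME b. b \<in> Basis"]
    by (metis SOME_Basis mult.right_neutral norm_Basis abs_ge_zero order_trans)
  note uh = integrable_space_weight[OF u \<eta>(1)]
  have Hh: "integrable (lborel \<Otimes>\<^sub>M lborel) (\<lambda>(x, t). frechet_derivative \<eta> (at x) (H i (x, t)))" if "i < N" for i
    using integrable_frechet_derivative_test_function[OF \<eta>(1) H[OF that]]
    by (simp add: lborel_prod case_prod_beta')
  have U: "integrable lborel (U i)" if "i < N" for i
    unfolding U_def[abs_def] by (rule lborel_pair.integrable_snd[OF uh[OF that]])
  have P: "integrable lborel (P i)" if "i < N" for i
    unfolding P_def[abs_def] by (rule lborel_pair.integrable_snd[OF Hh[OF that]])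
  have wd: "(LINT t|lborel. U i t * frechet_derivative \<theta> (at t) h) = - (LINT t|lborel. (- h * P i t) * \<theta> t)"
    if i: "i < N" and \<theta>: "\<theta> \<in> test_functions I" for i \<theta>
  proof -
    let ?d = "\<lambda>t. frechet_derivative \<theta> (at t) 1"
    have lin: "frechet_derivative \<theta> (at t) h = h * ?d t" for t
      using linear_cmul[OF has_derivative_linear[OF test_functionsD(2)[OF \<theta>]], of t h 1] by simp
    note \<theta>' = test_functions_derivative[OF \<theta>, of 1]
    obtain C1 where C1: "0 < C1" "\<And>x. \<bar>?d x\<bar> \<le> C1" using test_functions_bounded[OF \<theta>'] by blast
    obtain C2 where C2: "0 < C2" "\<And>x. \<bar>\<theta> x\<bar> \<le> C2" using test_functions_bounded[OF \<theta>] by blast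
    have bd: "integrable (lborel \<Otimes>\<^sub>M lborel) (\<lambda>(x, t). F (x, t) * k t :: real)"
      if F: "integrable (lborel \<Otimes>\<^sub>M lborel) (\<lambda>(x, t). F (x, t))"
        and k: "k \<in> borel_measurable borel" "\<And>t. \<bar>k t\<bar> \<le> D" for F :: "'a \<times> real \<Rightarrow> real" and k D
    proof -
      note [measurable] = k(1)
      have "integrable (lborel \<Otimes>\<^sub>M lborel) (\<lambda>z. (case z of (x, t) \<Rightarrow> F (x, t)) * k (snd z))"
        using k(2) by (intro integrable_mult_bounded[OF F]) measurable
      then show ?thesis by (simp add: case_prod_beta')
    qed
    have "(LINT t|lborel. U i t * ?d t) = (LINT t|lborel. LINT x|lborel. u i (x, t) * \<eta> x * ?d t)"
      by (simp add: U_def)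
    also have "\<dots> = (LINT z|lborel. u i z * (\<eta> (fst z) * ?d (snd z)))"
    proof (subst lborel_pair.integral_snd)
      show "integrable (lborel \<Otimes>\<^sub>M lborel) (\<lambda>(x, t). u i (x, t) * \<eta> x * ?d t)"
        using bd[of "\<lambda>z. u i z * \<eta> (fst z)" ?d C1] uh[OF i] C1(2) test_functions_measurable[OF \<theta>'] by simp
    qed (simp add: lborel_prod case_prod_beta' mult.assoc)
    also have "\<dots> = (LINT z|lborel. frechet_derivative \<eta> (at (fst z)) (H i z) * \<theta> (snd z))"
      by (rule eqn[OF i \<theta>])
    also have "\<dots> = (LINT t|lborel. LINT x|lborel. frechet_derivative \<eta> (at x) (H i (x, t)) * \<theta> t)"
    proof (subst lborel_pair.integral_snd)
      show "integrable (lborel \<Otimes>\<^sub>M lborel) (\<lambda>(x, t). frechet_derivative \<eta> (at x) (H i (x, t)) * \<theta> t)"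
        using bd[of "\<lambda>z. frechet_derivative \<eta> (at (fst z)) (H i z)" \<theta> C2] Hh[OF i] C2(2) test_functions_measurable[OF \<theta>] by simp
    qed (simp add: lborel_prod case_prod_beta')
    also have "\<dots> = (LINT t|lborel. P i t * \<theta> t)"
      by (simp add: P_def)
    finally have "h * (LINT t|lborel. U i t * ?d t) = h * (LINT t|lborel. P i t * \<theta> t)"
      by simp
    then show ?thesis
      by (simp add: lin mult.left_commute mult.assoc)
  qed
  \<comment> \<open>the size of the time derivative, integrated over all times\<close>
  define W where "W r = vnorm N (\<lambda>i. P i r)" for r
  have W: "integrable lborel W"
    unfolding W_def[abs_def] by (rule integrable_vnorm[OF P])
  have Hv: "integrable lborel (\<lambda>z. vnorm N (\<lambda>i. H i z))"
    by (rule integrable_vnorm[OF H])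
  then have Hv2: "integrable (lborel \<Otimes>\<^sub>M lborel) (\<lambda>(x, t). vnorm N (\<lambda>i. H i (x, t)))"
    by (simp add: lborel_prod case_prod_beta')
  have AE_slice: "AE t in lborel. integrable lborel (\<lambda>x. F x t)"
    if "integrable (lborel \<Otimes>\<^sub>M lborel) (\<lambda>(x, t). F x t)" for F :: "'a \<Rightarrow> real \<Rightarrow> real"
    using lborel_pair.AE_integrable_snd[OF that] .
  have "(LINT r|lborel. W r) \<le> (LINT r|lborel. K * (LINT x|lborel. vnorm N (\<lambda>i. H i (x, r))))"
  proof (rule integral_mono_AE)
    show "integrable lborel (\<lambda>r. K * (LINT x|lborel. vnorm N (\<lambda>i. H i (x, r))))"
      by (intro integrable_mult_right lborel_pair.integrable_snd[OF Hv2])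
    have "AE r in lborel. \<forall>i<N. integrable lborel (\<lambda>x. frechet_derivative \<eta> (at x) (H i (x, r)))"
      by (subst AE_all_countable) (auto intro!: AE_impI AE_slice Hh)
    moreover have "AE r in lborel. integrable lborel (\<lambda>x. vnorm N (\<lambda>i. H i (x, r)))"
      by (rule AE_slice[OF Hv2])
    ultimately show "AE r in lborel. W r \<le> K * (LINT x|lborel. vnorm N (\<lambda>i. H i (x, r)))"
    proof eventually_elim
      case (elim r)
      have "W r \<le> (LINT x|lborel. vnorm N (\<lambda>i. frechet_derivative \<eta> (at x) (H i (x, r))))"
        unfolding W_def P_def using elim(1) by (intro vnorm_integral_le) auto
      also have "\<dots> \<le> (LINT x|lborel. K * vnorm N (\<lambda>i. H i (x, r)))"
      proof (rule integral_mono)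
        show "integrable lborel (\<lambda>x. vnorm N (\<lambda>i. frechet_derivative \<eta> (at x) (H i (x, r))))"
          using elim(1) by (intro integrable_vnorm) auto
        show "integrable lborel (\<lambda>x. K * vnorm N (\<lambda>i. H i (x, r)))"
          by (rule integrable_mult_right[OF elim(2)])
        fix x
        have "vnorm N (\<lambda>i. frechet_derivative \<eta> (at x) (H i (x, r))) \<le> vnorm N (\<lambda>i. K *\<^sub>R H i (x, r))"
          using \<eta>(2) \<open>0 \<le> K\<close> by (intro vnorm_mono) auto
        then show "vnorm N (\<lambda>i. frechet_derivative \<eta> (at x) (H i (x, r))) \<le> K * vnorm N (\<lambda>i. H i (x, r))"
          using \<open>0 \<le> K\<close> by (simp add: vnorm_scaleR)
      qed
      finally show ?case by simp
    qed
  qed (rule W)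
  also have "\<dots> = K * (LINT r|lborel. LINT x|lborel. vnorm N (\<lambda>i. H i (x, r)))"
    by simp
  also have "(LINT r|lborel. LINT x|lborel. vnorm N (\<lambda>i. H i (x, r))) = (LINT z|lborel. vnorm N (\<lambda>i. H i z))"
    using lborel_pair.integral_snd[OF Hv2] by (simp add: lborel_prod case_prod_beta')
  finally have W_le: "(LINT r|lborel. W r) \<le> K * (LINT z|lborel. vnorm N (\<lambda>i. H i z))" .
  show ?thesis
  proof (cases "h = 0")
    case True
    have "0 \<le> (LINT r|lborel. W r)" by (simp add: W_def vnorm_nonneg)
    then show ?thesis using W_le True by (simp add: vnorm_def L2_set_def)
  next
    case False
    have gi: "integrable lborel (\<lambda>t. - h * P i t)" if "i < N" for i
      using P[OF that] by (rule integrable_mult_right)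
    have "AE t in lborel. \<forall>i<N. t \<in> I \<and> t + h \<in> I \<longrightarrow>
        U i (t + h) - U i t = (LINT s|lborel. (- h * P i (t + s *\<^sub>R h)) * indicator {0..1::real} s)"
      by (subst AE_all_countable)
        (use weak_derivative_imp_increment[OF I U gi wd] in \<open>auto intro!: AE_impI\<close>)
    moreover have "AE t in lborel. \<forall>i<N. integrable lborel (\<lambda>s. (- h * P i (t + s *\<^sub>R h)) * indicator {0..1::real} s)"
      using lborel_pair.AE_integrable_fst'[OF integrable_along_segments[OF gi, of _ h]]
      by (subst AE_all_countable) (auto intro!: AE_impI)
    ultimately show ?thesis
    proof eventually_elim
      case (elim t)
      show ?case
      proof
        assume t: "t \<in> I \<and> t + h \<in> I"
        have "vnorm N (\<lambda>i. U i (t + h) - U i t) =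
            vnorm N (\<lambda>i. LINT s|lborel. (- h * P i (t + s *\<^sub>R h)) * indicator {0..1::real} s)"
          using elim(1) t by (intro vnorm_cong) auto
        also have "\<dots> \<le> (LINT s|lborel. vnorm N (\<lambda>i. (- h * P i (t + s *\<^sub>R h)) * indicator {0..1::real} s))"
          using elim(2) by (intro vnorm_integral_le) auto
        \<comment> \<open>drop the restriction to \<open>0 \<le> s \<le> 1\<close>, so that \<open>r = t + h s\<close> may be substituted\<close>
        also have "\<dots> \<le> (LINT s|lborel. \<bar>h\<bar> * W (t + h * s))"
        proof (intro integral_mono integrable_vnorm integrable_mult_right)
          show "integrable lborel (\<lambda>s. W (t + h * s))"
            by (rule lborel_integrable_real_affine[OF W False])
          fix s :: real
          have "vnorm N (\<lambda>i. (- h * P i (t + s *\<^sub>R h)) * indicator {0..1} s) =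
              vnorm N (\<lambda>i. (- h * indicator {0..1} s) * P i (t + h * s))"
            by (simp add: mult_ac)
          also have "\<dots> = \<bar>h\<bar> * indicator {0..1} s * W (t + h * s)"
            unfolding vnorm_mult W_def by (simp add: abs_mult)
          also have "\<dots> \<le> \<bar>h\<bar> * W (t + h * s)"
            by (auto simp: indicator_def W_def vnorm_nonneg)
          finally show "vnorm N (\<lambda>i. (- h * P i (t + s *\<^sub>R h)) * indicator {0..1} s) \<le> \<bar>h\<bar> * W (t + h * s)" .
        qed (use elim(2) in auto)
        also have "\<dots> = (LINT r|lborel. W r)"
          using lborel_integral_real_affine[OF False, of W t] by simp
        also note W_le
        finally show "vnorm N (\<lambda>i. (LINT x|lborel. u i (x, t + h) * \<eta> x) - (LINT x|lborel. u i (x, t) * \<eta> x))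
            \<le> K * (LINT z|lborel. vnorm N (\<lambda>i. H i z))"
          by (simp add: U_def)
      qed
    qed
  qed
qed

text \<open>
The bound holds for every shift \<open>h\<close> and almost every \<open>t\<close>. By Fubini it holds for almost every time \<open>t\<close>
and almost every shift, that is, for almost every second time; any such \<open>t\<close> in \<open>I\<close> will do.
\<close>

lemma exists_reference_time:
  fixes U :: "nat \<Rightarrow> real \<Rightarrow> real"
  assumes U [measurable]: "\<And>i. i < N \<Longrightarrow> U i \<in> borel_measurable borel"
    and I [measurable]: "I \<in> sets borel" and pos: "emeasure lborel I \<noteq> 0"
    and osc: "\<And>h. AE t in lborel. t \<in> I \<and> t + h \<in> I \<longrightarrow> vnorm N (\<lambda>i. U i (t + h) - U i t) \<le> M"
  obtains s where "s \<in> I" "AE t in lborel. t \<in> I \<longrightarrow> vnorm N (\<lambda>i. U i t - U i s) \<le> M"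
proof -
  have [measurable]: "(\<lambda>z. vnorm N (\<lambda>i. U i (snd z + fst z) - U i (snd z))) \<in> borel_measurable (borel \<Otimes>\<^sub>M borel)"
    by (rule vnorm_measurable) measurable
  have [measurable]: "(\<lambda>t. vnorm N (\<lambda>i. U i t - U i s)) \<in> borel_measurable borel" for s
    by (rule vnorm_measurable) measurable
  let ?P = "\<lambda>h t. t \<in> I \<and> t + h \<in> I \<longrightarrow> vnorm N (\<lambda>i. U i (t + h) - U i t) \<le> M"
  have "AE h in lborel. AE t in lborel. ?P h t"
    by (rule AE_I2) (rule osc)
  then have "AE t in lborel. AE h in lborel. ?P h t"
    by (subst lborel_pair.AE_commute[symmetric]) measurable
  then have "AE s in lborel. s \<in> I \<longrightarrow> (AE t in lborel. t \<in> I \<longrightarrow> vnorm N (\<lambda>i. U i t - U i s) \<le> M)"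
  proof eventually_elim
    case (elim s)
    have "AE t in lborel. t \<in> I \<longrightarrow> vnorm N (\<lambda>i. U i t - U i s) \<le> M" if s: "s \<in> I"
    proof -
      have "AE h in lborel. s + h \<in> I \<longrightarrow> vnorm N (\<lambda>i. U i (s + h) - U i s) \<le> M"
        using elim by eventually_elim (use s in auto)
      then have "AE h in lborel. s + (- s + 1 * h) \<in> I \<longrightarrow> vnorm N (\<lambda>i. U i (s + (- s + 1 * h)) - U i s) \<le> M"
        by (intro AE_borel_affine[where P="\<lambda>h. s + h \<in> I \<longrightarrow> vnorm N (\<lambda>i. U i (s + h) - U i s) \<le> M"]) measurable
      then show ?thesis by simp
    qed
    then show ?case by simp
  qed
  moreover have "\<not> (AE s in lborel. s \<notin> I)"
    using pos AE_iff_null_sets[of I lborel] by auto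
  ultimately have "\<exists>s\<in>I. AE t in lborel. t \<in> I \<longrightarrow> vnorm N (\<lambda>i. U i t - U i s) \<le> M"
    by (metis (mono_tags, lifting) eventually_mono)
  then show ?thesis using that by blast
qed

section \<open>The estimate on a cylinder\<close>

text \<open>
The function \<open>exp(-1/y)\<close> at \<open>y = 1/4 - |x - x0|\<^sup>2/\<rho>\<^sup>2\<close> is supported in the ball of radius \<open>\<rho>/2\<close>,
where the gradient of \<open>y\<close> has length at most \<open>1/\<rho>\<close>. On the ball of radius \<open>\<rho>/4\<close> one has
\<open>y \<ge> 3/16\<close>, whence the lower bound \<open>exp(-16/3)\<close> on a fraction \<open>4\<^sup>-\<^sup>n\<close> of the volume.
\<close>

lemma exists_cutoff:
  fixes x0 :: "'a::euclidean_space"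
  assumes \<rho>: "0 < \<rho>"
  obtains \<eta> where "\<eta> \<in> test_functions (ball x0 \<rho>)" "\<And>x. 0 \<le> \<eta> x" "\<And>x. \<eta> x \<le> 1"
    "\<And>x w. \<bar>frechet_derivative \<eta> (at x) w\<bar> \<le> 1 / \<rho> * norm w"
    "exp (-16/3) / 4 ^ DIM('a) * measure lborel (ball x0 \<rho>) \<le> (LINT x|lborel. \<eta> x)"
proof -
  define y where "y x = 1/4 - ((x - x0) \<bullet> (x - x0)) / \<rho>\<^sup>2" for x
  define \<eta> where "\<eta> x = flat_exp 0 (y x)" for x
  have y_eq: "y x = 1/4 - (norm (x - x0) / \<rho>)\<^sup>2" for x
    by (simp add: y_def power_divide power2_norm_eq_inner)
  have sm_y: "C_k k y" for k
  proof -
    have "C_k k (\<lambda>x. 1/4 - (\<Sum>b\<in>Basis. (x \<bullet> b - x0 \<bullet> b) * (x \<bullet> b - x0 \<bullet> b)) * (1 / \<rho>\<^sup>2))"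
    proof (intro C_k_minus[OF C_k_const] C_k_mult[OF _ C_k_const])
      have sq: "C_k k (\<lambda>x. (x \<bullet> b - x0 \<bullet> b) * (x \<bullet> b - x0 \<bullet> b))" for b
        by (rule C_k_mult; rule C_k_minus[OF C_k_bounded_linear[OF bounded_linear_inner_left] C_k_const])
      have "C_k k (\<lambda>x. \<Sum>b\<in>B. (x \<bullet> b - x0 \<bullet> b) * (x \<bullet> b - x0 \<bullet> b))" for B :: "'a set"
        by (induction B rule: infinite_finite_induct)
          (simp_all add: C_k_const C_k_add[OF sq])
      then show "C_k k (\<lambda>x::'a. \<Sum>b\<in>Basis. (x \<bullet> b - x0 \<bullet> b) * (x \<bullet> b - x0 \<bullet> b))" .
    qed
    moreover have "y = (\<lambda>x. 1/4 - (\<Sum>b\<in>Basis. (x \<bullet> b - x0 \<bullet> b) * (x \<bullet> b - x0 \<bullet> b)) * (1 / \<rho>\<^sup>2))"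
    proof (rule ext)
      fix x
      have "(x - x0) \<bullet> (x - x0) = (\<Sum>b\<in>Basis. (x \<bullet> b - x0 \<bullet> b) * (x \<bullet> b - x0 \<bullet> b))"
        by (subst euclidean_inner) (simp only: inner_diff_left)
      then show "y x = 1/4 - (\<Sum>b\<in>Basis. (x \<bullet> b - x0 \<bullet> b) * (x \<bullet> b - x0 \<bullet> b)) * (1 / \<rho>\<^sup>2)"
        by (simp add: y_def)
    qed
    ultimately show ?thesis by simp
  qed
  have off: "\<eta> x = 0 \<and> flat_exp 2 (y x) = 0" if "\<rho> / 2 < norm (x - x0)" for x
  proof -
    have "1/2 \<le> norm (x - x0) / \<rho>" using that \<rho> by (simp add: field_simps)
    then have "(1/2)\<^sup>2 \<le> (norm (x - x0) / \<rho>)\<^sup>2" by (intro power_mono) auto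
    then show ?thesis by (simp add: \<eta>_def y_eq flat_exp_def power2_eq_square)
  qed
  have test: "\<eta> \<in> test_functions (ball x0 \<rho>)"
  proof (rule test_functionsI)
    show "compact (cball x0 (\<rho>/2))" "cball x0 (\<rho>/2) \<subseteq> ball x0 \<rho>" using \<rho> by auto
    show "C_k k \<eta>" for k
      unfolding \<eta>_def[abs_def] by (rule C_k_compose_real[OF C_k_flat_exp sm_y])
    show "\<eta> x = 0" if "x \<notin> cball x0 (\<rho>/2)" for x
      using that off[of x] by (simp add: dist_norm norm_minus_commute)
  qed
  have nonneg: "0 \<le> \<eta> x" for x by (simp add: \<eta>_def flat_exp_def)
  have le1: "\<eta> x \<le> 1" for x by (simp add: \<eta>_def flat_exp_def)
  have deriv: "\<bar>frechet_derivative \<eta> (at x) w\<bar> \<le> 1 / \<rho> * norm w" for x w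
  proof -
    have dy: "(y has_derivative (\<lambda>w. - (2 * ((x - x0) \<bullet> w)) / \<rho>\<^sup>2)) (at x)"
      unfolding y_def[abs_def]
      using \<rho> by (auto intro!: derivative_eq_intros ext simp: inner_commute power2_eq_square power4_eq_xxxx)
    have "(flat_exp 0 has_derivative (\<lambda>h. flat_exp 2 (y x) * h)) (at (y x))"
      using flat_exp_has_derivative[of 0 "y x"] by (simp add: has_field_derivative_def numeral_2_eq_2)
    from has_derivative_compose[OF dy this]
    have "frechet_derivative \<eta> (at x) w = flat_exp 2 (y x) * (- (2 * ((x - x0) \<bullet> w)) / \<rho>\<^sup>2)"
      unfolding \<eta>_def[abs_def] by (metis frechet_derivative_at)
    then have eq: "\<bar>frechet_derivative \<eta> (at x) w\<bar> = flat_exp 2 (y x) * (2 * \<bar>(x - x0) \<bullet> w\<bar> / \<rho>\<^sup>2)"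
      by (simp add: abs_mult flat_exp_def)
    show ?thesis
    proof (cases "\<rho> / 2 < norm (x - x0)")
      case True
      then show ?thesis using off[of x] \<rho> by (simp add: eq)
    next
      case False
      have "\<bar>(x - x0) \<bullet> w\<bar> \<le> norm (x - x0) * norm w" by (rule Cauchy_Schwarz_ineq2)
      also have "\<dots> \<le> \<rho> / 2 * norm w" using False by (intro mult_right_mono) auto
      finally have "2 * \<bar>(x - x0) \<bullet> w\<bar> / \<rho>\<^sup>2 \<le> 2 * (\<rho> / 2 * norm w) / \<rho>\<^sup>2"
        using \<rho> by (intro divide_right_mono mult_left_mono) auto
      also have "\<dots> = 1 / \<rho> * norm w" using \<rho> by (simp add: power2_eq_square)
      finally have "2 * \<bar>(x - x0) \<bullet> w\<bar> / \<rho>\<^sup>2 \<le> 1 / \<rho> * norm w" .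
      moreover have "flat_exp 2 (y x) * (2 * \<bar>(x - x0) \<bullet> w\<bar> / \<rho>\<^sup>2) \<le> 1 * (2 * \<bar>(x - x0) \<bullet> w\<bar> / \<rho>\<^sup>2)"
        by (intro mult_right_mono flat_exp_2_le_1) auto
      ultimately show ?thesis by (simp add: eq)
    qed
  qed
  have [measurable]: "\<eta> \<in> borel_measurable borel" by (rule test_functions_measurable[OF test])
  have ball4: "emeasure lborel (ball x0 r) < \<infinity>" for r
    using emeasure_lborel_ball_finite by auto
  have int: "integrable lborel \<eta>"
  proof (rule Bochner_Integration.integrable_bound)
    show "integrable lborel (indicator (ball x0 \<rho>) :: 'a \<Rightarrow> real)"
      using ball4 by (intro integrable_real_indicator) auto
    show "AE x in lborel. norm (\<eta> x) \<le> norm (indicator (ball x0 \<rho>) x :: real)"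
      using nonneg le1 test_functionsD(4)[OF test] by (auto simp: indicator_def intro!: AE_I2)
  qed measurable
  have "exp (-16/3) / 4 ^ DIM('a) * measure lborel (ball x0 \<rho>) = (LINT x|lborel. exp (-16/3) * indicator (ball x0 (\<rho>/4)) x)"
    using \<rho> content_ball_conv_unit_ball[of \<rho> x0] content_ball_conv_unit_ball[of "\<rho>/4" x0]
    by (simp add: power_divide)
  also have "\<dots> \<le> (LINT x|lborel. \<eta> x)"
  proof (rule integral_mono[OF _ int])
    show "integrable lborel (\<lambda>x::'a. exp (-16/3) * indicator (ball x0 (\<rho>/4)) x :: real)"
      using ball4 by (intro integrable_mult_right integrable_real_indicator) auto
    fix x
    show "exp (-16/3) * indicator (ball x0 (\<rho>/4)) x \<le> \<eta> x"
    proof (cases "x \<in> ball x0 (\<rho>/4)")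
      case True
      then have "norm (x - x0) / \<rho> \<le> 1/4"
        using \<rho> by (simp add: dist_norm norm_minus_commute field_simps)
      then have "(norm (x - x0) / \<rho>)\<^sup>2 \<le> (1/4)\<^sup>2"
        using \<rho> by (intro power_mono) auto
      then have "3/16 \<le> y x" by (simp add: y_eq power2_eq_square)
      moreover from this have "inverse (y x) \<le> inverse (3/16)"
        by (intro le_imp_inverse_le) auto
      ultimately show ?thesis using True by (simp add: \<eta>_def flat_exp_def)
    qed (use nonneg in simp)
  qed
  finally show ?thesis
    using that[OF test nonneg le1 deriv] by simp
qed

text \<open>
With \<open>H\<close> the flux minus the datum \<open>F\<close> and \<open>\<mu>\<close> the volume of the cylinder, the average of \<open>|H|\<close>
enters with the scaling \<open>\<rho>\<close> because \<open>\<mu> = 2 \<rho>\<^sup>2 |B|\<close> turns \<open>(1/(\<kappa> |B| \<rho>)) \<integral> |H|\<close> into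
\<open>(2 \<rho>/\<kappa>) (1/\<mu>) \<integral> |H|\<close>. Both the oscillation in space and that in time carry the factor \<open>(2 \<rho>/\<kappa>)\<^sup>q\<close>.
\<close>

lemma cylinder_oscillation:
  fixes u :: "nat \<Rightarrow> 'a::euclidean_space \<times> real \<Rightarrow> real"
    and Du H :: "nat \<Rightarrow> 'a \<times> real \<Rightarrow> 'a"
  assumes q: "1 \<le> q" and \<rho>: "0 < \<rho>"
    and u: "\<And>i. i < N \<Longrightarrow> integrable lborel (u i)"
    and Du: "\<And>i. i < N \<Longrightarrow> integrable lborel (Du i)"
    and H: "\<And>i. i < N \<Longrightarrow> integrable lborel (H i)"
    and I: "I = {t0 - \<rho>\<^sup>2<..<t0 + \<rho>\<^sup>2}"
    and slices: "AE t in lborel. t \<in> I \<longrightarrow> (\<forall>i<N. \<forall>\<phi>\<in>test_functions (ball x0 \<rho>). \<forall>v.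
      (LINT x|lborel. u i (x, t) * frechet_derivative \<phi> (at x) v) = - (LINT x|lborel. (Du i (x, t) \<bullet> v) * \<phi> x))"
    and eqn: "\<And>i \<eta> \<theta>. i < N \<Longrightarrow> \<eta> \<in> test_functions (ball x0 \<rho>) \<Longrightarrow> \<theta> \<in> test_functions I \<Longrightarrow>
      (LINT z|lborel. u i z * (\<eta> (fst z) * frechet_derivative \<theta> (at (snd z)) 1))
      = (LINT z|lborel. frechet_derivative \<eta> (at (fst z)) (H i z) * \<theta> (snd z))"
    and \<kappa>: "\<kappa> = exp (-16/3) / 4 ^ DIM('a)"
    and Q: "\<mu> = 2 * \<rho>\<^sup>2 * measure lborel (ball x0 \<rho>)"
  obtains a where
    "(\<integral>\<^sup>+z. ennreal (vnorm N (\<lambda>i. u i z - a i) powr q) * indicator (ball x0 \<rho> \<times> I) z \<partial>lborel)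
      \<le> ennreal (2 powr q * 2 ^ DIM('a) * (2 * \<rho> / \<kappa>) powr q) *
        ((\<integral>\<^sup>+z. ennreal (vnorm N (\<lambda>i. Du i z) powr q) \<partial>lborel) +
         ennreal (\<mu> * ((LINT z|lborel. vnorm N (\<lambda>i. H i z)) / \<mu>) powr q))"
proof -
  let ?B = "ball x0 \<rho>"
  define b where "b = measure lborel ?B"
  have b: "0 < b" using \<rho> content_ball_pos[of \<rho> x0] by (simp add: b_def)
  have \<kappa>_pos: "0 < \<kappa>" by (simp add: \<kappa>)
  have \<mu>_pos: "0 < \<mu>" using b \<rho> by (simp add: Q b_def)
  obtain \<eta> where \<eta>: "\<eta> \<in> test_functions ?B" "\<And>x. 0 \<le> \<eta> x" "\<And>x. \<eta> x \<le> 1"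
    "\<And>x w. \<bar>frechet_derivative \<eta> (at x) w\<bar> \<le> 1 / \<rho> * norm w"
    "\<kappa> * b \<le> (LINT x|lborel. \<eta> x)"
    using exists_cutoff[OF \<rho>, of x0] unfolding \<kappa> b_def by blast
  define m where "m = (LINT x|lborel. \<eta> x)"
  have m_ge: "\<kappa> * b \<le> m" using \<eta>(5) by (simp add: m_def)
  then have m: "0 < m" using \<kappa>_pos b by (smt (verit) mult_pos_pos)
  define U where "U i t = (LINT x|lborel. u i (x, t) * \<eta> x)" for i t
  define h where "h = (LINT z|lborel. vnorm N (\<lambda>i. H i z))"
  have h: "0 \<le> h" by (simp add: h_def vnorm_nonneg)
  have Im [measurable]: "I \<in> sets borel" by (simp add: I)
  have um [measurable]: "u i \<in> borel_measurable borel" if "i < N" for i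
    using borel_measurable_integrable[OF u[OF that]] by simp
  have Dum [measurable]: "Du i \<in> borel_measurable borel" if "i < N" for i
    using borel_measurable_integrable[OF Du[OF that]] by simp
  note [measurable] = test_functions_measurable[OF \<eta>(1)]
  have Um: "U i \<in> borel_measurable borel" if "i < N" for i
    using borel_measurable_integrable[OF lborel_pair.integrable_snd[OF integrable_space_weight[OF u[OF that] \<eta>(1)]]]
    by (simp add: U_def[abs_def])
  have osc: "AE t in lborel. t \<in> I \<and> t + k \<in> I \<longrightarrow> vnorm N (\<lambda>i. U i (t + k) - U i t) \<le> 1 / \<rho> * h" for k
    unfolding U_def h_def
    by (rule time_increment_le[OF u H _ _ eqn[OF _ \<eta>(1)] \<eta>(1) \<eta>(4)]) (auto simp: I)
  obtain s where s: "AE t in lborel. t \<in> I \<longrightarrow> vnorm N (\<lambda>i. U i t - U i s) \<le> 1 / \<rho> * h"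
    using exists_reference_time[OF Um Im _ osc] \<rho> by (auto simp: I)
  \<comment> \<open>the weighted average at the reference time\<close>
  define a where "a i = U i s / m" for i
  let ?C = "(2 * \<rho> / \<kappa>) powr q"
  let ?M = "2 * \<rho> / \<kappa> * (h / \<mu>)"
  have M_nonneg: "0 \<le> ?M" using h \<rho> \<kappa>_pos \<mu>_pos by simp
  have M: "1 / \<rho> * h / m \<le> ?M"
  proof -
    have "1 / \<rho> * h / m \<le> 1 / \<rho> * h / (\<kappa> * b)"
      using m_ge h \<rho> \<kappa>_pos b m by (intro divide_left_mono) auto
    also have "\<dots> = ?M"
      using \<rho> b \<kappa>_pos by (simp add: Q b_def[symmetric] field_simps power2_eq_square)
    finally show ?thesis .
  qed
  have const: "measure lborel ?B powr (q - 1) / m powr q * (2 * \<rho>) powr q * measure lborel (ball (0::'a) (2 * \<rho>))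
      \<le> 2 ^ DIM('a) * ?C"
  proof -
    have "measure lborel (ball (0::'a) (2 * \<rho>)) = 2 ^ DIM('a) * b"
      using \<rho> content_ball_conv_unit_ball[of \<rho> x0] content_ball_conv_unit_ball[of "2 * \<rho>" "0::'a"]
      by (simp add: b_def power_mult_distrib)
    moreover have "b powr (q - 1) / m powr q \<le> b powr (q - 1) / (\<kappa> * b) powr q"
      using q m_ge \<kappa>_pos b m by (intro divide_left_mono powr_mono2) auto
    then have "b powr (q - 1) / m powr q * (2 * \<rho>) powr q * (2 ^ DIM('a) * b)
        \<le> b powr (q - 1) / (\<kappa> * b) powr q * (2 * \<rho>) powr q * (2 ^ DIM('a) * b)"
      using b by (intro mult_right_mono) auto
    moreover have "b powr (q - 1) / (\<kappa> * b) powr q * (2 * \<rho>) powr q * (2 ^ DIM('a) * b) = 2 ^ DIM('a) * ?C"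
      using b \<kappa>_pos \<rho> by (simp add: powr_mult powr_divide powr_diff)
    ultimately show ?thesis by (simp add: b_def)
  qed
  have slice_int: "AE t in lborel. \<forall>i<N. integrable lborel (\<lambda>x. F i (x, t))"
    if "\<And>i. i < N \<Longrightarrow> integrable lborel (F i)" for F :: "nat \<Rightarrow> 'a \<times> real \<Rightarrow> 'b::euclidean_space"
  proof -
    have "AE t in lborel. integrable lborel (\<lambda>x. F i (x, t))" if "i < N" for i
      using \<open>\<And>i. i < N \<Longrightarrow> integrable lborel (F i)\<close>[OF that]
      by (intro lborel_pair.AE_integrable_snd) (simp add: lborel_prod)
    then show ?thesis by (subst AE_all_countable) (auto intro!: AE_impI)
  qed
  have u_slice: "AE t in lborel. \<forall>i<N. integrable lborel (\<lambda>x. u i (x, t))"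
    by (rule slice_int) (rule u)
  have Du_slice: "AE t in lborel. \<forall>i<N. integrable lborel (\<lambda>x. Du i (x, t))"
    by (rule slice_int) (rule Du)
  let ?G = "\<lambda>t. \<integral>\<^sup>+x. ennreal (vnorm N (\<lambda>i. Du i (x, t)) powr q) \<partial>lborel"
  have [measurable]: "(\<lambda>z. vnorm N (\<lambda>i. Du i z)) \<in> borel_measurable borel"
    by (rule vnorm_measurable) measurable
  have Gm: "(\<lambda>z. ennreal (vnorm N (\<lambda>i. Du i z) powr q)) \<in> borel_measurable borel"
    by measurable
  have "AE t in lborel. (\<integral>\<^sup>+x. ennreal (vnorm N (\<lambda>i. u i (x, t) - a i) powr q) * indicator (?B \<times> I) (x, t) \<partial>lborel)
      \<le> ennreal (2 powr q * 2 ^ DIM('a) * ?C) * (?G t + ennreal (b * (h / \<mu>) powr q) * indicator I t)"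
    using s slices u_slice Du_slice
  proof eventually_elim
    case (elim t)
    show ?case
    proof (cases "t \<in> I")
      case True
      let ?w = "\<lambda>i. U i t / m"
      have osc_t: "vnorm N (\<lambda>i. ?w i - a i) \<le> ?M"
      proof -
        have "vnorm N (\<lambda>i. ?w i - a i) = vnorm N (\<lambda>i. (1 / m) * (U i t - U i s))"
          by (simp add: a_def diff_divide_distrib)
        also have "\<dots> \<le> (1 / m) * (1 / \<rho> * h)"
          using elim(1) True m unfolding vnorm_mult by (intro mult_mono) (auto simp: vnorm_nonneg)
        also have "\<dots> = 1 / \<rho> * h / m" by simp
        also note M
        finally show ?thesis .
      qed
      have [measurable]: "(\<lambda>x. vnorm N (\<lambda>i. u i (x, t) - ?w i)) \<in> borel_measurable borel"
      proof (rule vnorm_measurable)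
        fix i assume "i < N"
        then have "integrable lborel (\<lambda>x. u i (x, t))" using elim by auto
        from borel_measurable_integrable[OF this]
        show "(\<lambda>x. u i (x, t) - ?w i) \<in> borel_measurable borel" by measurable
      qed
      have "(\<integral>\<^sup>+x. ennreal (vnorm N (\<lambda>i. u i (x, t) - a i) powr q) * indicator (?B \<times> I) (x, t) \<partial>lborel)
        \<le> (\<integral>\<^sup>+x. ennreal (2 powr q) * (ennreal (vnorm N (\<lambda>i. u i (x, t) - ?w i) powr q) * indicator ?B x
              + ennreal (?M powr q) * indicator ?B x) \<partial>lborel)"
      proof (rule nn_integral_mono)
        fix x
        have "vnorm N (\<lambda>i. u i (x, t) - a i) powr q \<le> (vnorm N (\<lambda>i. u i (x, t) - ?w i) + ?M) powr q"
          using q osc_t vnorm_diff_triangle[of N "\<lambda>i. u i (x, t)" a ?w] by (intro powr_mono2) (auto simp: vnorm_nonneg)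
        also have "\<dots> \<le> 2 powr q * (vnorm N (\<lambda>i. u i (x, t) - ?w i) powr q + ?M powr q)"
          by (intro powr_add_le q M_nonneg vnorm_nonneg)
        finally have "ennreal (vnorm N (\<lambda>i. u i (x, t) - a i) powr q) \<le>
            ennreal (2 powr q * (vnorm N (\<lambda>i. u i (x, t) - ?w i) powr q + ?M powr q))"
          by (rule ennreal_leI)
        also have "\<dots> = ennreal (2 powr q) * (ennreal (vnorm N (\<lambda>i. u i (x, t) - ?w i) powr q) + ennreal (?M powr q))"
          by (simp add: ennreal_mult)
        finally show "ennreal (vnorm N (\<lambda>i. u i (x, t) - a i) powr q) * indicator (?B \<times> I) (x, t) \<le>
            ennreal (2 powr q) * (ennreal (vnorm N (\<lambda>i. u i (x, t) - ?w i) powr q) * indicator ?B x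
              + ennreal (?M powr q) * indicator ?B x)"
          by (auto simp: indicator_def)
      qed
      also have "\<dots> = ennreal (2 powr q) * ((\<integral>\<^sup>+x. ennreal (vnorm N (\<lambda>i. u i (x, t) - ?w i) powr q) * indicator ?B x \<partial>lborel)
              + ennreal (?M powr q) * emeasure lborel ?B)"
      proof -
        have [measurable]: "?B \<in> sets borel" by simp
        show ?thesis
          by (subst nn_integral_cmult, measurable, subst nn_integral_add, measurable, subst nn_integral_cmult_indicator) auto
      qed
      also have "(\<integral>\<^sup>+x. ennreal (vnorm N (\<lambda>i. u i (x, t) - ?w i) powr q) * indicator ?B x \<partial>lborel)
          \<le> ennreal (measure lborel ?B powr (q - 1) / m powr q * (2 * \<rho>) powr q * measure lborel (ball (0::'a) (2 * \<rho>))) * ?G t"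
        unfolding U_def
        using elim True by (intro weighted_poincare[OF q \<rho> _ _ _ \<eta>(1-3) m_def m]) auto
      also have "\<dots> \<le> ennreal (2 ^ DIM('a) * ?C) * ?G t"
        by (intro mult_right_mono ennreal_leI const) auto
      also have "emeasure lborel ?B = ennreal b"
        unfolding b_def using emeasure_lborel_ball_finite[of x0 \<rho>] by (intro emeasure_eq_ennreal_measure) auto
      also have "ennreal (?M powr q) * ennreal b \<le> ennreal (2 ^ DIM('a) * ?C) * ennreal (b * (h / \<mu>) powr q)"
      proof -
        have "?M powr q * b = 1 * (?C * (b * (h / \<mu>) powr q))"
          using \<rho> \<kappa>_pos h \<mu>_pos by (simp add: powr_mult powr_divide)
        also have "\<dots> \<le> 2 ^ DIM('a) * (?C * (b * (h / \<mu>) powr q))"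
          using b by (intro mult_right_mono) auto
        finally have "ennreal (?M powr q * b) \<le> ennreal (2 ^ DIM('a) * ?C * (b * (h / \<mu>) powr q))"
          by (intro ennreal_leI) (simp add: mult.assoc)
        then show ?thesis using b by (simp add: ennreal_mult)
      qed
      finally show ?thesis
        using True by (simp add: distrib_left mult.assoc ennreal_mult add_mono mult_left_mono)
    qed simp
  qed
  then have "(\<integral>\<^sup>+t. \<integral>\<^sup>+x. ennreal (vnorm N (\<lambda>i. u i (x, t) - a i) powr q) * indicator (?B \<times> I) (x, t) \<partial>lborel \<partial>lborel)
      \<le> (\<integral>\<^sup>+t. ennreal (2 powr q * 2 ^ DIM('a) * ?C) * (?G t + ennreal (b * (h / \<mu>) powr q) * indicator I t) \<partial>lborel)"
    by (rule nn_integral_mono_AE)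
  also have "\<dots> = ennreal (2 powr q * 2 ^ DIM('a) * ?C) * ((\<integral>\<^sup>+t. ?G t \<partial>lborel) + ennreal (b * (h / \<mu>) powr q) * emeasure lborel I)"
    using measurable_nn_integral_slice[OF Gm]
    by (subst nn_integral_cmult, simp, subst nn_integral_add, simp_all add: nn_integral_cmult_indicator)
  also have "ennreal (b * (h / \<mu>) powr q) * emeasure lborel I = ennreal (\<mu> * (h / \<mu>) powr q)"
    using b \<rho> by (simp add: I Q b_def[symmetric] ennreal_mult[symmetric] mult_ac)
  also have "(\<integral>\<^sup>+t. ?G t \<partial>lborel) = (\<integral>\<^sup>+z. ennreal (vnorm N (\<lambda>i. Du i z) powr q) \<partial>lborel)"
    by (rule nn_integral_lborel_slices[OF Gm])
  also have "(\<integral>\<^sup>+t. \<integral>\<^sup>+x. ennreal (vnorm N (\<lambda>i. u i (x, t) - a i) powr q) * indicator (?B \<times> I) (x, t) \<partial>lborel \<partial>lborel)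
     = (\<integral>\<^sup>+z. ennreal (vnorm N (\<lambda>i. u i z - a i) powr q) * indicator (?B \<times> I) z \<partial>lborel)"
  proof (rule nn_integral_lborel_slices)
    have [measurable]: "?B \<times> I \<in> sets borel"
      by (intro borel_open open_Times) (simp_all add: I)
    have [measurable]: "(\<lambda>z. vnorm N (\<lambda>i. u i z - a i)) \<in> borel_measurable borel"
      by (rule vnorm_measurable) measurable
    show "(\<lambda>z. ennreal (vnorm N (\<lambda>i. u i z - a i) powr q) * indicator (?B \<times> I) z) \<in> borel_measurable borel"
      by measurable
  qed
  finally show ?thesis
    using that[of a] by (simp add: h_def)
qed

section \<open>Lebesgue measurable data and Borel representatives\<close>

lemma AE_eq_measurable_lebesgue_on:
  fixes f g :: "'a::euclidean_space \<Rightarrow> 'b::euclidean_space"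
  assumes S: "S \<in> sets lebesgue" and g: "g \<in> borel_measurable (lebesgue_on S)"
    and eq: "AE x in lebesgue_on S. f x = g x"
  shows "f \<in> borel_measurable (lebesgue_on S)"
proof -
  have "(\<lambda>x. if x \<in> S then g x else 0) \<in> borel_measurable lebesgue"
    using g S by (rule borel_measurable_if_I)
  moreover have "AE x in lebesgue. (if x \<in> S then g x else 0) = (if x \<in> S then f x else 0)"
    using eq S by (auto simp: AE_restrict_space_iff elim!: eventually_mono)
  ultimately have "(\<lambda>x. if x \<in> S then f x else 0) \<in> borel_measurable lebesgue"
    by (rule borel_measurable_AE)
  then show ?thesis by (rule borel_measurable_if_D)
qed

text \<open>
Lebesgue measure on a product space is only the completion of the product measure. Borel
representatives are measurable on every slice, and Fubini's theorem applies to them directly.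
\<close>

lemma borel_representative:
  fixes f :: "'a::euclidean_space \<Rightarrow> 'b::euclidean_space"
  assumes S: "S \<in> sets borel" and f: "integrable (lebesgue_on S) f"
  obtains g where "integrable lborel g" "AE x in lborel. x \<in> S \<longrightarrow> f x = g x" "\<And>x. x \<notin> S \<Longrightarrow> g x = 0"
proof -
  have SL: "S \<in> sets lebesgue" using S by simp
  have F: "integrable lebesgue (\<lambda>x. indicator S x *\<^sub>R f x)"
    using f SL by (subst (asm) integrable_restrict_space) auto
  have "\<exists>g\<in>borel_measurable lborel. AE x in lborel. (indicator S x *\<^sub>R f x) \<bullet> b = g x" for b
    using F by (intro completion_ex_borel_measurable_real borel_measurable_integrable integrable_inner_left)
  then obtain G where G: "\<And>b. G b \<in> borel_measurable lborel"
    "\<And>b. AE x in lborel. (indicator S x *\<^sub>R f x) \<bullet> b = G b x"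
    by metis
  have Gm [measurable]: "G b \<in> borel_measurable borel" for b
    using G(1)[of b] by simp
  define g where "g x = indicator S x *\<^sub>R (\<Sum>b\<in>Basis. G b x *\<^sub>R b)" for x
  have [measurable]: "g \<in> borel_measurable borel"
    unfolding g_def[abs_def] using S by measurable
  have "AE x in lborel. \<forall>b\<in>Basis. (indicator S x *\<^sub>R f x) \<bullet> b = G b x"
    using G(2) by (intro AE_finite_allI) auto
  then have eq: "AE x in lborel. indicator S x *\<^sub>R f x = g x"
  proof eventually_elim
    case (elim x)
    have "indicator S x *\<^sub>R f x = indicator S x *\<^sub>R (\<Sum>b\<in>Basis. ((indicator S x *\<^sub>R f x) \<bullet> b) *\<^sub>R b)"
      by (simp only: euclidean_representation) (simp add: indicator_def)
    also have "\<dots> = g x"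
      using elim by (simp add: g_def)
    finally show ?case .
  qed
  have "integrable lebesgue g"
    by (rule integrable_cong_AE_imp[OF F])
      (use eq in \<open>auto simp: AE_completion intro!: measurable_completion\<close>)
  then have "integrable lborel g"
    by (subst (asm) integrable_completion) auto
  moreover have "AE x in lborel. x \<in> S \<longrightarrow> f x = g x"
    using eq by eventually_elim auto
  ultimately show ?thesis
    using that[of g] by (simp add: g_def)
qed

lemma integral_lebesgue_on_eq_lborel:
  fixes f g :: "'a::euclidean_space \<Rightarrow> 'b::euclidean_space"
  assumes S: "S \<in> sets borel" and g: "g \<in> borel_measurable borel"
    and eq: "AE x in lborel. x \<in> S \<longrightarrow> f x = g x" and off: "\<And>x. x \<notin> S \<Longrightarrow> g x = 0"
  shows "(LINT x|lebesgue_on S. f x) = (LINT x|lborel. g x)"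
proof -
  have SL: "S \<in> sets lebesgue" using S by simp
  have gL: "g \<in> borel_measurable lebesgue"
    using g by (intro measurable_completion) simp
  have eqL: "AE x in lebesgue. g x = indicator S x *\<^sub>R f x"
    using eq by (intro AE_completion) (auto simp: indicator_def off elim!: eventually_mono)
  have fL: "(\<lambda>x. indicator S x *\<^sub>R f x) \<in> borel_measurable lebesgue"
    by (rule borel_measurable_AE[OF gL eqL])
  have "(LINT x|lebesgue_on S. f x) = (LINT x|lebesgue. indicator S x *\<^sub>R f x)"
    using SL by (subst integral_restrict_space) auto
  also have "\<dots> = (LINT x|lebesgue. g x)"
    using eqL by (intro integral_cong_AE fL gL) auto
  also have "\<dots> = (LINT x|lborel. g x)"
    using g by (intro integral_completion) simp
  finally show ?thesis .
qed

lemma nn_integral_lebesgue_on_eq_lborel: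
  fixes f g :: "'a::euclidean_space \<Rightarrow> ennreal"
  assumes S: "S \<in> sets borel" and eq: "AE x in lborel. x \<in> S \<longrightarrow> f x = g x"
  shows "(\<integral>\<^sup>+x. f x \<partial>lebesgue_on S) = (\<integral>\<^sup>+x. g x * indicator S x \<partial>lborel)"
proof -
  have "(\<integral>\<^sup>+x. f x \<partial>lebesgue_on S) = (\<integral>\<^sup>+x. f x * indicator S x \<partial>lborel)"
    using S by (subst nn_integral_restrict_space) (auto simp: nn_integral_completion)
  also have "\<dots> = (\<integral>\<^sup>+x. g x * indicator S x \<partial>lborel)"
    using eq by (intro nn_integral_cong_AE) (auto simp: indicator_def elim!: eventually_mono)
  finally show ?thesis .
qed

text \<open>
The property itself need not be measurable, so the order of the variables is exchanged for a measurable null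
set that contains the exceptional set.
\<close>

lemma AE_lborel_slices:
  assumes "AE z in lborel. P (z :: 'a::euclidean_space \<times> 'b::euclidean_space)"
  shows "AE t in lborel. AE x in lborel. P (x, t)"
proof -
  obtain Z where Z: "Z \<in> null_sets lborel" "{z. \<not> P z} \<subseteq> Z"
    using assms by (auto simp: eventually_ae_filter)
  have [measurable]: "Z \<in> sets borel" using Z by auto
  have ZP: "Z \<in> sets (lborel \<Otimes>\<^sub>M lborel)" unfolding lborel_prod by simp
  have "AE z in lborel \<Otimes>\<^sub>M lborel. z \<notin> Z"
    using AE_not_in[OF Z(1)] unfolding lborel_prod .
  then have "AE x in lborel. AE t in lborel. (x, t) \<notin> Z"
    by (rule lborel_pair.AE_pair)
  then have "AE t in lborel. AE x in lborel. (x, t) \<notin> Z"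
  proof (subst lborel_pair.AE_commute[symmetric])
    have "{z \<in> space (lborel \<Otimes>\<^sub>M lborel). (fst z, snd z) \<notin> Z} = space (lborel \<Otimes>\<^sub>M lborel) - Z"
      by auto
    then show "{z \<in> space (lborel \<Otimes>\<^sub>M lborel). (fst z, snd z) \<notin> Z} \<in> sets (lborel \<Otimes>\<^sub>M lborel)"
      using ZP by (metis sets.compl_sets)
  qed
  then show ?thesis
  proof eventually_elim
    case (elim t)
    then show ?case by eventually_elim (use Z(2) in auto)
  qed
qed

text \<open>
If \<open>v\<close> takes finitely many values, \<open>A(z, v(z))\<close> is pieced together from the measurable functions
\<open>A(\<cdot>, \<xi>)\<close>. A general \<open>v\<close> is a pointwise limit of such functions with values in \<open>vecs N\<close>, where \<open>A(z, \<cdot>)\<close>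
is continuous for almost every \<open>z\<close>.
\<close>

lemma caratheodory_composition_measurable:
  fixes A :: "'a::euclidean_space \<Rightarrow> (nat \<Rightarrow> real^'n) \<Rightarrow> nat \<Rightarrow> real^'n"
  assumes D: "D \<in> sets lebesgue" and A: "caratheodory_field N D A"
    and v: "v \<in> D \<rightarrow> vecs N" "vmeasurable N (lebesgue_on D) v"
  shows "vmeasurable N (lebesgue_on D) (\<lambda>z. A z (v z))"
  unfolding vmeasurable_def
proof (intro allI impI)
  fix j assume j: "j < N"
  let ?M = "lebesgue_on D"
  have spM: "space ?M = D" by simp
  have "\<exists>F. (\<forall>k. simple_function ?M (F k)) \<and> (\<forall>z\<in>space ?M. (\<lambda>k. F k z) \<longlonglongrightarrow> v z i)" if "i < N" for i
  proof -
    have "(\<lambda>z. v z i) \<in> borel_measurable ?M"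
      using v(2) that by (simp add: vmeasurable_def)
    from borel_measurable_implies_sequence_metric[OF this] show ?thesis
      by metis
  qed
  then obtain F where F: "\<And>i k. i < N \<Longrightarrow> simple_function ?M (F i k)"
    "\<And>i z. i < N \<Longrightarrow> z \<in> D \<Longrightarrow> (\<lambda>k. F i k z) \<longlonglongrightarrow> v z i"
    unfolding spM by metis
  define w where "w k z = (\<lambda>i. if i < N then F i k z else 0)" for k z
  have w_vecs: "w k z \<in> vecs N" for k z by (simp add: w_def vecs_def)
  have w_lim: "(\<lambda>k. w k z) \<longlonglongrightarrow> v z" if z: "z \<in> D" for z
  proof -
    have "(\<lambda>k. w k z i) \<longlonglongrightarrow> v z i" for i
      using F(2)[of i z] v(1) z by (cases "i < N") (auto simp: w_def vecs_def Pi_def)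
    then have "limitin (product_topology (\<lambda>i. euclidean) UNIV) (\<lambda>k. w k z) (v z) sequentially"
      by (simp add: limitin_componentwise)
    then show ?thesis
      by (simp add: euclidean_product_topology)
  qed
  have meas: "(\<lambda>z. A z (w k z) j) \<in> borel_measurable ?M" for k
  proof (rule measurable_compose_countable'[where f="\<lambda>\<xi> z. A z \<xi> j" and g="w k" and I="w k ` D"])
    show "(\<lambda>z. A z \<xi> j) \<in> borel_measurable ?M" if "\<xi> \<in> w k ` D" for \<xi>
      using A j that w_vecs by (auto simp: caratheodory_field_def vmeasurable_def)
    have fin: "finite (w k ` D)"
    proof (rule finite_subset)
      show "w k ` D \<subseteq> (\<lambda>p i. if i < N then p i else 0) ` (PiE {..<N} (\<lambda>i. F i k ` D))"
      proof
        fix \<xi> assume "\<xi> \<in> w k ` D"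
        then obtain z where z: "z \<in> D" "\<xi> = w k z" by auto
        have "\<xi> = (\<lambda>i. if i < N then (restrict (\<lambda>i. F i k z) {..<N}) i else 0)"
          by (auto simp: z w_def)
        moreover have "restrict (\<lambda>i. F i k z) {..<N} \<in> PiE {..<N} (\<lambda>i. F i k ` D)"
          using z by auto
        ultimately show "\<xi> \<in> (\<lambda>p i. if i < N then p i else 0) ` (PiE {..<N} (\<lambda>i. F i k ` D))"
          by (rule image_eqI)
      qed
      have "finite (F i k ` D)" if "i < N" for i
        using simple_functionD(1)[OF F(1)[OF that, of k]] by simp
      then have "finite (PiE {..<N} (\<lambda>i. F i k ` D))"
        by (intro finite_PiE) auto
      then show "finite ((\<lambda>p i. if i < N then p i else 0) ` (PiE {..<N} (\<lambda>i. F i k ` D)))"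
        by (rule finite_imageI)
    qed
    then show "countable (w k ` D)" by (rule countable_finite)
    show "w k \<in> ?M \<rightarrow>\<^sub>M count_space (w k ` D)"
    proof (subst measurable_count_space_eq2[OF fin], intro conjI ballI)
      fix \<xi> assume "\<xi> \<in> w k ` D"
      then have "\<xi> \<in> vecs N" using w_vecs by auto
      then have "w k -` {\<xi>} \<inter> space ?M = {z \<in> space ?M. \<forall>i\<in>{..<N}. z \<in> F i k -` {\<xi> i} \<inter> space ?M}"
        by (auto simp: w_def vecs_def fun_eq_iff)
      also have "\<dots> \<in> sets ?M"
      proof (rule sets.sets_Collect_finite_All)
        fix i assume "i \<in> {..<N}"
        then have "F i k -` {\<xi> i} \<inter> space ?M \<in> sets ?M"
          using simple_functionD(2)[OF F(1)] by blast
        moreover have "{z \<in> space ?M. z \<in> F i k -` {\<xi> i} \<inter> space ?M} = F i k -` {\<xi> i} \<inter> space ?M"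
          by blast
        ultimately show "{z \<in> space ?M. z \<in> F i k -` {\<xi> i} \<inter> space ?M} \<in> sets ?M"
          by simp
      qed simp
      finally show "w k -` {\<xi>} \<inter> space ?M \<in> sets ?M" .
    qed auto
  qed
  have "AE z in ?M. continuous_on (vecs N) (A z)"
    using A by (simp add: caratheodory_field_def)
  then obtain Z where Z: "Z \<in> null_sets ?M" "{z \<in> space ?M. \<not> continuous_on (vecs N) (A z)} \<subseteq> Z"
    by (auto simp: eventually_ae_filter)
  have [measurable]: "Z \<in> sets ?M" using Z by auto
  note [measurable] = meas
  have lim: "(\<lambda>z. if z \<in> Z then 0 else A z (v z) j) \<in> borel_measurable ?M"
  proof (rule borel_measurable_LIMSEQ_metric[where f="\<lambda>k z. if z \<in> Z then 0 else A z (w k z) j"])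
    show "(\<lambda>z. if z \<in> Z then 0 else A z (w k z) j) \<in> borel_measurable ?M" for k
      by measurable
    fix z assume z: "z \<in> space ?M"
    show "(\<lambda>k. if z \<in> Z then 0 else A z (w k z) j) \<longlonglongrightarrow> (if z \<in> Z then 0 else A z (v z) j)"
    proof (cases "z \<in> Z")
      case False
      then have "continuous_on (vecs N) (A z)" using Z(2) z by auto
      then have "continuous_on (vecs N) (\<lambda>\<xi>. A z \<xi> j)"
        by (rule continuous_on_product_then_coordinatewise)
      moreover have "(\<lambda>k. w k z) \<longlonglongrightarrow> v z" "v z \<in> vecs N"
        using w_lim[of z] z v(1) by auto
      ultimately have "(\<lambda>k. A z (w k z) j) \<longlonglongrightarrow> A z (v z) j"
        by (rule continuous_on_tendsto_compose) (simp add: w_vecs)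
      then show ?thesis using False by simp
    qed simp
  qed
  show "(\<lambda>z. A z (v z) j) \<in> borel_measurable ?M"
    using AE_not_in[OF Z(1)] by (intro AE_eq_measurable_lebesgue_on[OF D lim]) (auto elim!: eventually_mono)
qed

section \<open>Oscillation around the mean\<close>

text \<open>
By Jensen's inequality the distance from \<open>a\<close> to the mean is controlled by the oscillation about \<open>a\<close>,
so the mean is an optimal constant up to the factor \<open>2\<^sup>q\<^sup>+\<^sup>1\<close>.
\<close>

lemma (in finite_measure) oscillation_about_mean_le:
  fixes f :: "nat \<Rightarrow> 'a \<Rightarrow> real"
  assumes q: "1 \<le> q" and pos: "0 < measure M (space M)"
    and f: "\<And>i. i < N \<Longrightarrow> integrable M (f i)"
  shows "(\<integral>\<^sup>+x. ennreal (vnorm N (\<lambda>i. f i x - (LINT y|M. f i y) / measure M (space M)) powr q) \<partial>M)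
    \<le> ennreal (2 powr (q + 1)) * (\<integral>\<^sup>+x. ennreal (vnorm N (\<lambda>i. f i x - a i) powr q) \<partial>M)"
proof -
  let ?\<mu> = "measure M (space M)"
  let ?X = "\<integral>\<^sup>+x. ennreal (vnorm N (\<lambda>i. f i x - a i) powr q) \<partial>M"
  define b where "b i = (LINT y|M. f i y) / ?\<mu>" for i
  have fa: "integrable M (\<lambda>x. f i x - a i)" if "i < N" for i
    using f[OF that] by simp
  have [measurable]: "(\<lambda>x. vnorm N (\<lambda>i. f i x - a i)) \<in> borel_measurable M"
    using borel_measurable_integrable[OF integrable_vnorm[OF fa]] by simp
  have "b i - a i = 1 / ?\<mu> * (LINT x|M. f i x - a i)" if "i < N" for i
    using f[OF that] pos by (simp add: b_def field_simps)
  then have "vnorm N (\<lambda>i. a i - b i) = vnorm N (\<lambda>i. 1 / ?\<mu> * (LINT x|M. f i x - a i))"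
    by (subst vnorm_diff_commute) (auto intro: vnorm_cong)
  also have "\<dots> \<le> 1 / ?\<mu> * (LINT x|M. vnorm N (\<lambda>i. f i x - a i))"
    unfolding vnorm_mult using pos vnorm_integral_le[of N M "\<lambda>i x. f i x - a i"] fa
    by (auto intro!: divide_right_mono)
  finally have "ennreal (vnorm N (\<lambda>i. a i - b i) powr q) \<le> ennreal ((1 / ?\<mu> * (LINT x|M. vnorm N (\<lambda>i. f i x - a i))) powr q)"
    using q by (intro ennreal_leI powr_mono2) (auto simp: vnorm_nonneg)
  also have "\<dots> = ennreal (1 / ?\<mu> powr q) * ennreal ((LINT x|M. vnorm N (\<lambda>i. f i x - a i)) powr q)"
    using pos by (simp add: powr_divide powr_mult vnorm_nonneg ennreal_mult[symmetric])
  also have "\<dots> \<le> ennreal (1 / ?\<mu> powr q) * (ennreal (?\<mu> powr (q - 1)) * ?X)"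
    by (intro mult_left_mono jensen_powr q integrable_vnorm fa vnorm_nonneg) auto
  also have "\<dots> = ennreal (1 / ?\<mu>) * ?X"
    using pos by (simp add: mult.assoc[symmetric] ennreal_mult[symmetric] powr_diff)
  finally have ab: "ennreal (vnorm N (\<lambda>i. a i - b i) powr q) \<le> ennreal (1 / ?\<mu>) * ?X" .
  have "(\<integral>\<^sup>+x. ennreal (vnorm N (\<lambda>i. f i x - b i) powr q) \<partial>M)
      \<le> (\<integral>\<^sup>+x. ennreal (2 powr q) * (ennreal (vnorm N (\<lambda>i. f i x - a i) powr q) + ennreal (vnorm N (\<lambda>i. a i - b i) powr q)) \<partial>M)"
  proof (rule nn_integral_mono)
    fix x
    have "vnorm N (\<lambda>i. f i x - b i) powr q \<le> (vnorm N (\<lambda>i. f i x - a i) + vnorm N (\<lambda>i. a i - b i)) powr q"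
      using q by (intro powr_mono2 vnorm_diff_triangle) (auto simp: vnorm_nonneg)
    also have "\<dots> \<le> 2 powr q * (vnorm N (\<lambda>i. f i x - a i) powr q + vnorm N (\<lambda>i. a i - b i) powr q)"
      by (intro powr_add_le q vnorm_nonneg)
    finally show "ennreal (vnorm N (\<lambda>i. f i x - b i) powr q) \<le>
        ennreal (2 powr q) * (ennreal (vnorm N (\<lambda>i. f i x - a i) powr q) + ennreal (vnorm N (\<lambda>i. a i - b i) powr q))"
      by (simp add: ennreal_mult[symmetric] ennreal_plus[symmetric] ennreal_leI del: ennreal_plus)
  qed
  also have "\<dots> = ennreal (2 powr q) * (?X + ennreal (vnorm N (\<lambda>i. a i - b i) powr q) * emeasure M (space M))"
    by (subst nn_integral_cmult, measurable, subst nn_integral_add) auto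
  also have "\<dots> \<le> ennreal (2 powr q) * (?X + ennreal (1 / ?\<mu>) * ?X * emeasure M (space M))"
    by (intro mult_left_mono add_left_mono mult_right_mono ab) auto
  also have "ennreal (1 / ?\<mu>) * ?X * emeasure M (space M) = ?X"
  proof -
    have "ennreal (1 / ?\<mu>) * ennreal ?\<mu> = 1"
      using pos by (simp add: ennreal_mult[symmetric])
    moreover have "c * x * d = x" if "c * d = 1" for c d x :: ennreal
    proof -
      have "c * x * d = (c * d) * x" by (simp only: mult_ac)
      then show ?thesis using that by simp
    qed
    ultimately show ?thesis
      by (simp only: emeasure_eq_measure)
  qed
  also have "ennreal (2 powr q) * (?X + ?X) = ennreal (2 powr (q + 1)) * ?X"
  proof -
    have "ennreal (2 powr (q + 1)) = ennreal (2 powr q) * 2"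
      by (simp add: powr_add ennreal_mult)
    then show ?thesis by (simp add: mult.assoc mult_2)
  qed
  finally show ?thesis by (simp add: b_def)
qed

section \<open>Reduction of the weak formulation to Borel functions\<close>

lemma (in finite_measure) integrable_if_powr_vnorm_integrable:
  fixes w :: "'a \<Rightarrow> nat \<Rightarrow> 'b::euclidean_space"
  assumes q: "1 \<le> q" and m: "\<And>i. i < N \<Longrightarrow> (\<lambda>z. w z i) \<in> borel_measurable M"
    and p: "integrable M (\<lambda>z. vnorm N (w z) powr q)"
  shows "i < N \<Longrightarrow> integrable M (\<lambda>z. w z i)" and "integrable M (\<lambda>z. vnorm N (w z))"
proof -
  have le: "x \<le> 1 + x powr q" if "0 \<le> x" for x
  proof (cases "x \<le> 1")
    case False
    then show ?thesis using powr_mono[of 1 q x] q by simp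
  qed (simp add: add_increasing2)
  have i1: "integrable M (\<lambda>z. 1 + vnorm N (w z) powr q)"
    using p by simp
  show v: "integrable M (\<lambda>z. vnorm N (w z))"
  proof (rule Bochner_Integration.integrable_bound[OF i1 vnorm_measurable])
    show "AE z in M. norm (vnorm N (w z)) \<le> norm (1 + vnorm N (w z) powr q)"
      using le[OF vnorm_nonneg] by (auto simp: vnorm_nonneg intro!: AE_I2)
  qed (rule m)
  show "integrable M (\<lambda>z. w z i)" if "i < N"
  proof (rule Bochner_Integration.integrable_bound[OF v m[OF that]])
    show "AE z in M. norm (w z i) \<le> norm (vnorm N (w z))"
      using norm_le_vnorm[OF that, of "w _"] by (auto simp: vnorm_nonneg intro!: AE_I2)
  qed
qed

lemma borel_representatives:
  fixes f :: "'a::euclidean_space \<Rightarrow> nat \<Rightarrow> 'b::euclidean_space"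
  assumes S: "S \<in> sets borel" and f: "\<And>i. i < N \<Longrightarrow> integrable (lebesgue_on S) (\<lambda>z. f z i)"
  obtains g where "\<And>i. i < N \<Longrightarrow> integrable lborel (g i)"
    "AE z in lborel. z \<in> S \<longrightarrow> (\<forall>i<N. f z i = g i z)" "\<And>i z. i < N \<Longrightarrow> z \<notin> S \<Longrightarrow> g i z = 0"
proof -
  have "\<exists>g. i < N \<longrightarrow> integrable lborel g \<and> (AE z in lborel. z \<in> S \<longrightarrow> f z i = g z) \<and> (\<forall>z. z \<notin> S \<longrightarrow> g z = 0)" for i
    using borel_representative[OF S f] by metis
  then obtain g where g: "\<And>i. i < N \<Longrightarrow> integrable lborel (g i)"
    "\<And>i. i < N \<Longrightarrow> AE z in lborel. z \<in> S \<longrightarrow> f z i = g i z" "\<And>i z. i < N \<Longrightarrow> z \<notin> S \<Longrightarrow> g i z = 0"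
    by metis
  have "AE z in lborel. \<forall>i<N. z \<in> S \<longrightarrow> f z i = g i z"
    using g(2) by (subst AE_all_countable) (auto intro!: AE_impI)
  then have "AE z in lborel. z \<in> S \<longrightarrow> (\<forall>i<N. f z i = g i z)"
    by eventually_elim auto
  with g show ?thesis using that by blast
qed

lemma inner_grad:
  fixes \<phi> :: "real^'n \<Rightarrow> real"
  assumes "\<phi> \<in> test_functions U"
  shows "w \<bullet> grad \<phi> x = frechet_derivative \<phi> (at x) w"
proof -
  have l: "linear (frechet_derivative \<phi> (at x))"
    using has_derivative_linear[OF test_functionsD(2)[OF assms]] .
  have "frechet_derivative \<phi> (at x) w = frechet_derivative \<phi> (at x) (\<Sum>j\<in>UNIV. (w $ j) *\<^sub>R axis j 1)"
    using basis_expansion[of w] by (simp add: scalar_mult_eq_scaleR)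
  also have "\<dots> = (\<Sum>j\<in>UNIV. (w $ j) * frechet_derivative \<phi> (at x) (axis j 1))"
    using l by (simp add: linear_sum linear_cmul)
  also have "\<dots> = w \<bullet> grad \<phi> x"
    by (simp add: inner_vec_def grad_def)
  finally show ?thesis by simp
qed

lemma grad_eq_sum:
  fixes \<phi> :: "real^'n \<Rightarrow> real"
  assumes "\<phi> \<in> test_functions U"
  shows "grad \<phi> x = (\<Sum>b\<in>Basis. frechet_derivative \<phi> (at x) b *\<^sub>R b)"
  using euclidean_representation[of "grad \<phi> x"] inner_grad[OF assms]
  by (simp add: inner_commute)

lemma integrable_scaleR_grad:
  fixes \<phi> :: "real^'n \<Rightarrow> real"
  assumes "\<phi> \<in> test_functions U" "integrable lborel f"
  shows "integrable lborel (\<lambda>x. f x *\<^sub>R grad \<phi> x)"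
  unfolding grad_eq_sum[OF assms(1)] scaleR_sum_right scaleR_scaleR
  by (intro Bochner_Integration.integrable_sum integrable_scaleR_left
      integrable_mult_test_function[OF assms(2) test_functions_derivative[OF assms(1)]])

lemma integrable_test_function_scaleR:
  fixes f :: "'a::euclidean_space \<Rightarrow> 'b::euclidean_space"
  assumes "\<phi> \<in> test_functions U" "integrable lborel f"
  shows "integrable lborel (\<lambda>x. \<phi> x *\<^sub>R f x)"
proof -
  have "integrable lborel (\<lambda>x. \<Sum>b\<in>Basis. ((f x \<bullet> b) * \<phi> x) *\<^sub>R b)"
    by (intro Bochner_Integration.integrable_sum integrable_scaleR_left
        integrable_mult_test_function[OF integrable_inner_left[OF assms(2)] assms(1)])
  moreover have "(\<Sum>b\<in>Basis. ((f x \<bullet> b) * \<phi> x) *\<^sub>R b) = \<phi> x *\<^sub>R f x" for x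
  proof -
    have "\<phi> x *\<^sub>R f x = \<phi> x *\<^sub>R (\<Sum>b\<in>Basis. (f x \<bullet> b) *\<^sub>R b)"
      by (simp only: euclidean_representation)
    then show ?thesis by (simp add: scaleR_sum_right mult.commute)
  qed
  ultimately show ?thesis by simp
qed

text \<open>
The test function and the Borel representatives vanish outside \<open>B\<close>, so the integrals
extend to the whole space. Pairing the vector identity with \<open>v\<close> gives the weak derivative in
the direction \<open>v\<close>.
\<close>

lemma weak_gradient_borel:
  fixes f :: "real^'n \<Rightarrow> real" and g :: "real^'n \<Rightarrow> real^'n"
  assumes wg: "has_weak_gradient_on f g B" and B: "B \<in> sets borel"
    and f': "integrable lborel f'" "AE x in lborel. x \<in> B \<longrightarrow> f x = f' x" "\<And>x. x \<notin> B \<Longrightarrow> f' x = 0"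
    and g': "integrable lborel g'" "AE x in lborel. x \<in> B \<longrightarrow> g x = g' x" "\<And>x. x \<notin> B \<Longrightarrow> g' x = 0"
    and \<phi>: "\<phi> \<in> test_functions B"
  shows "(LINT x|lborel. f' x * frechet_derivative \<phi> (at x) v) = - (LINT x|lborel. (g' x \<bullet> v) * \<phi> x)"
proof -
  note i1 = integrable_scaleR_grad[OF \<phi> f'(1)] and i2 = integrable_test_function_scaleR[OF \<phi> g'(1)]
  have "(LINT x|lebesgue_on B. f x *\<^sub>R grad \<phi> x) = (LINT x|lborel. f' x *\<^sub>R grad \<phi> x)"
    using f'(2,3) borel_measurable_integrable[OF i1]
    by (intro integral_lebesgue_on_eq_lborel[OF B]) (auto elim!: eventually_mono)
  moreover have "(LINT x|lebesgue_on B. \<phi> x *\<^sub>R g x) = (LINT x|lborel. \<phi> x *\<^sub>R g' x)"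
    using g'(2,3) borel_measurable_integrable[OF i2]
    by (intro integral_lebesgue_on_eq_lborel[OF B]) (auto elim!: eventually_mono)
  ultimately have eq: "(LINT x|lborel. f' x *\<^sub>R grad \<phi> x) = - (LINT x|lborel. \<phi> x *\<^sub>R g' x)"
    using wg \<phi> by (simp add: has_weak_gradient_on_def)
  have "(LINT x|lborel. f' x * frechet_derivative \<phi> (at x) v) = (LINT x|lborel. (f' x *\<^sub>R grad \<phi> x) \<bullet> v)"
    using inner_grad[OF \<phi>, of v] by (simp add: inner_commute)
  also have "\<dots> = (LINT x|lborel. f' x *\<^sub>R grad \<phi> x) \<bullet> v"
    using i1 by (intro integral_inner_left)
  also have "\<dots> = - ((LINT x|lborel. \<phi> x *\<^sub>R g' x) \<bullet> v)"
    by (simp add: eq)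
  also have "(LINT x|lborel. \<phi> x *\<^sub>R g' x) \<bullet> v = (LINT x|lborel. (\<phi> x *\<^sub>R g' x) \<bullet> v)"
    using i2 by (intro integral_inner_left[symmetric])
  finally show ?thesis by (simp add: mult.commute)
qed

text \<open>
A test function that equals \<open>\<eta>(x) \<theta>(t)\<close> in component \<open>i\<close> and vanishes in the others isolates the \<open>i\<close>-th
equation of the system.
\<close>

lemma weak_solution_product_test:
  fixes u :: "(real^'n) \<times> real \<Rightarrow> nat \<Rightarrow> real"
  assumes ws: "weak_solution N D A F u Du" and i: "i < N" and BI: "B \<times> I \<subseteq> D"
    and \<eta>: "\<eta> \<in> test_functions B" and \<theta>: "\<theta> \<in> test_functions I"
  shows "(LINT z|lebesgue_on D. - (u z i * (\<eta> (fst z) * frechet_derivative \<theta> (at (snd z)) 1)) +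
        frechet_derivative \<eta> (at (fst z)) (A z (Du z) i) * \<theta> (snd z)) =
      (LINT z|lebesgue_on D. frechet_derivative \<eta> (at (fst z)) (F z i) * \<theta> (snd z))"
proof -
  define \<phi> where "\<phi> z k = (if k = i then \<eta> (fst z) * \<theta> (snd z) else 0)" for z k
  have "\<phi> \<in> vec_test_functions N D"
    unfolding vec_test_functions_def
  proof (intro CollectI conjI allI impI)
    show "\<phi> z \<in> vecs N" for z
      using i by (auto simp: vecs_def \<phi>_def)
    fix k assume "k < N"
    show "(\<lambda>z. \<phi> z k) \<in> test_functions D"
    proof (cases "k = i")
      case True
      then show ?thesis
        using test_functions_mono[OF BI test_functions_times[OF \<eta> \<theta>]] by (simp add: \<phi>_def)
    next
      case False
      then show ?thesis
        by (auto simp: \<phi>_def intro!: test_functionsI[where K="{}"] C_k_const)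
    qed
  qed
  then have eq: "(LINT z|lebesgue_on D. - vinner N (u z) (time_deriv \<phi> z) + vinner N (A z (Du z)) (space_grad \<phi> z)) =
      (LINT z|lebesgue_on D. vinner N (F z) (space_grad \<phi> z))"
    using ws by (simp add: weak_solution_def)
  have \<theta>': "(\<theta> has_real_derivative frechet_derivative \<theta> (at t) 1) (at t)" for t
  proof -
    have lin: "frechet_derivative \<theta> (at t) h = h * frechet_derivative \<theta> (at t) 1" for h
      using linear_cmul[OF has_derivative_linear[OF test_functionsD(2)[OF \<theta>]], of t h 1] by simp
    have "frechet_derivative \<theta> (at t) = (*) (frechet_derivative \<theta> (at t) 1)"
      by (rule ext, subst lin, rule mult.commute)
    then show ?thesis
      using test_functionsD(2)[OF \<theta>, of t] by (simp only: has_field_derivative_def)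
  qed
  have td: "time_deriv \<phi> z k = (if k = i then \<eta> (fst z) * frechet_derivative \<theta> (at (snd z)) 1 else 0)" for z k
  proof -
    have "((\<lambda>t. \<eta> (fst z) * \<theta> t) has_real_derivative \<eta> (fst z) * frechet_derivative \<theta> (at (snd z)) 1) (at (snd z))"
      by (rule DERIV_cmult[OF \<theta>'])
    then show ?thesis
      by (auto simp: time_deriv_def \<phi>_def intro!: DERIV_imp_deriv)
  qed
  have sg: "space_grad \<phi> z k = (if k = i then \<theta> (snd z) *\<^sub>R grad \<eta> (fst z) else 0)" for z k
  proof (cases "k = i")
    case True
    have "((\<lambda>x. \<eta> x * \<theta> (snd z)) has_derivative (\<lambda>v. frechet_derivative \<eta> (at (fst z)) v * \<theta> (snd z))) (at (fst z))"
      by (rule has_derivative_mult_left[OF test_functionsD(2)[OF \<eta>]])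
    then have "frechet_derivative (\<lambda>x. \<eta> x * \<theta> (snd z)) (at (fst z)) = (\<lambda>v. frechet_derivative \<eta> (at (fst z)) v * \<theta> (snd z))"
      by (rule frechet_derivative_at[symmetric])
    then show ?thesis
      using True by (simp add: space_grad_def grad_def \<phi>_def vec_eq_iff mult.commute)
  next
    case False
    then show ?thesis by (simp add: space_grad_def grad_def \<phi>_def vec_eq_iff frechet_derivative_const)
  qed
  have vi: "vinner N a (\<lambda>k. if k = i then c else 0) = a i \<bullet> c" for a :: "nat \<Rightarrow> 'd::real_inner" and c
  proof -
    have "vinner N a (\<lambda>k. if k = i then c else 0) = (\<Sum>k<N. if k = i then a i \<bullet> c else 0)"
      unfolding vinner_def by (intro sum.cong) auto
    then show ?thesis using i by simp
  qed
  have td': "time_deriv \<phi> z = (\<lambda>k. if k = i then \<eta> (fst z) * frechet_derivative \<theta> (at (snd z)) 1 else 0)" for z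
    by (rule ext) (rule td)
  have sg': "space_grad \<phi> z = (\<lambda>k. if k = i then \<theta> (snd z) *\<^sub>R grad \<eta> (fst z) else 0)" for z
    by (rule ext) (rule sg)
  show ?thesis
    using eq unfolding td' sg' vi inner_scaleR_right inner_grad[OF \<eta>] by (simp add: mult.commute)
qed

text \<open>
Only values on \<open>B \<times> I\<close> enter, since \<open>\<eta>(x) \<theta>(t)\<close> and its derivatives vanish elsewhere; there the data may be
replaced by Borel representatives. These are integrable, so the flux and \<open>F\<close> can be
collected in one term.
\<close>

lemma weak_solution_borel:
  fixes u :: "(real^'n) \<times> real \<Rightarrow> nat \<Rightarrow> real"
  assumes ws: "weak_solution N D A F u Du" and i: "i < N"
    and D: "D \<in> sets borel" and BI: "B \<times> I \<subseteq> D"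
    and u': "integrable lborel u'" "AE z in lborel. z \<in> B \<times> I \<longrightarrow> u z i = u' z" "\<And>z. z \<notin> B \<times> I \<Longrightarrow> u' z = 0"
    and A': "integrable lborel A'" "AE z in lborel. z \<in> B \<times> I \<longrightarrow> A z (Du z) i = A' z" "\<And>z. z \<notin> B \<times> I \<Longrightarrow> A' z = 0"
    and F': "integrable lborel F'" "AE z in lborel. z \<in> B \<times> I \<longrightarrow> F z i = F' z" "\<And>z. z \<notin> B \<times> I \<Longrightarrow> F' z = 0"
    and \<eta>: "\<eta> \<in> test_functions B" and \<theta>: "\<theta> \<in> test_functions I"
  shows "(LINT z|lborel. u' z * (\<eta> (fst z) * frechet_derivative \<theta> (at (snd z)) 1))
      = (LINT z|lborel. frechet_derivative \<eta> (at (fst z)) (A' z - F' z) * \<theta> (snd z))"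
proof -
  let ?d = "\<lambda>z. frechet_derivative \<eta> (at (fst z))" and ?\<theta>' = "\<lambda>t. frechet_derivative \<theta> (at t) 1"
  note \<theta>' = test_functions_derivative[OF \<theta>, of 1]
  have lin: "linear (frechet_derivative \<eta> (at x))" for x
    using has_derivative_linear[OF test_functionsD(2)[OF \<eta>]] .
  have off1: "\<eta> (fst z) * ?\<theta>' (snd z) = 0" if "z \<notin> B \<times> I" for z
    using that test_functionsD(4)[OF \<eta>, of "fst z"] test_functionsD(4)[OF \<theta>', of "snd z"]
    by (auto simp: mem_Times_iff)
  have off2: "?d z w * \<theta> (snd z) = 0" if "z \<notin> B \<times> I" for z w
    using that test_functionsD(4)[OF test_functions_derivative[OF \<eta>], of "fst z"] test_functionsD(4)[OF \<theta>, of "snd z"]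
    by (auto simp: mem_Times_iff)
  have iu: "integrable lborel (\<lambda>z. u' z * (\<eta> (fst z) * ?\<theta>' (snd z)))"
    by (rule integrable_mult_test_function[OF u'(1) test_functions_times[OF \<eta> \<theta>']])
  have ih: "integrable lborel (\<lambda>z. ?d z (h z) * \<theta> (snd z))" if h: "integrable lborel h" for h
  proof -
    have "snd \<in> borel_measurable (borel :: ((real^'n) \<times> real) measure)"
      by (intro borel_measurable_continuous_onI continuous_intros)
    from measurable_compose[OF this test_functions_measurable[OF \<theta>]]
    have \<theta>m: "(\<lambda>z. \<theta> (snd z)) \<in> borel_measurable (lborel :: ((real^'n) \<times> real) measure)"
      by simp
    obtain C where "\<And>x. \<bar>\<theta> x\<bar> \<le> C" using test_functions_bounded[OF \<theta>] by blast
    then show ?thesis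
      by (rule integrable_mult_bounded[OF integrable_frechet_derivative_test_function[OF \<eta> h] \<theta>m])
  qed
  have "(LINT z|lebesgue_on D. - (u z i * (\<eta> (fst z) * ?\<theta>' (snd z))) + ?d z (A z (Du z) i) * \<theta> (snd z))
      = (LINT z|lborel. - (u' z * (\<eta> (fst z) * ?\<theta>' (snd z))) + ?d z (A' z) * \<theta> (snd z))"
  proof (rule integral_lebesgue_on_eq_lborel[OF D])
    show "(\<lambda>z. - (u' z * (\<eta> (fst z) * ?\<theta>' (snd z))) + ?d z (A' z) * \<theta> (snd z)) \<in> borel_measurable borel"
      using borel_measurable_integrable[OF iu] borel_measurable_integrable[OF ih[OF A'(1)]] by simp
    show "AE z in lborel. z \<in> D \<longrightarrow> - (u z i * (\<eta> (fst z) * ?\<theta>' (snd z))) + ?d z (A z (Du z) i) * \<theta> (snd z)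
        = - (u' z * (\<eta> (fst z) * ?\<theta>' (snd z))) + ?d z (A' z) * \<theta> (snd z)"
      using u'(2) A'(2)
    proof eventually_elim
      case (elim z)
      show ?case
      proof (cases "z \<in> B \<times> I")
        case False
        show ?thesis by (simp only: off1[OF False] off2[OF False] mult_zero_right) simp
      qed (use elim in simp)
    qed
    show "- (u' z * (\<eta> (fst z) * ?\<theta>' (snd z))) + ?d z (A' z) * \<theta> (snd z) = 0" if "z \<notin> D" for z
    proof -
      have n: "z \<notin> B \<times> I" using that BI by auto
      show ?thesis by (simp only: off1[OF n] off2[OF n] mult_zero_right minus_zero add_0_left)
    qed
  qed
  also have "\<dots> = - (LINT z|lborel. u' z * (\<eta> (fst z) * ?\<theta>' (snd z))) + (LINT z|lborel. ?d z (A' z) * \<theta> (snd z))"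
    using iu ih[OF A'(1)] by simp
  finally have left: "(LINT z|lebesgue_on D. - (u z i * (\<eta> (fst z) * ?\<theta>' (snd z))) + ?d z (A z (Du z) i) * \<theta> (snd z)) = \<dots>" .
  have right: "(LINT z|lebesgue_on D. ?d z (F z i) * \<theta> (snd z)) = (LINT z|lborel. ?d z (F' z) * \<theta> (snd z))"
  proof (rule integral_lebesgue_on_eq_lborel[OF D])
    show "(\<lambda>z. ?d z (F' z) * \<theta> (snd z)) \<in> borel_measurable borel"
      using borel_measurable_integrable[OF ih[OF F'(1)]] by simp
    show "AE z in lborel. z \<in> D \<longrightarrow> ?d z (F z i) * \<theta> (snd z) = ?d z (F' z) * \<theta> (snd z)"
      using F'(2)
    proof eventually_elim
      case (elim z)
      show ?case
      proof (cases "z \<in> B \<times> I")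
        case False
        show ?thesis by (simp only: off2[OF False] simp_thms)
      qed (use elim in simp)
    qed
    show "?d z (F' z) * \<theta> (snd z) = 0" if "z \<notin> D" for z
      using that BI by (intro off2) auto
  qed
  have "(LINT z|lborel. ?d z (A' z - F' z) * \<theta> (snd z)) =
      (LINT z|lborel. ?d z (A' z) * \<theta> (snd z)) - (LINT z|lborel. ?d z (F' z) * \<theta> (snd z))"
    using ih[OF A'(1)] ih[OF F'(1)] by (simp add: linear_diff[OF lin] left_diff_distrib)
  moreover have "- (LINT z|lborel. u' z * (\<eta> (fst z) * ?\<theta>' (snd z))) + (LINT z|lborel. ?d z (A' z) * \<theta> (snd z))
      = (LINT z|lborel. ?d z (F' z) * \<theta> (snd z))"
    using weak_solution_product_test[OF ws i BI \<eta> \<theta>] left right by simp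
  ultimately show ?thesis by simp
qed

section \<open>The parabolic Poincare inequality\<close>

text \<open>
The first factor is the price of passing to the mean, the second is the constant of
\<open>cylinder_oscillation\<close> without \<open>\<rho>\<^sup>q\<close>, and the third collects \<open>|grad u|\<^sup>q\<close> from the space oscillation and
the two parts of \<open>(L |grad u| + |F|)\<^sup>q\<close> from the time oscillation.
\<close>

definition parabolic_poincare_constant :: "nat \<Rightarrow> real \<Rightarrow> real \<Rightarrow> real"
  where "parabolic_poincare_constant n q L =
    2 powr (q + 1) * (2 powr q * 2 ^ n * (2 / (exp (-16/3) / 4 ^ n)) powr q) *
    (1 + 2 powr q * L powr q + 2 powr q)"

lemma cylinder_measure:
  fixes x0 :: "'a::euclidean_space"
  shows "emeasure lborel (ball x0 \<rho> \<times> {t0 - \<rho>\<^sup>2<..<t0 + \<rho>\<^sup>2}) =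
    ennreal (2 * \<rho>\<^sup>2 * measure lborel (ball x0 \<rho>))"
proof -
  have "emeasure lborel (ball x0 \<rho> \<times> {t0 - \<rho>\<^sup>2<..<t0 + \<rho>\<^sup>2}) =
      emeasure lborel (ball x0 \<rho>) * emeasure lborel {t0 - \<rho>\<^sup>2<..<t0 + \<rho>\<^sup>2}"
    unfolding lborel_prod[symmetric] by (intro lborel.emeasure_pair_measure_Times) auto
  also have "emeasure lborel (ball x0 \<rho>) = ennreal (measure lborel (ball x0 \<rho>))"
    using emeasure_lborel_ball_finite[of x0 \<rho>] by (intro emeasure_eq_ennreal_measure) simp
  also have "emeasure lborel {t0 - \<rho>\<^sup>2<..<t0 + \<rho>\<^sup>2} = ennreal (2 * \<rho>\<^sup>2)"
    by simp
  finally show ?thesis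
    by (simp add: ennreal_mult[symmetric] mult.commute)
qed

text \<open>
The closure of \<open>Q\<close> lies in \<open>\<Omega> \<times> (0,T)\<close>, so the ball and the time interval of \<open>Q\<close> themselves are
admissible in the definition of the local Sobolev space, and \<open>|F|\<close> is integrable over \<open>Q\<close>. Borel
representatives on \<open>Q\<close> then satisfy the hypotheses of \<open>cylinder_oscillation\<close>.
\<close>

lemma parabolic_poincare_cylinder:
  fixes \<Omega> :: "(real^'n) set" and u :: "(real^'n) \<times> real \<Rightarrow> nat \<Rightarrow> real"
  assumes q: "1 \<le> q" and L: "0 < L" and \<Omega>: "open \<Omega>"
    and A: "caratheodory_field N (\<Omega> \<times> {0<..<T}) A"
    and str: "structure_conditions N \<nu> L (\<Omega> \<times> {0<..<T}) A"
    and F: "vmeasurable N (lebesgue_on (\<Omega> \<times> {0<..<T})) F"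
      "locally_integrable_on (\<lambda>z. vnorm N (F z)) (\<Omega> \<times> {0<..<T})"
    and ps: "parabolic_sobolev N q \<Omega> T u Du"
    and ws: "weak_solution N (\<Omega> \<times> {0<..<T}) A F u Du"
    and \<rho>: "0 < \<rho>" and cc: "compactly_contained (cylinder \<rho> x0 t0) (\<Omega> \<times> {0<..<T})"
    and Q: "Q = cylinder \<rho> x0 t0" and c: "c = parabolic_poincare_constant CARD('n) q L"
  shows "avg Q (\<lambda>z. vnorm N (\<lambda>i. u z i - avg Q (\<lambda>w. u w i)) powr q / \<rho> powr q)
    \<le> c * avg Q (\<lambda>z. vnorm N (Du z) powr q) + c * (avg Q (\<lambda>z. vnorm N (F z))) powr q"
proof -
  define B where "B = ball x0 \<rho>"
  define I where "I = {t0 - \<rho>\<^sup>2<..<t0 + \<rho>\<^sup>2}"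
  define D where "D = \<Omega> \<times> {0<..<T}"
  have QBI: "Q = B \<times> I" by (simp add: Q cylinder_def B_def I_def)
  have \<rho>2: "0 < \<rho>\<^sup>2" using \<rho> by simp
  have clQ: "closure Q = cball x0 \<rho> \<times> {t0 - \<rho>\<^sup>2..t0 + \<rho>\<^sup>2}"
    using \<rho> \<rho>2 by (simp add: QBI B_def I_def closure_Times)
  have clD: "cball x0 \<rho> \<times> {t0 - \<rho>\<^sup>2..t0 + \<rho>\<^sup>2} \<subseteq> \<Omega> \<times> {0<..<T}"
    using cc clQ by (simp add: compactly_contained_def Q)
  have "x0 \<in> cball x0 \<rho>" "t0 \<in> {t0 - \<rho>\<^sup>2..t0 + \<rho>\<^sup>2}" using \<rho> by auto
  then have cl\<Omega>: "cball x0 \<rho> \<subseteq> \<Omega>" and "{t0 - \<rho>\<^sup>2..t0 + \<rho>\<^sup>2} \<subseteq> {0<..<T}"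
    using clD by blast+
  then have "t0 - \<rho>\<^sup>2 \<in> {0<..<T}" "t0 + \<rho>\<^sup>2 \<in> {0<..<T}"
    using \<rho>2 by (auto simp: subset_iff)
  then have times: "0 < t0 - \<rho>\<^sup>2" "t0 - \<rho>\<^sup>2 < t0 + \<rho>\<^sup>2" "t0 + \<rho>\<^sup>2 < T" using \<rho>2 by auto
  have QD: "Q \<subseteq> D" using clD clQ closure_subset[of Q] by (auto simp: D_def)
  have Dm: "D \<in> sets borel" unfolding D_def by (intro borel_open open_Times \<Omega>) auto
  have Qm [measurable]: "Q \<in> sets borel" unfolding QBI B_def I_def by (intro borel_open open_Times) auto
  have Bm: "B \<in> sets borel" by (simp add: B_def)
  have DL: "D \<in> sets lebesgue" and QL: "Q \<in> sets lebesgue" using Dm Qm by auto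
  define \<mu> where "\<mu> = 2 * \<rho>\<^sup>2 * measure lborel (ball x0 \<rho>)"
  have \<mu>_pos: "0 < \<mu>" using \<rho> content_ball_pos[of \<rho> x0] by (simp add: \<mu>_def)
  have emQ: "emeasure lborel Q = ennreal \<mu>"
    unfolding QBI B_def I_def \<mu>_def by (rule cylinder_measure)
  have mQ: "measure lebesgue Q = \<mu>"
    using emQ Qm \<mu>_pos by (simp add: measure_def)
  let ?M = "lebesgue_on Q"
  have emM: "emeasure ?M (space ?M) = ennreal \<mu>"
    using emQ Qm QL by (simp add: emeasure_restrict_space)
  interpret M: finite_measure ?M
    by (intro finite_measureI) (simp only: emM, simp)
  have mM: "measure ?M (space ?M) = \<mu>"
    unfolding measure_def emM using \<mu>_pos by simp
  have restr: "f \<in> borel_measurable ?M" if "f \<in> borel_measurable (lebesgue_on D)" for f :: "_ \<Rightarrow> 'b::topological_space"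
    using measurable_restrict_mono[OF that QD] .
  have AE_M: "(AE z in ?M. P z) \<longleftrightarrow> (AE z in lborel. z \<in> Q \<longrightarrow> P z)" for P
    using QL by (simp add: AE_restrict_space_iff AE_completion_iff)

  have um: "(\<lambda>z. u z i) \<in> borel_measurable ?M" and Dum: "(\<lambda>z. Du z i) \<in> borel_measurable ?M"
    and Fm: "(\<lambda>z. F z i) \<in> borel_measurable ?M" if "i < N" for i
    using ps F(1) that by (auto simp: parabolic_sobolev_def vmeasurable_def D_def intro!: restr)
  have "open B \<and> compactly_contained B \<Omega> \<and> 0 < t0 - \<rho>\<^sup>2 \<and> t0 - \<rho>\<^sup>2 < t0 + \<rho>\<^sup>2 \<and> t0 + \<rho>\<^sup>2 < T"
    using times cl\<Omega> \<rho> by (simp add: B_def compactly_contained_def)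
  then have slice0: "AE t in lebesgue_on I. W1q_with_gradient N q B (\<lambda>x. u (x, t)) (\<lambda>x. Du (x, t))"
    and int0: "integrable ?M (\<lambda>z. vnorm N (u z) powr q + vnorm N (Du z) powr q)"
    using ps unfolding parabolic_sobolev_def I_def QBI by blast+
  have powr_int: "integrable ?M (\<lambda>z. vnorm N (w z) powr q)"
    if "\<And>i. i < N \<Longrightarrow> (\<lambda>z. w z i) \<in> borel_measurable ?M"
      and le: "\<And>z. vnorm N (w z) powr q \<le> vnorm N (u z) powr q + vnorm N (Du z) powr q"
    for w :: "_ \<Rightarrow> nat \<Rightarrow> 'b::euclidean_space"
  proof (rule Bochner_Integration.integrable_bound[OF int0])
    have "(\<lambda>z. vnorm N (w z)) \<in> borel_measurable ?M"
      using that(1) by (rule vnorm_measurable)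
    then show "(\<lambda>z. vnorm N (w z) powr q) \<in> borel_measurable ?M" by measurable
    show "AE z in ?M. norm (vnorm N (w z) powr q) \<le> norm (vnorm N (u z) powr q + vnorm N (Du z) powr q)"
      using le by (intro AE_I2) simp
  qed
  have uq: "integrable ?M (\<lambda>z. vnorm N (u z) powr q)" by (rule powr_int[OF um]) auto
  have Duq: "integrable ?M (\<lambda>z. vnorm N (Du z) powr q)" by (rule powr_int[OF Dum]) auto
  have ui: "integrable ?M (\<lambda>z. u z i)" if "i < N" for i
    using M.integrable_if_powr_vnorm_integrable(1)[OF q um uq that] .
  have Dui: "integrable ?M (\<lambda>z. Du z i)" if "i < N" for i
    using M.integrable_if_powr_vnorm_integrable(1)[OF q Dum Duq that] .
  have Duv: "integrable ?M (\<lambda>z. vnorm N (Du z))"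
    using M.integrable_if_powr_vnorm_integrable(2)[OF q Dum Duq] .
  have Fv: "integrable ?M (\<lambda>z. vnorm N (F z))"
  proof -
    have "compact (closure Q)" "closure Q \<subseteq> \<Omega> \<times> {0<..<T}"
      using cc by (auto simp: compactly_contained_def Q)
    then have "(\<lambda>z. vnorm N (F z)) absolutely_integrable_on closure Q"
      using F(2) by (auto simp: locally_integrable_on_def)
    then have "(\<lambda>z. vnorm N (F z)) absolutely_integrable_on Q"
      by (rule set_integrable_subset[OF _ QL closure_subset])
    then show ?thesis
      using QL unfolding set_integrable_def by (subst integrable_restrict_space) auto
  qed
  have Fi: "integrable ?M (\<lambda>z. F z i)" if "i < N" for i
  proof (rule Bochner_Integration.integrable_bound[OF Fv Fm[OF that]])
    show "AE z in ?M. norm (F z i) \<le> norm (vnorm N (F z))"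
      using norm_le_vnorm[OF that, of "F _"] by (auto simp: vnorm_nonneg intro!: AE_I2)
  qed
  have Am: "(\<lambda>z. A z (Du z) i) \<in> borel_measurable ?M" if "i < N" for i
  proof -
    have "vmeasurable N (lebesgue_on D) (\<lambda>z. A z (Du z))"
      using ps by (intro caratheodory_composition_measurable[OF DL A[folded D_def]])
        (auto simp: parabolic_sobolev_def D_def)
    then show ?thesis using that by (auto simp: vmeasurable_def intro: restr)
  qed
  have A_le: "AE z in ?M. vnorm N (A z (Du z)) \<le> L * vnorm N (Du z)"
  proof -
    have "AE z in lborel. z \<in> D \<longrightarrow> (\<forall>\<xi>\<in>vecs N. vnorm N (A z \<xi>) \<le> L * vnorm N \<xi>)"
      using str DL by (auto simp: structure_conditions_def D_def[symmetric] AE_restrict_space_iff AE_completion_iff elim!: eventually_mono)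
    then show ?thesis
      unfolding AE_M
    proof eventually_elim
      case (elim z)
      have "Du z \<in> vecs N" if "z \<in> Q"
        using ps that QD by (auto simp: parabolic_sobolev_def D_def)
      then show ?case using elim QD by auto
    qed
  qed
  have Ai: "integrable ?M (\<lambda>z. A z (Du z) i)" if "i < N" for i
  proof (rule Bochner_Integration.integrable_bound[OF _ Am[OF that]])
    show "integrable ?M (\<lambda>z. L * vnorm N (Du z))" by (intro integrable_mult_right Duv)
    show "AE z in ?M. norm (A z (Du z) i) \<le> norm (L * vnorm N (Du z))"
      using A_le
    proof eventually_elim
      case (elim z)
      then show ?case
        using norm_le_vnorm[OF that, of "A z (Du z)"] L vnorm_nonneg[of N "Du z"] by simp
    qed
  qed

  obtain u' where u': "\<And>i. i < N \<Longrightarrow> integrable lborel (u' i)"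
    "AE z in lborel. z \<in> Q \<longrightarrow> (\<forall>i<N. u z i = u' i z)" "\<And>i z. i < N \<Longrightarrow> z \<notin> Q \<Longrightarrow> u' i z = 0"
    by (rule borel_representatives[where f="u" and N=N, OF Qm]) (erule ui, rule that)
  obtain Du' where Du': "\<And>i. i < N \<Longrightarrow> integrable lborel (Du' i)"
    "AE z in lborel. z \<in> Q \<longrightarrow> (\<forall>i<N. Du z i = Du' i z)" "\<And>i z. i < N \<Longrightarrow> z \<notin> Q \<Longrightarrow> Du' i z = 0"
    by (rule borel_representatives[where f="Du" and N=N, OF Qm]) (erule Dui, rule that)
  obtain A' where A': "\<And>i. i < N \<Longrightarrow> integrable lborel (A' i)"
    "AE z in lborel. z \<in> Q \<longrightarrow> (\<forall>i<N. A z (Du z) i = A' i z)" "\<And>i z. i < N \<Longrightarrow> z \<notin> Q \<Longrightarrow> A' i z = 0"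
    by (rule borel_representatives[where f="\<lambda>z. A z (Du z)" and N=N, OF Qm]) (erule Ai, rule that)
  obtain F' where F': "\<And>i. i < N \<Longrightarrow> integrable lborel (F' i)"
    "AE z in lborel. z \<in> Q \<longrightarrow> (\<forall>i<N. F z i = F' i z)" "\<And>i z. i < N \<Longrightarrow> z \<notin> Q \<Longrightarrow> F' i z = 0"
    by (rule borel_representatives[where f="F" and N=N, OF Qm]) (erule Fi, rule that)
  define H where "H i z = A' i z - F' i z" for i z
  have Hi: "integrable lborel (H i)" if "i < N" for i
    unfolding H_def[abs_def] using A'(1)[OF that] F'(1)[OF that] by (rule Bochner_Integration.integrable_diff)

  have slices: "AE t in lborel. t \<in> I \<longrightarrow> (\<forall>i<N. \<forall>\<phi>\<in>test_functions (ball x0 \<rho>). \<forall>v.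
      (LINT x|lborel. u' i (x, t) * frechet_derivative \<phi> (at x) v) = - (LINT x|lborel. (Du' i (x, t) \<bullet> v) * \<phi> x))"
  proof -
    have W: "AE t in lborel. t \<in> I \<longrightarrow> W1q_with_gradient N q B (\<lambda>x. u (x, t)) (\<lambda>x. Du (x, t))"
      using slice0 by (simp add: AE_restrict_space_iff AE_completion_iff I_def)
    have slice_int: "AE t in lborel. integrable lborel (\<lambda>x. F (x, t))" if "integrable lborel F"
      for F :: "(real^'n) \<times> real \<Rightarrow> 'b::euclidean_space"
      using that by (intro lborel_pair.AE_integrable_snd) (simp add: lborel_prod)
    have int: "AE t in lborel. \<forall>i<N. integrable lborel (\<lambda>x. u' i (x, t)) \<and> integrable lborel (\<lambda>x. Du' i (x, t))"
      by (subst AE_all_countable) (auto intro!: AE_impI AE_conjI slice_int u'(1) Du'(1))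
    from W int AE_lborel_slices[OF u'(2)] AE_lborel_slices[OF Du'(2)] show ?thesis
    proof eventually_elim
      case (elim t)
      show ?case
      proof (intro impI allI ballI)
        fix i \<phi> v assume t: "t \<in> I" and i: "i < N" and \<phi>: "\<phi> \<in> test_functions (ball x0 \<rho>)"
        show "(LINT x|lborel. u' i (x, t) * frechet_derivative \<phi> (at x) v) = - (LINT x|lborel. (Du' i (x, t) \<bullet> v) * \<phi> x)"
        proof (rule weak_gradient_borel[OF _ Bm])
          show "has_weak_gradient_on (\<lambda>x. u (x, t) i) (\<lambda>x. Du (x, t) i) B"
            using elim(1) t i by (auto simp: W1q_with_gradient_def)
          show "AE x in lborel. x \<in> B \<longrightarrow> u (x, t) i = u' i (x, t)"
            using elim(3) by eventually_elim (use t i QBI in auto)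
          show "AE x in lborel. x \<in> B \<longrightarrow> Du (x, t) i = Du' i (x, t)"
            using elim(4) by eventually_elim (use t i QBI in auto)
        qed (use elim(2) i u'(3) Du'(3) QBI \<phi> B_def in auto)
      qed
    qed
  qed
  have eqn: "(LINT z|lborel. u' i z * (\<eta> (fst z) * frechet_derivative \<theta> (at (snd z)) 1))
      = (LINT z|lborel. frechet_derivative \<eta> (at (fst z)) (H i z) * \<theta> (snd z))"
    if i: "i < N" and "\<eta> \<in> test_functions (ball x0 \<rho>)" "\<theta> \<in> test_functions I" for i \<eta> \<theta>
    unfolding H_def
  proof (rule weak_solution_borel[OF ws[folded D_def] i Dm])
    show "B \<times> I \<subseteq> D" using QD QBI by simp
    show "AE z in lborel. z \<in> B \<times> I \<longrightarrow> u z i = u' i z"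
      using u'(2) by eventually_elim (use i QBI in auto)
    show "AE z in lborel. z \<in> B \<times> I \<longrightarrow> A z (Du z) i = A' i z"
      using A'(2) by eventually_elim (use i QBI in auto)
    show "AE z in lborel. z \<in> B \<times> I \<longrightarrow> F z i = F' i z"
      using F'(2) by eventually_elim (use i QBI in auto)
  qed (use that u'(1,3) A'(1,3) F'(1,3) QBI B_def in auto)

  define \<kappa> where "\<kappa> = (exp (-16/3) / 4 ^ CARD('n) :: real)"
  have \<kappa>: "\<kappa> = exp (-16/3) / 4 ^ DIM(real^'n)" "0 < \<kappa>" by (simp_all add: \<kappa>_def)
  obtain a where a: "(\<integral>\<^sup>+z. ennreal (vnorm N (\<lambda>i. u' i z - a i) powr q) * indicator (ball x0 \<rho> \<times> I) z \<partial>lborel)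
      \<le> ennreal (2 powr q * 2 ^ DIM(real^'n) * (2 * \<rho> / \<kappa>) powr q) *
        ((\<integral>\<^sup>+z. ennreal (vnorm N (\<lambda>i. Du' i z) powr q) \<partial>lborel) +
         ennreal (\<mu> * ((LINT z|lborel. vnorm N (\<lambda>i. H i z)) / \<mu>) powr q))"
    by (rule cylinder_oscillation[OF q \<rho> _ _ _ I_def slices _ \<kappa>(1) \<mu>_def, where H=H])
      (erule u'(1), erule Du'(1), erule Hi, erule (2) eqn, rule that)
  define h where "h = (LINT z|lborel. vnorm N (\<lambda>i. H i z))"
  define dq where "dq = (LINT z|?M. vnorm N (Du z) powr q)"
  define d where "d = (LINT z|?M. vnorm N (Du z))"
  define f where "f = (LINT z|?M. vnorm N (F z))"
  have nn: "0 \<le> h" "0 \<le> dq" "0 \<le> d" "0 \<le> f"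
    by (simp_all add: h_def dq_def d_def f_def vnorm_nonneg)
  let ?K = "2 powr q * 2 ^ CARD('n) * (2 * \<rho> / \<kappa>) powr q"
  have osc: "(\<integral>\<^sup>+z. ennreal (vnorm N (\<lambda>i. u z i - a i) powr q) \<partial>?M) \<le> ennreal (?K * (dq + \<mu> * (h / \<mu>) powr q))"
  proof -
    have "(\<integral>\<^sup>+z. ennreal (vnorm N (\<lambda>i. u z i - a i) powr q) \<partial>?M) =
        (\<integral>\<^sup>+z. ennreal (vnorm N (\<lambda>i. u' i z - a i) powr q) * indicator Q z \<partial>lborel)"
    proof (rule nn_integral_lebesgue_on_eq_lborel[OF Qm])
      show "AE z in lborel. z \<in> Q \<longrightarrow> ennreal (vnorm N (\<lambda>i. u z i - a i) powr q) = ennreal (vnorm N (\<lambda>i. u' i z - a i) powr q)"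
        using u'(2)
      proof eventually_elim
        case (elim z)
        then have "z \<in> Q \<Longrightarrow> vnorm N (\<lambda>i. u z i - a i) = vnorm N (\<lambda>i. u' i z - a i)"
          by (intro vnorm_cong) auto
        then show ?case by simp
      qed
    qed
    also have "\<dots> \<le> ennreal ?K * ((\<integral>\<^sup>+z. ennreal (vnorm N (\<lambda>i. Du' i z) powr q) \<partial>lborel) + ennreal (\<mu> * (h / \<mu>) powr q))"
      using a by (simp add: h_def QBI B_def)
    also have "(\<integral>\<^sup>+z. ennreal (vnorm N (\<lambda>i. Du' i z) powr q) \<partial>lborel) = ennreal dq"
    proof -
      have "(\<integral>\<^sup>+z. ennreal (vnorm N (\<lambda>i. Du' i z) powr q) \<partial>lborel) = (\<integral>\<^sup>+z. ennreal (vnorm N (\<lambda>i. Du' i z) powr q) * indicator Q z \<partial>lborel)"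
      proof (rule nn_integral_cong)
        fix z
        have "vnorm N (\<lambda>i. Du' i z) = 0" if "z \<notin> Q"
          using Du'(3) that by (simp add: vnorm_def L2_set_def)
        then show "ennreal (vnorm N (\<lambda>i. Du' i z) powr q) = ennreal (vnorm N (\<lambda>i. Du' i z) powr q) * indicator Q z"
          by (auto simp: indicator_def)
      qed
      also have "\<dots> = (\<integral>\<^sup>+z. ennreal (vnorm N (Du z) powr q) \<partial>?M)"
      proof (rule nn_integral_lebesgue_on_eq_lborel[OF Qm, symmetric])
        show "AE z in lborel. z \<in> Q \<longrightarrow> ennreal (vnorm N (Du z) powr q) = ennreal (vnorm N (\<lambda>i. Du' i z) powr q)"
          using Du'(2)
        proof eventually_elim
          case (elim z)
          then have "z \<in> Q \<Longrightarrow> vnorm N (Du z) = vnorm N (\<lambda>i. Du' i z)"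
            by (intro vnorm_cong) auto
          then show ?case by simp
        qed
      qed
      also have "\<dots> = ennreal dq"
        unfolding dq_def by (rule nn_integral_eq_integral[OF Duq]) simp
      finally show ?thesis .
    qed
    finally show ?thesis
      using nn \<mu>_pos by (simp add: ennreal_mult[symmetric] ennreal_plus[symmetric] del: ennreal_plus)
  qed
  have h_le: "h \<le> L * d + f"
  proof -
    have "(LINT z|?M. vnorm N (\<lambda>i. A z (Du z) i - F z i)) = h"
      unfolding h_def
    proof (rule integral_lebesgue_on_eq_lborel[OF Qm])
      show "(\<lambda>z. vnorm N (\<lambda>i. H i z)) \<in> borel_measurable borel"
        using borel_measurable_integrable[OF Hi] by (intro vnorm_measurable) simp
      show "AE z in lborel. z \<in> Q \<longrightarrow> vnorm N (\<lambda>i. A z (Du z) i - F z i) = vnorm N (\<lambda>i. H i z)"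
        using A'(2) F'(2) by eventually_elim (auto simp: H_def intro!: vnorm_cong)
      show "vnorm N (\<lambda>i. H i z) = 0" if "z \<notin> Q" for z
        using A'(3) F'(3) that by (simp add: vnorm_def L2_set_def H_def)
    qed
    moreover have "(LINT z|?M. vnorm N (\<lambda>i. A z (Du z) i - F z i)) \<le> (LINT z|?M. L * vnorm N (Du z) + vnorm N (F z))"
    proof (rule integral_mono_AE)
      show "integrable ?M (\<lambda>z. vnorm N (\<lambda>i. A z (Du z) i - F z i))"
        by (rule integrable_vnorm) (rule Bochner_Integration.integrable_diff[OF Ai Fi])
      show "integrable ?M (\<lambda>z. L * vnorm N (Du z) + vnorm N (F z))"
        by (intro Bochner_Integration.integrable_add integrable_mult_right Duv Fv)
      show "AE z in ?M. vnorm N (\<lambda>i. A z (Du z) i - F z i) \<le> L * vnorm N (Du z) + vnorm N (F z)"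
        using A_le
      proof eventually_elim
        case (elim z)
        have "vnorm N (\<lambda>i. A z (Du z) i - F z i) \<le> vnorm N (A z (Du z)) + vnorm N (\<lambda>i. - F z i)"
          using vnorm_add_le[of N "A z (Du z)" "\<lambda>i. - F z i"] by simp
        also have "vnorm N (\<lambda>i. - F z i) = vnorm N (F z)"
          by (simp add: vnorm_def)
        finally show ?case using elim by simp
      qed
    qed
    ultimately show ?thesis
      using Duv Fv by (simp add: d_def f_def)
  qed
  have d_le: "(d / \<mu>) powr q \<le> dq / \<mu>"
  proof -
    have "ennreal (d powr q) \<le> ennreal (\<mu> powr (q - 1)) * (\<integral>\<^sup>+z. ennreal (vnorm N (Du z) powr q) \<partial>?M)"
      using M.jensen_powr[OF q Duv vnorm_nonneg] unfolding mM d_def .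
    also have "(\<integral>\<^sup>+z. ennreal (vnorm N (Du z) powr q) \<partial>?M) = ennreal dq"
      unfolding dq_def by (rule nn_integral_eq_integral[OF Duq]) simp
    finally have "d powr q \<le> \<mu> powr (q - 1) * dq"
      using nn by (simp add: ennreal_mult[symmetric])
    then have "d powr q / \<mu> powr q \<le> \<mu> powr (q - 1) * dq / \<mu> powr q"
      by (intro divide_right_mono) auto
    also have "\<dots> = dq / \<mu>"
      using \<mu>_pos by (simp add: powr_diff)
    finally show ?thesis
      using nn \<mu>_pos by (simp add: powr_divide)
  qed
  have h_powr: "(h / \<mu>) powr q \<le> 2 powr q * (L powr q * (dq / \<mu>) + (f / \<mu>) powr q)"
  proof -
    have "(h / \<mu>) powr q \<le> (L * (d / \<mu>) + f / \<mu>) powr q"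
      using h_le nn \<mu>_pos q by (intro powr_mono2) (auto simp: add_divide_distrib[symmetric] divide_right_mono)
    also have "\<dots> \<le> 2 powr q * ((L * (d / \<mu>)) powr q + (f / \<mu>) powr q)"
      using nn \<mu>_pos L q by (intro powr_add_le) auto
    also have "(L * (d / \<mu>)) powr q = L powr q * (d / \<mu>) powr q"
      by (rule powr_mult)
    also have "2 powr q * (L powr q * (d / \<mu>) powr q + (f / \<mu>) powr q) \<le> 2 powr q * (L powr q * (dq / \<mu>) + (f / \<mu>) powr q)"
      by (intro mult_left_mono add_right_mono d_le) auto
    finally show ?thesis .
  qed
  let ?b = "\<lambda>i. (LINT w|?M. u w i) / \<mu>"
  have b: "avg Q (\<lambda>w. u w i) = ?b i" for i
    by (simp add: avg_def mQ)
  have "(\<integral>\<^sup>+z. ennreal (vnorm N (\<lambda>i. u z i - ?b i) powr q) \<partial>?M)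
      \<le> ennreal (2 powr (q + 1)) * (\<integral>\<^sup>+z. ennreal (vnorm N (\<lambda>i. u z i - a i) powr q) \<partial>?M)"
    using M.oscillation_about_mean_le[where f="\<lambda>i z. u z i" and N=N and a=a, OF q _ ui] \<mu>_pos
    unfolding mM by simp
  also have "\<dots> \<le> ennreal (2 powr (q + 1)) * ennreal (?K * (dq + \<mu> * (h / \<mu>) powr q))"
    by (intro mult_left_mono osc) auto
  also have "\<dots> = ennreal (2 powr (q + 1) * (?K * (dq + \<mu> * (h / \<mu>) powr q)))"
    using nn \<mu>_pos by (simp add: ennreal_mult[symmetric])
  finally have "(LINT z|?M. vnorm N (\<lambda>i. u z i - ?b i) powr q) \<le> 2 powr (q + 1) * (?K * (dq + \<mu> * (h / \<mu>) powr q))"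
    using nn \<mu>_pos by (intro integral_real_bounded) auto
  also have "\<dots> \<le> 2 powr (q + 1) * (?K * (dq + \<mu> * (2 powr q * (L powr q * (dq / \<mu>) + (f / \<mu>) powr q))))"
    using \<mu>_pos by (intro mult_left_mono add_left_mono h_powr) auto
  finally have main: "(LINT z|?M. vnorm N (\<lambda>i. u z i - ?b i) powr q)
      \<le> 2 powr (q + 1) * (?K * (dq + \<mu> * (2 powr q * (L powr q * (dq / \<mu>) + (f / \<mu>) powr q))))" .
  define K0 where "K0 = 2 powr (q + 1) * (2 powr q * 2 ^ CARD('n) * (2 / \<kappa>) powr q)"
  have K0: "0 \<le> K0" by (simp add: K0_def)
  have Kr: "?K / \<rho> powr q = 2 powr q * 2 ^ CARD('n) * (2 / \<kappa>) powr q"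
    using \<rho> \<kappa>(2) by (simp add: powr_mult powr_divide)
  have "avg Q (\<lambda>z. vnorm N (\<lambda>i. u z i - avg Q (\<lambda>w. u w i)) powr q / \<rho> powr q)
      = (LINT z|?M. vnorm N (\<lambda>i. u z i - ?b i) powr q) / \<rho> powr q / \<mu>"
    unfolding b by (simp add: avg_def mQ)
  also have "\<dots> \<le> 2 powr (q + 1) * (?K * (dq + \<mu> * (2 powr q * (L powr q * (dq / \<mu>) + (f / \<mu>) powr q)))) / \<rho> powr q / \<mu>"
    using main \<mu>_pos by (intro divide_right_mono) auto
  also have "\<dots> = 2 powr (q + 1) * (?K / \<rho> powr q) * ((dq + \<mu> * (2 powr q * (L powr q * (dq / \<mu>) + (f / \<mu>) powr q))) / \<mu>)"
    by simp
  also have "\<dots> = K0 * ((1 + 2 powr q * L powr q) * (dq / \<mu>) + 2 powr q * (f / \<mu>) powr q)"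
    unfolding Kr K0_def using \<mu>_pos by (simp add: add_divide_distrib algebra_simps)
  also have "\<dots> \<le> K0 * ((1 + 2 powr q * L powr q + 2 powr q) * (dq / \<mu>) + (1 + 2 powr q * L powr q + 2 powr q) * (f / \<mu>) powr q)"
    using nn \<mu>_pos by (intro mult_left_mono[OF add_mono[OF mult_right_mono mult_right_mono] K0]) auto
  also have "\<dots> = c * (dq / \<mu>) + c * (f / \<mu>) powr q"
  proof -
    have "c = K0 * (1 + 2 powr q * L powr q + 2 powr q)"
      by (simp only: c parabolic_poincare_constant_def K0_def \<kappa>_def)
    moreover have "K0 * (S * v + S * w) = K0 * S * v + K0 * S * w" for S v w
      by (simp add: distrib_left mult.assoc)
    ultimately show ?thesis by (simp only:)
  qed
  finally show ?thesis
    by (simp add: avg_def mQ dq_def f_def)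
qed

theorem lemma3p2:
  fixes q L :: real
  assumes "1 \<le> q"
  shows "\<exists>c::real. \<forall>(N::nat) \<nu> (\<Omega> :: (real^'n) set) T A F u Du.
    N \<ge> 1 \<and> 0 < \<nu> \<and> \<nu> < L \<and>
    open \<Omega> \<and> connected \<Omega> \<and> bounded \<Omega> \<and> \<Omega> \<noteq> {} \<and> 0 < T \<and>
    caratheodory_field N (\<Omega> \<times> {0<..<T}) A \<and>
    structure_conditions N \<nu> L (\<Omega> \<times> {0<..<T}) A \<and>
    F \<in> \<Omega> \<times> {0<..<T} \<rightarrow> vecs N \<and>
    vmeasurable N (lebesgue_on (\<Omega> \<times> {0<..<T})) F \<and>
    locally_integrable_on (\<lambda>z. vnorm N (F z)) (\<Omega> \<times> {0<..<T}) \<and>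
    parabolic_sobolev N q \<Omega> T u Du \<and>
    weak_solution N (\<Omega> \<times> {0<..<T}) A F u Du \<longrightarrow>
    (\<forall>\<rho> x0 t0. let Q = cylinder \<rho> x0 t0 in
      0 < \<rho> \<and> compactly_contained Q (\<Omega> \<times> {0<..<T}) \<longrightarrow>
      avg Q (\<lambda>z. vnorm N (\<lambda>i. u z i - avg Q (\<lambda>w. u w i)) powr q / \<rho> powr q)
        \<le> c * avg Q (\<lambda>z. vnorm N (Du z) powr q) + c * (avg Q (\<lambda>z. vnorm N (F z))) powr q)"
proof (rule exI[where x="parabolic_poincare_constant CARD('n) q L"], unfold Let_def, intro allI impI, elim conjE)
  fix N \<nu> T A F \<rho> x0 t0 and \<Omega> :: "(real^'n) set"
    and u :: "(real^'n) \<times> real \<Rightarrow> nat \<Rightarrow> real" and Du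
  assume "0 < \<nu>" "\<nu> < L" and hyps: "open \<Omega>" "caratheodory_field N (\<Omega> \<times> {0<..<T}) A"
    "structure_conditions N \<nu> L (\<Omega> \<times> {0<..<T}) A"
    "vmeasurable N (lebesgue_on (\<Omega> \<times> {0<..<T})) F"
    "locally_integrable_on (\<lambda>z. vnorm N (F z)) (\<Omega> \<times> {0<..<T})"
    "parabolic_sobolev N q \<Omega> T u Du" "weak_solution N (\<Omega> \<times> {0<..<T}) A F u Du"
    "0 < \<rho>" "compactly_contained (cylinder \<rho> x0 t0) (\<Omega> \<times> {0<..<T})"
  then have "0 < L" by linarith
  from parabolic_poincare_cylinder[OF assms this hyps refl refl]
  show "avg (cylinder \<rho> x0 t0) (\<lambda>z. vnorm N (\<lambda>i. u z i - avg (cylinder \<rho> x0 t0) (\<lambda>w. u w i)) powr q / \<rho> powr q)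
      \<le> parabolic_poincare_constant CARD('n) q L * avg (cylinder \<rho> x0 t0) (\<lambda>z. vnorm N (Du z) powr q)
        + parabolic_poincare_constant CARD('n) q L * (avg (cylinder \<rho> x0 t0) (\<lambda>z. vnorm N (F z))) powr q" .
qed

end
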